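(* Suppose $X$ is of bounded variation. For any $p,q\ge0$ and $v\le b\le x$: (i) $$\int_0^\infty\int_{(-\infty,-y)}W^{(q)}(y+u+b-v)\,\mathbb{W}^{(p)}(x-b-y)\,\Pi(du)\,dy$$ $$=(c-\delta)W^{(q)}(b-v)\mathbb{W}^{(p)}(x-b)-W^{(q)}(x-v)-\delta\int_b^x\mathbb{W}^{(p)}(x-y)W^{(q)\prime}(y-v)\,dy+(q-p)\int_b^x\mathbb{W}^{(p)}(x-z)W^{(q)}(z-v)\,dz;$$ (ii) $$\int_0^\infty\int_{(-\infty,-y)}Z^{(q)}(y+u+b-v)\,\mathbb{W}^{(p)}(x-b-y)\,\Pi(du)\,dy$$ $$=(c-\delta)Z^{(q)}(b-v)\mathbb{W}^{(p)}(x-b)-Z^{(q)}(x-v)-(p-q)\overline{\mathbb{W}}^{(p)}(x-b)+q\int_b^x\mathbb{W}^{(p)}(x-y)\left((q-p)\overline{W}^{(q)}(y-v)-\delta W^{(q)}(y-v)\right)dy;$$ (iii) $$\int_0^\infty\int_{(-\infty,-y)}\overline{Z}^{(q)}(y+u+b-v)\,\mathbb{W}^{(p)}(x-b-y)\,\Pi(du)\,dy$$ $$=(c-\delta)\overline{Z}^{(q)}(b-v)\mathbb{W}^{(p)}(x-b)-\overline{Z}^{(q)}(x-v)-\delta\int_b^x\mathbb{W}^{(p)}(x-y)Z^{(q)}(y-v)\,dy$$ $$\quad+(q-p)\int_b^x\mathbb{W}^{(p)}(x-y)\overline{Z}^{(q)}(y-v)\,dy+\psi'(0+)\overline{\ma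thbb{W}}^{(p)}(x-b).$$
   Context: $X=(X_t)_{t\ge0}$ is a spectrally negative Lévy process (no positive jumps, not the negative of a subordinator) with Lévy measure $\Pi$ on $(-\infty,0)$; in the bounded variation case $X_t=X_0+ct-S_t$ with $c>0$ and $S$ a driftless subordinator, and its Laplace exponent is $\psi(\theta)=c\theta+\int_{(-\infty,0)}(e^{\theta x}-1)\Pi(dx)$, $\theta\ge0$. Fix $b>0$ and $0\le\delta<c$. $Y_t:=X_t-\delta t$ is a spectrally negative Lévy process with Laplace exponent $\psi_Y(\theta)=\psi(\theta)-\delta\theta$. For $q\ge0$, $\Phi(q):=\sup\{\lambda\ge0:\psi(\lambda)=q\}$ and $\varphi(q):=\sup\{\lambda\ge0:\psi_Y(\lambda)=q\}$. $W^{(q)}$ (resp. $\mathbb{W}^{(q)}$) is the scale function of $X$ (resp. $Y$): zero on $(-\infty,0)$, continuous and increasing on $[0,\infty)$, with $\int_0^\infty e^{-\theta x}W^{(q)}(x)dx=1/(\psi(\theta)-q)$ for $\theta>\Phi(q)$ (resp. $\int_0^\infty e^{-\theta x}\mathbb{W}^{(q)}(x)dx=1/(\psi_Y(\theta)-q)$ for $\theta>\varphi(q)$). $W^{(q)\prime}$ denotes the derivative of $W^{(q)}$ on $(0,\infty)$ (defined a.e.). For $x\in\mathbb{R}$: $\overline{W}^{(q)}(x):=\int_0^xW^{(q)}(y)dy$, $\overline{\mathbb{W}}^{(q)}(x):=\int_0^x\mathbb{W}^{(q)}(y)dy$, $Z^{(q)}(x):=1+q\overline{W}^{(q)}(x)$,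 $\overline{Z}^{(q)}(x):=\int_0^xZ^{(q)}(z)dz$ (so $Z^{(q)}(x)=1$ and $\overline{Z}^{(q)}(x)=x$ for $x\le0$). Here $\psi'(0+)\in[-\infty,\infty)$, and in (iii) the convention $(-\infty)\cdot0=0$ is used if $\psi'(0+)=-\infty$. *)

theory Defs
  imports "HOL-Probability.Probability"
begin

definition levy_process :: "'w measure \<Rightarrow> (real \<Rightarrow> 'w \<Rightarrow> real) \<Rightarrow> bool" where
  "levy_process M L \<longleftrightarrow>
     prob_space M \<and>
     (\<forall>t\<ge>0. L t \<in> borel_measurable M) \<and>
     (AE \<omega> in M. L 0 \<omega> = 0) \<and>
     (\<forall>(t :: nat \<Rightarrow> real) n. 0 \<le> t 0 \<longrightarrow> mono t \<longrightarrow>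
        prob_space.indep_vars M (\<lambda>_. borel) (\<lambda>i \<omega>. L (t (Suc i)) \<omega> - L (t i) \<omega>) {..<n}) \<and>
     (\<forall>s\<ge>0. \<forall>h\<ge>0. distr M borel (\<lambda>\<omega>. L (s + h) \<omega> - L s \<omega>) = distr M borel (L h)) \<and>
     (AE \<omega> in M. \<forall>t\<ge>0.
        ((\<lambda>s. L s \<omega>) \<longlongrightarrow> L t \<omega>) (at_right t) \<and>
        (t > 0 \<longrightarrow> (\<exists>l. ((\<lambda>s. L s \<omega>) \<longlongrightarrow> l) (at_left t))))"

definition subordinator :: "'w measure \<Rightarrow> (real \<Rightarrow> 'w \<Rightarrow> real) \<Rightarrow> bool" where
  "subordinator M S \<longleftrightarrow> levy_process M S \<and> (AE \<omega> in M. mono_on {0..} (\<lambda>t. S t \<omega>))"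

text \<open>Levy measures of spectrally negative processes with paths of bounded variation.\<close>

definition bv_levy_measure :: "real measure \<Rightarrow> bool" where
  "bv_levy_measure \<nu> \<longleftrightarrow>
     sets \<nu> = sets borel \<and> emeasure \<nu> {0..} = 0 \<and>
     (\<integral>\<^sup>+ u. ennreal (min 1 \<bar>u\<bar>) \<partial>\<nu>) < \<infinity>"

text \<open>
  \<open>\<nu>\<close> lives on the negative half-line: it is the jump measure of \<open>- S\<close>, i.e. the image under
  \<open>u \<mapsto> - u\<close> of the usual Levy measure of the subordinator \<open>S\<close>. That \<open>S\<close> is driftless means that
  its Laplace exponent has no linear term.
\<close>

definition driftless_subordinator ::
    "'w measure \<Rightarrow> (real \<Rightarrow> 'w \<Rightarrow> real) \<Rightarrow> real measure \<Rightarrow> bool" where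
  "driftless_subordinator M S \<nu> \<longleftrightarrow>
     subordinator M S \<and> bv_levy_measure \<nu> \<and>
     (\<forall>t\<ge>0. \<forall>\<theta>\<ge>0.
        (LINT \<omega>|M. exp (- \<theta> * S t \<omega>)) = exp (- t * (LINT u:{..<0}|\<nu>. 1 - exp (\<theta> * u))))"

text \<open>
  A spectrally negative Levy process with paths of bounded variation, drift \<open>c\<close> and Levy measure
  \<open>\<nu>\<close>, started from an arbitrary point \<open>x0\<close>. Positive jumps are excluded because \<open>S\<close> is
  nondecreasing; \<open>X - x0\<close> is not the negative of a subordinator because \<open>c > 0\<close> and \<open>S\<close> has no drift.
\<close>

definition spectrally_negative_bv ::
    "'w measure \<Rightarrow> (real \<Rightarrow> 'w \<Rightarrow> real) \<Rightarrow> real \<Rightarrow> real measure \<Rightarrow> bool" where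
  "spectrally_negative_bv M X c \<nu> \<longleftrightarrow>
     c > 0 \<and>
     (\<exists>x0 S. driftless_subordinator M S \<nu> \<and>
        (\<forall>t\<ge>0. \<forall>\<omega>\<in>space M. X t \<omega> = x0 + c * t - S t \<omega>))"

text \<open>
  If \<open>spectrally_negative_bv M X c \<nu>\<close>, then for \<open>\<theta> \<ge> 0\<close> this is
  \<open>c * \<theta> + (LINT u:{..<0}|\<nu>. exp (\<theta> * u) - 1)\<close>.
\<close>

definition laplace_exponent :: "'w measure \<Rightarrow> (real \<Rightarrow> 'w \<Rightarrow> real) \<Rightarrow> real \<Rightarrow> real" where
  "laplace_exponent M X \<theta> = ln (LINT \<omega>|M. exp (\<theta> * (X 1 \<omega> - X 0 \<omega>)))"

definition right_inverse_exponent :: "(real \<Rightarrow> real) \<Rightarrow> real \<Rightarrow> real" where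
  "right_inverse_exponent \<psi> q = Sup {\<theta>. 0 \<le> \<theta> \<and> \<psi> \<theta> = q}"

text \<open>The limit of \<open>\<psi>'(\<theta>)\<close> as \<open>\<theta> \<down> 0\<close>, which may be \<open>- \<infinity>\<close>.\<close>

definition deriv_zero_plus :: "(real \<Rightarrow> real) \<Rightarrow> ereal" where
  "deriv_zero_plus \<psi> = Lim (at_right 0) (\<lambda>\<theta>. ereal (deriv \<psi> \<theta>))"

text \<open>
  Monotonicity is not required to be strict: for \<open>\<nu> = 0\<close> and \<open>q = 0\<close> the scale function is
  constant on \<open>{0..}\<close>.
\<close>

definition is_scale_function :: "(real \<Rightarrow> real) \<Rightarrow> real \<Rightarrow> (real \<Rightarrow> real) \<Rightarrow> bool" where
  "is_scale_function \<psi> q W \<longleftrightarrow>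
     (\<forall>x<0. W x = 0) \<and> continuous_on {0..} W \<and> mono_on {0..} W \<and>
     (\<forall>\<theta>>right_inverse_exponent \<psi> q.
        set_integrable lborel {0..} (\<lambda>x. exp (- \<theta> * x) * W x) \<and>
        (LBINT x:{0..}. exp (- \<theta> * x) * W x) = 1 / (\<psi> \<theta> - q))"

text \<open>In the next definitions the integrals are oriented, so that \<open>scale_Zbar q W x = x\<close> for \<open>x \<le> 0\<close>.\<close>

definition scale_Wbar :: "(real \<Rightarrow> real) \<Rightarrow> real \<Rightarrow> real" where
  "scale_Wbar W x = (LBINT y=0..x. W y)"

definition scale_Z :: "real \<Rightarrow> (real \<Rightarrow> real) \<Rightarrow> real \<Rightarrow> real" where
  "scale_Z q W x = 1 + q * scale_Wbar W x"

definition scale_Zbar :: "real \<Rightarrow> (real \<Rightarrow> real) \<Rightarrow> real \<Rightarrow> real" where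
  "scale_Zbar q W x = (LBINT z=0..x. scale_Z q W z)"

text \<open>
  Integral with values in the extended reals, needed because for \<open>\<psi>'(0+) = - \<infinity>\<close> the integral of
  \<open>scale_Zbar\<close> against \<open>\<nu>\<close> diverges to \<open>- \<infinity>\<close>. Since \<open>\<infinity> - a = \<infinity>\<close> for all \<open>a\<close> in \<^typ>\<open>ereal\<close>, a value
  below \<open>\<infinity>\<close> entails that the positive part has finite integral, so that no undefined
  \<open>\<infinity> - \<infinity>\<close> is involved.
\<close>

definition ext_integral :: "'a measure \<Rightarrow> 'a set \<Rightarrow> ('a \<Rightarrow> ereal) \<Rightarrow> ereal" where
  "ext_integral M A f =
     enn2ereal (\<integral>\<^sup>+ x\<in>A. e2ennreal (f x) \<partial>M) - enn2ereal (\<integral>\<^sup>+ x\<in>A. e2ennreal (- f x) \<partial>M)"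

end

theory Submission
  imports Defs
begin

text \<open>
  Write \<open>N y = \<nu> {..< - y}\<close>. Integrating by parts in the Laplace exponent gives \<open>\<psi> \<theta> = \<theta> (c - L N \<theta>)\<close>,
  so inverting the Laplace transforms of the scale functions yields the renewal equations
  \<open>c W = 1 + W * N + q (W * 1)\<close> and \<open>(c - \<delta>) V = 1 + V * N + p (V * 1)\<close>, where \<open>*\<close> is the
  convolution on the half-line and \<open>V\<close> is the scale function of \<open>Y\<close>.
  For \<open>F = W, Z, Zbar\<close>, \<open>f z = F (b - v + z)\<close> and \<open>K y\<close> the inner integral of the lemma without the factor
  \<open>V\<close>, the first equation gives \<open>c (f - f 0) = f * N - 1 * K + q (f * 1) + m (1 * 1)\<close>, with \<open>m = 0\<close> for
  \<open>W\<close> and \<open>Z\<close> and \<open>m = \<psi>'(0+)\<close> for \<open>Zbar\<close>. Convolving with \<open>V\<close> and eliminating \<open>V * N\<close> by means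
  of the second equation expresses \<open>1 * (V * K)\<close> as \<open>1 *\<close> the right-hand side; both factors
  are continuous, hence equal.
  For the integral of \<open>W'\<close>, the renewal equation provides a density of \<open>W\<close> that is continuous wherever
  \<open>N\<close> is, that is, off a countable set.
  If \<open>\<psi>'(0+) = -\<infinity>\<close>, both sides of the identity for \<open>Zbar\<close> are \<open>-\<infinity>\<close> for \<open>x > b\<close> and vanish for \<open>x = b\<close>.
\<close>

section \<open>Convolution on the half-line\<close>

text \<open>The singularity of the tail at 0 shapes the proof: if \<open>\<nu>\<close> is infinite,
  \<open>N\<close> is unbounded there and only locally integrable. Convolutions therefore pair a
  locally bounded left factor with a locally integrable right one, and the manipulations rest on one
  exchange law for two right factors. The overshoot integral \<open>K\<close> is likewise only
  locally integrable, so it is reached through the continuous function \<open>1 * K\<close>.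

  The equation for \<open>f\<close> does not differentiate \<open>F\<close>: for a jump
  \<open>u < 0\<close> the integrals of \<open>F\<close> over a window and over the window shifted
  by \<open>u\<close> overlap, and after cancellation there remain a piece at the upper end, which
  integrates to \<open>f * N\<close>, and a piece below the base point, which integrates to
  \<open>1 * K\<close>.

  The term with \<open>deriv W\<close> is delicate: a continuous increasing function may have a
  singular part, and then its derivative does not integrate back to it. The density is therefore
  constructed as the solution of the formally differentiated renewal equation, and uniqueness of
  solutions identifies its primitive with \<open>W\<close>.\<close>

definition half_conv :: "(real \<Rightarrow> real) \<Rightarrow> (real \<Rightarrow> real) \<Rightarrow> real \<Rightarrow> real" where
  "half_conv f g t = (LBINT y:{0..t}. f (t - y) * g y)"

definition loc_integrable :: "(real \<Rightarrow> real) \<Rightarrow> bool" where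
  "loc_integrable f \<longleftrightarrow> f \<in> borel_measurable borel \<and> (\<forall>t. set_integrable lborel {0..t} f)"

text \<open>Measurable functions that are continuous on the closed half-line belong to this class;
  the tail of an infinite Levy measure fails it near 0. Apart from measurability, values at negative
  arguments are unconstrained.\<close>

definition loc_bounded :: "(real \<Rightarrow> real) \<Rightarrow> bool" where
  "loc_bounded f \<longleftrightarrow> f \<in> borel_measurable borel \<and> (\<forall>t. \<exists>B. \<forall>y\<in>{0..t}. \<bar>f y\<bar> \<le> B)"

lemma loc_boundedE:
  assumes "loc_bounded f"
  obtains B where "0 \<le> B" "\<And>y. 0 \<le> y \<Longrightarrow> y \<le> t \<Longrightarrow> \<bar>f y\<bar> \<le> B"
proof -
  obtain B where B: "\<forall>y\<in>{0..t}. \<bar>f y\<bar> \<le> B"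
    using assms by (auto simp: loc_bounded_def)
  show ?thesis
    by (rule that[of "max 0 B"]) (use B in \<open>auto intro: max.coboundedI2\<close>)
qed

lemma loc_bounded_one: "loc_bounded (\<lambda>_. 1)"
  by (auto simp: loc_bounded_def)

lemma loc_bounded_measurable: "loc_bounded f \<Longrightarrow> f \<in> borel_measurable borel"
  by (simp add: loc_bounded_def)

lemma loc_integrable_measurable: "loc_integrable f \<Longrightarrow> f \<in> borel_measurable borel"
  by (simp add: loc_integrable_def)

lemma set_integrable_bounded_mult:
  fixes f g :: "'a \<Rightarrow> real"
  assumes g: "set_integrable M A g" and f: "f \<in> borel_measurable M" and A: "A \<in> sets M"
    and B: "\<And>y. y \<in> A \<Longrightarrow> \<bar>f y\<bar> \<le> B"
  shows "set_integrable M A (\<lambda>y. f y * g y)"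
  unfolding set_integrable_def
proof (rule Bochner_Integration.integrable_bound)
  show "integrable M (\<lambda>y. B * (indicator A y *\<^sub>R g y))"
    using g unfolding set_integrable_def by (rule integrable_mult_right)
  have "(\<lambda>y. f y * (indicator A y *\<^sub>R g y)) \<in> borel_measurable M"
    using borel_measurable_integrable[OF g[unfolded set_integrable_def]] f by simp
  then show "(\<lambda>y. indicator A y *\<^sub>R (f y * g y)) \<in> borel_measurable M"
    by (simp add: mult.left_commute)
  show "AE y in M. norm (indicator A y *\<^sub>R (f y * g y)) \<le> norm (B * (indicator A y *\<^sub>R g y))"
  proof (rule AE_I2)
    fix y
    have "\<bar>f y\<bar> * \<bar>g y\<bar> \<le> \<bar>B\<bar> * \<bar>g y\<bar>" if "y \<in> A"
      using B[OF that] by (intro mult_right_mono) auto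
    then show "norm (indicator A y *\<^sub>R (f y * g y)) \<le> norm (B * (indicator A y *\<^sub>R g y))"
      by (auto simp: abs_mult split: split_indicator)
  qed
qed

lemma set_integrable_const_Icc: "set_integrable lborel {a..b} (\<lambda>_. k :: real)" for a b :: real
proof -
  have "set_integrable lborel {a..b} (\<lambda>_. 1 :: real)"
    unfolding set_integrable_def by (simp add: integrable_real_indicator emeasure_lborel_Icc_eq)
  from set_integrable_mult_right[of k, OF this] show ?thesis by simp
qed

lemma loc_bounded_imp_integrable:
  assumes "loc_bounded f" shows "loc_integrable f"
  unfolding loc_integrable_def
proof (intro conjI allI)
  show m: "f \<in> borel_measurable borel" using assms by (rule loc_bounded_measurable)
  fix t
  obtain B where "\<And>y. 0 \<le> y \<Longrightarrow> y \<le> t \<Longrightarrow> \<bar>f y\<bar> \<le> B" by (rule loc_boundedE[OF assms]) auto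
  then have "set_integrable lborel {0..t} (\<lambda>y. f y * 1)"
    using m set_integrable_const_Icc[of 0 t 1] by (intro set_integrable_bounded_mult[where B=B]) auto
  then show "set_integrable lborel {0..t} f" by simp
qed

lemma loc_bounded_of_continuous:
  assumes "f \<in> borel_measurable borel" and c: "continuous_on {0..} f"
  shows "loc_bounded f"
  unfolding loc_bounded_def
proof (intro conjI allI assms)
  fix t
  have "compact (f ` {0..t})" by (intro compact_continuous_image continuous_on_subset[OF c]) auto
  then show "\<exists>B. \<forall>y\<in>{0..t}. \<bar>f y\<bar> \<le> B"
    by (metis bounded_iff compact_imp_bounded imageI real_norm_def)
qed

lemma half_conv_integrable:
  assumes f: "loc_bounded f" and g: "loc_integrable g"
  shows "set_integrable lborel {0..t} (\<lambda>y. f (t - y) * g y)"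
proof -
  obtain B where B: "\<And>y. 0 \<le> y \<Longrightarrow> y \<le> t \<Longrightarrow> \<bar>f y\<bar> \<le> B" by (rule loc_boundedE[OF f]) auto
  show ?thesis
  proof (rule set_integrable_bounded_mult)
    show "set_integrable lborel {0..t} g" using g by (simp add: loc_integrable_def)
    show "(\<lambda>y. f (t - y)) \<in> borel_measurable lborel"
      using loc_bounded_measurable[OF f] by simp
    show "\<bar>f (t - y)\<bar> \<le> B" if "y \<in> {0..t}" for y using that B by auto
  qed auto
qed

lemma half_conv_measurable:
  assumes f: "f \<in> borel_measurable borel" and g: "g \<in> borel_measurable borel"
  shows "half_conv f g \<in> borel_measurable borel"
proof -
  note [measurable] = f g
  \<comment> \<open>Here the range of integration depends on \<open>t\<close>. Written as a
    conditional, the integrand is visibly jointly measurable in \<open>t\<close> and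
    \<open>y\<close>.\<close>
  have "(\<lambda>t. LINT y|lborel. (if 0 \<le> y \<and> y \<le> t then f (t - y) * g y else 0)) \<in> borel_measurable borel"
    by measurable
  moreover have "half_conv f g = (\<lambda>t. LINT y|lborel. (if 0 \<le> y \<and> y \<le> t then f (t - y) * g y else 0))"
    by (auto simp: half_conv_def set_lebesgue_integral_def indicator_def fun_eq_iff
        intro!: Bochner_Integration.integral_cong)
  ultimately show ?thesis by simp
qed

lemma abs_half_conv_le:
  assumes f: "loc_bounded f" and g: "loc_integrable g"
    and B: "\<And>y. 0 \<le> y \<Longrightarrow> y \<le> T \<Longrightarrow> \<bar>f y\<bar> \<le> B" "0 \<le> B" and t: "t \<le> T"
  shows "\<bar>half_conv f g t\<bar> \<le> B * (LBINT y:{0..T}. \<bar>g y\<bar>)"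
proof -
  have gi: "set_integrable lborel {0..T} (\<lambda>y. \<bar>g y\<bar>)"
    using g by (auto simp: loc_integrable_def intro: set_integrable_abs)
  have "\<bar>half_conv f g t\<bar> \<le> (LBINT y:{0..t}. \<bar>f (t - y) * g y\<bar>)"
    using set_integral_norm_bound[OF half_conv_integrable[OF f g, of t]] by (simp add: half_conv_def)
  also have "\<dots> \<le> (LBINT y:{0..T}. B * \<bar>g y\<bar>)"
    unfolding set_lebesgue_integral_def
  proof (rule integral_mono)
    show "integrable lborel (\<lambda>y. indicator {0..t} y *\<^sub>R \<bar>f (t - y) * g y\<bar>)"
      using set_integrable_abs[OF half_conv_integrable[OF f g, of t]] by (simp add: set_integrable_def)
    show "integrable lborel (\<lambda>y. indicator {0..T} y *\<^sub>R (B * \<bar>g y\<bar>))"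
      using set_integrable_mult_right[of B, OF gi] by (simp add: set_integrable_def)
    show "indicator {0..t} y *\<^sub>R \<bar>f (t - y) * g y\<bar> \<le> indicator {0..T} y *\<^sub>R (B * \<bar>g y\<bar>)" for y
      using B t by (auto simp: abs_mult intro!: mult_right_mono split: split_indicator)
  qed
  finally show ?thesis by simp
qed

lemma loc_bounded_half_conv:
  assumes f: "loc_bounded f" and g: "loc_integrable g"
  shows "loc_bounded (half_conv f g)"
  unfolding loc_bounded_def
proof (intro conjI allI)
  show "half_conv f g \<in> borel_measurable borel"
    by (intro half_conv_measurable loc_bounded_measurable loc_integrable_measurable f g)
  fix T
  obtain B where "\<And>y. 0 \<le> y \<Longrightarrow> y \<le> T \<Longrightarrow> \<bar>f y\<bar> \<le> B" "0 \<le> B" by (rule loc_boundedE[OF f]) auto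
  then have "\<forall>y\<in>{0..T}. \<bar>half_conv f g y\<bar> \<le> B * (LBINT y:{0..T}. \<bar>g y\<bar>)"
    by (auto intro!: abs_half_conv_le f g)
  then show "\<exists>B. \<forall>y\<in>{0..T}. \<bar>half_conv f g y\<bar> \<le> B" by blast
qed

text \<open>The reflection \<open>y -> t - y\<close> preserves Lebesgue measure. If the integrand is
  not integrable, both sides take the default value 0.\<close>

lemma half_conv_commute: "half_conv f g t = half_conv g f t"
proof -
  have "half_conv f g t = (LINT y|lborel. indicator {0..t} y * (f (t - y) * g y))"
    by (simp add: half_conv_def set_lebesgue_integral_def)
  also have "\<dots> = (LINT y|lborel. indicator {0..t} (t - y) * (f (t - (t - y)) * g (t - y)))"
    using lborel_integral_real_affine[of "-1" "\<lambda>y. indicator {0..t} y * (f (t - y) * g y)" t] by simp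
  also have "\<dots> = half_conv g f t"
    by (auto simp: half_conv_def set_lebesgue_integral_def indicator_def intro!: Bochner_Integration.integral_cong)
  finally show ?thesis .
qed

lemma half_conv_cong:
  assumes "\<And>y. 0 \<le> y \<Longrightarrow> y \<le> t \<Longrightarrow> f y = f' y" "\<And>y. 0 \<le> y \<Longrightarrow> y \<le> t \<Longrightarrow> g y = g' y"
  shows "half_conv f g t = half_conv f' g' t"
  unfolding half_conv_def by (rule set_lebesgue_integral_cong) (auto simp: assms)

lemma half_conv_add_left:
  assumes "loc_bounded f" "loc_bounded f'" "loc_integrable g"
  shows "half_conv (\<lambda>y. f y + f' y) g t = half_conv f g t + half_conv f' g t"
  unfolding half_conv_def distrib_right using assms
  by (intro set_integral_add half_conv_integrable)

lemma half_conv_mult_left: "half_conv (\<lambda>y. k * f y) g t = k * half_conv f g t"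
  by (simp add: half_conv_def mult.assoc)

section \<open>Fubini and continuity for convolutions\<close>

lemma (in pair_sigma_finite) integrable_pair_mult:
  fixes u v :: "_ \<Rightarrow> real"
  assumes u: "integrable M1 u" and v: "integrable M2 v"
  shows "integrable (M1 \<Otimes>\<^sub>M M2) (\<lambda>(x, y). u x * v y)"
proof (rule Fubini_integrable)
  have "u \<in> borel_measurable M1" "v \<in> borel_measurable M2" using u v by auto
  then show "(\<lambda>(x, y). u x * v y) \<in> borel_measurable (M1 \<Otimes>\<^sub>M M2)" by measurable
  show "integrable M1 (\<lambda>x. \<integral>y. norm (case (x, y) of (x, y) \<Rightarrow> u x * v y) \<partial>M2)"
    using u by (simp add: abs_mult)
  show "AE x in M1. integrable M2 (\<lambda>y. case (x, y) of (x, y) \<Rightarrow> u x * v y)"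
    using v by simp
qed

text \<open>Young's inequality for integrable functions: by translation invariance the integral of
  \<open>|f (s - y)|\<close> over \<open>s\<close> does not depend on \<open>y\<close>. It justifies
  Fubini for Laplace transforms, where the factors are integrable but possibly unbounded.\<close>

lemma integrable_shear_mult:
  fixes f g :: "real \<Rightarrow> real"
  assumes f: "integrable lborel f" and g: "integrable lborel g"
  shows "integrable (lborel \<Otimes>\<^sub>M lborel) (\<lambda>(y, s). f (s - y) * g y)"
proof (rule lborel_pair.Fubini_integrable)
  have [measurable]: "f \<in> borel_measurable borel" "g \<in> borel_measurable borel"
    using borel_measurable_integrable[OF f] borel_measurable_integrable[OF g] by simp_all
  show "(\<lambda>(y, s). f (s - y) * g y) \<in> borel_measurable (lborel \<Otimes>\<^sub>M lborel)" by measurable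
  have "integrable lborel (\<lambda>y. (LINT s|lborel. \<bar>f s\<bar>) * \<bar>g y\<bar>)" using g by simp
  moreover have "(LINT s|lborel. \<bar>f (s - y)\<bar>) = (LINT s|lborel. \<bar>f s\<bar>)" for y
    using lborel_integral_real_affine[of 1 "\<lambda>s. \<bar>f s\<bar>" "-y"] by (simp add: add.commute)
  ultimately show "integrable lborel (\<lambda>y. LINT s|lborel. norm (case (y, s) of (y, s) \<Rightarrow> f (s - y) * g y))"
    by (simp add: abs_mult)
  show "AE y in lborel. integrable lborel (\<lambda>s. case (y, s) of (y, s) \<Rightarrow> f (s - y) * g y)"
    using lborel_integrable_real_affine[OF f, of 1 "-y" for y] by (simp add: add.commute)
qed

text \<open>Associativity and commutativity in one law. Both sides are integrals of
  \<open>f (t - y - z) * k z * g y\<close> over the triangle \<open>0 <= y\<close>,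
  \<open>0 <= z\<close>, \<open>y + z <= t\<close>, in the two possible orders. The bound on
  \<open>f\<close> dominates the integrand by a product of integrable functions, so \<open>g\<close>
  and \<open>k\<close> may be singular.\<close>

lemma half_conv_right_commute:
  assumes f: "loc_bounded f" and g: "loc_integrable g" and k: "loc_integrable k"
  shows "half_conv (half_conv f k) g t = half_conv (half_conv f g) k t"
proof -
  have [measurable]: "f \<in> borel_measurable borel" "g \<in> borel_measurable borel" "k \<in> borel_measurable borel"
    using assms by (auto simp: loc_bounded_def loc_integrable_def)
  define F where "F = (\<lambda>y z. if 0 \<le> y \<and> 0 \<le> z \<and> y + z \<le> t then f (t - y - z) * k z * g y else 0)"
  obtain B where B: "\<And>y. 0 \<le> y \<Longrightarrow> y \<le> t \<Longrightarrow> \<bar>f y\<bar> \<le> B" "0 \<le> B" by (rule loc_boundedE[OF f]) auto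
  have int: "integrable (lborel \<Otimes>\<^sub>M lborel) (\<lambda>(y, z). F y z)"
  proof (rule Bochner_Integration.integrable_bound)
    have "integrable lborel (\<lambda>y. B * (indicator {0..t} y *\<^sub>R g y))" "integrable lborel (\<lambda>z. indicator {0..t} z *\<^sub>R k z)"
      using g k by (auto simp: loc_integrable_def set_integrable_def)
    then show "integrable (lborel \<Otimes>\<^sub>M lborel) (\<lambda>(y, z). (B * (indicator {0..t} y *\<^sub>R g y)) * (indicator {0..t} z *\<^sub>R k z))"
      by (rule lborel_pair.integrable_pair_mult)
    show "(\<lambda>(y, z). F y z) \<in> borel_measurable (lborel \<Otimes>\<^sub>M lborel)"
      unfolding F_def by measurable
    have "norm (F y z) \<le> norm ((B * (indicator {0..t} y *\<^sub>R g y)) * (indicator {0..t} z *\<^sub>R k z))" for y z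
    proof (cases "0 \<le> y \<and> 0 \<le> z \<and> y + z \<le> t")
      case True
      then have "\<bar>f (t - y - z)\<bar> * \<bar>k z\<bar> * \<bar>g y\<bar> \<le> B * \<bar>k z\<bar> * \<bar>g y\<bar>"
        by (intro mult_right_mono B) auto
      then show ?thesis using True B by (simp add: F_def abs_mult mult_ac)
    qed (auto simp: F_def)
    then show "AE x in lborel \<Otimes>\<^sub>M lborel. norm (case x of (y, z) \<Rightarrow> F y z) \<le>
      norm (case x of (y, z) \<Rightarrow> (B * (indicator {0..t} y *\<^sub>R g y)) * (indicator {0..t} z *\<^sub>R k z))"
      by auto
  qed
  have "half_conv (half_conv f k) g t = (LINT y|lborel. LINT z|lborel. F y z)"
    unfolding half_conv_def set_lebesgue_integral_def
  proof (intro Bochner_Integration.integral_cong refl)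
    fix y :: real
    have "indicator {0..t} y *\<^sub>R ((LINT z|lborel. indicator {0..t - y} z *\<^sub>R (f (t - y - z) * k z)) * g y)
      = (LINT z|lborel. indicator {0..t} y * ((indicator {0..t - y} z * (f (t - y - z) * k z)) * g y))"
      by simp
    also have "\<dots> = (LINT z|lborel. F y z)"
      by (intro Bochner_Integration.integral_cong) (auto simp: F_def split: split_indicator)
    finally show "indicator {0..t} y *\<^sub>R ((LINT z|lborel. indicator {0..t - y} z *\<^sub>R (f (t - y - z) * k z)) * g y)
       = (LINT z|lborel. F y z)" .
  qed
  also have "\<dots> = (LINT z|lborel. LINT y|lborel. F y z)"
    using lborel_pair.Fubini_integral[OF int] by simp
  also have "\<dots> = half_conv (half_conv f g) k t"
    unfolding half_conv_def set_lebesgue_integral_def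
  proof (intro Bochner_Integration.integral_cong refl)
    fix z :: real
    have "(LINT y|lborel. F y z) = (LINT y|lborel. indicator {0..t} z * ((indicator {0..t - z} y * (f (t - z - y) * g y)) * k z))"
      by (intro Bochner_Integration.integral_cong) (auto simp: F_def algebra_simps split: split_indicator)
    also have "\<dots> = indicator {0..t} z *\<^sub>R ((LINT y|lborel. indicator {0..t - z} y *\<^sub>R (f (t - z - y) * g y)) * k z)"
      by simp
    finally show "(LINT y|lborel. F y z) = indicator {0..t} z *\<^sub>R ((LINT y|lborel. indicator {0..t - z} y *\<^sub>R (f (t - z - y) * g y)) * k z)" .
  qed
  finally show ?thesis .
qed

text \<open>Dominated convergence: along \<open>u n\<close> tending to \<open>a\<close> the
  integrand converges for every \<open>y\<close> except possibly \<open>y = a\<close>, where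
  membership in the moving interval can oscillate.\<close>

lemma half_conv_continuous:
  assumes f: "loc_bounded f" "continuous_on {0..} f" and g: "loc_integrable g"
  shows "continuous_on {0..} (half_conv f g)"
proof (rule continuous_on_sequentiallyI)
  fix u :: "nat \<Rightarrow> real" and a :: real
  assume u: "\<forall>n. u n \<in> {0..}" and a: "a \<in> {0..}" and lim: "u \<longlonglongrightarrow> a"
  let ?g = "\<lambda>n y. indicator {0..u n} y * (f (u n - y) * g y)"
  have [measurable]: "f \<in> borel_measurable borel" "g \<in> borel_measurable borel"
    using assms by (auto simp: loc_bounded_def loc_integrable_def)
  obtain T where T: "\<And>n. u n \<le> T"
    using Bseq_eq_bounded[of u] convergent_imp_Bseq[of u] lim
    by (metis convergent_def Bseq_bdd_above bdd_above_def rangeI)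
  have aT: "a \<le> T" using lim T by (auto intro: LIMSEQ_le_const2)
  obtain B where B: "\<And>y. 0 \<le> y \<Longrightarrow> y \<le> T \<Longrightarrow> \<bar>f y\<bar> \<le> B" "0 \<le> B" by (rule loc_boundedE[OF f(1)]) auto
  have "(\<lambda>n. LINT y|lborel. (?g n y))
     \<longlonglongrightarrow> (LINT y|lborel. (indicator {0..a} y * (f (a - y) * g y)))"
  proof (rule integral_dominated_convergence)
    show "integrable lborel (\<lambda>y. B * (indicator {0..T} y *\<^sub>R \<bar>g y\<bar>))"
      using set_integrable_abs[of lborel "{0..T}" g] g
      by (auto simp: loc_integrable_def set_integrable_def)
    have "AE y in lborel. y \<noteq> a" by (rule AE_lborel_singleton)
    then show "AE y in lborel. (\<lambda>n. ?g n y) \<longlonglongrightarrow> indicator {0..a} y * (f (a - y) * g y)"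
    proof eventually_elim
      case (elim y)
      show ?case
      proof (cases "0 \<le> y \<and> y < a")
        case True
        have ev: "eventually (\<lambda>n. y < u n) sequentially"
          using order_tendstoD(1)[OF lim, of y] True by auto
        have "(\<lambda>n. f (u n - y)) \<longlonglongrightarrow> f (a - y)"
        proof (rule continuous_on_tendsto_compose[OF f(2)])
          show "(\<lambda>n. u n - y) \<longlonglongrightarrow> a - y" by (intro tendsto_intros lim)
          show "a - y \<in> {0..}" using True by auto
          show "eventually (\<lambda>n. u n - y \<in> {0..}) sequentially" using ev by eventually_elim auto
        qed
        then have "(\<lambda>n. f (u n - y) * g y) \<longlonglongrightarrow> f (a - y) * g y" by (intro tendsto_intros)
        then have "(\<lambda>n. ?g n y) \<longlonglongrightarrow> f (a - y) * g y"
          by (rule Lim_transform_eventually) (use ev in eventually_elim, use True in auto)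
        then show ?thesis using True by simp
      next
        case False
        have "eventually (\<lambda>n. ?g n y = 0) sequentially"
        proof (cases "0 \<le> y")
          case True
          then have "a < y" using False elim by auto
          from order_tendstoD(2)[OF lim this] show ?thesis by eventually_elim auto
        qed auto
        then have "(\<lambda>n. ?g n y) \<longlonglongrightarrow> 0"
          by (rule tendsto_eventually)
        then show ?thesis using False elim by (auto split: split_indicator)
      qed
    qed
    show "AE y in lborel. norm (?g n y) \<le> B * (indicator {0..T} y *\<^sub>R \<bar>g y\<bar>)" for n
    proof (rule AE_I2)
      fix y
      show "norm (?g n y) \<le> B * (indicator {0..T} y *\<^sub>R \<bar>g y\<bar>)"
      proof (cases "0 \<le> y \<and> y \<le> u n")
        case True
        then have "y \<le> T" "u n - y \<le> T" "0 \<le> u n - y" using T[of n] by auto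
        then show ?thesis using True B(1)[of "u n - y"] by (auto simp: abs_mult intro!: mult_right_mono)
      qed (use B(2) in auto)
    qed
  qed auto
  then show "(\<lambda>n. half_conv f g (u n)) \<longlonglongrightarrow> half_conv f g a"
    by (simp add: half_conv_def set_lebesgue_integral_def)
qed

lemma half_conv_0: "half_conv f g 0 = 0"
  unfolding half_conv_def set_lebesgue_integral_def
proof (rule integral_eq_zero_AE)
  show "AE y in lborel. indicator {0..0} y *\<^sub>R (f (0 - y) * g y) = 0"
    using AE_lborel_singleton[of "0::real"] by eventually_elim auto
qed

lemma half_conv_one: "half_conv (\<lambda>_. 1) g t = (LBINT y:{0..t}. g y)"
  by (simp add: half_conv_def)

text \<open>This cancels the factor 1 in an identity between convolutions: the primitive of
  \<open>D\<close> vanishes identically, and its derivative is \<open>D\<close>.\<close>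

lemma continuous_eq_0_if_integrals_0:
  fixes D :: "real \<Rightarrow> real"
  assumes c: "continuous_on {0..} D" and z: "\<And>t. 0 \<le> t \<Longrightarrow> (LBINT y:{0..t}. D y) = 0" and t: "0 \<le> t"
  shows "D t = 0"
proof -
  \<comment> \<open>The extra unit keeps the interval nondegenerate at \<open>t = 0\<close>, where
    the derivative is one-sided.\<close>
  have c1: "continuous_on {0..t + 1} D" using c by (rule continuous_on_subset) auto
  have eq: "integral {0..s} D = 0" if "s \<in> {0..t+1}" for s
  proof -
    have "set_integrable lborel {0..s} D"
      using that by (intro borel_integrable_atLeastAtMost') (auto intro: continuous_on_subset[OF c])
    from set_borel_integral_eq_integral(2)[OF this] z[of s] that show ?thesis by simp
  qed
  have "((\<lambda>s. integral {0..s} D) has_vector_derivative D t) (at t within {0..t+1})"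
    by (rule integral_has_vector_derivative[OF c1]) (use t in auto)
  then have "((\<lambda>s. 0) has_vector_derivative D t) (at t within {0..t+1})"
    by (rule has_vector_derivative_transform[rotated 2]) (use eq t in auto)
  moreover have "((\<lambda>s::real. 0::real) has_vector_derivative 0) (at t within {0..t+1})" by auto
  ultimately show ?thesis
    using vector_derivative_unique_within[of t "{0..t+1}"] t
    by (metis at_within_Icc_at_right at_within_eq_bot_iff at_within_Icc_at trivial_limit_at_right_real less_add_one trivial_limit_at order_le_less)
qed

text \<open>The two equations carry different drifts, so eliminating \<open>V * N\<close> leaves
  \<open>- \<delta> (V * f)\<close> in \<open>1 * (V * K)\<close>. Replacing \<open>f\<close> there
  by \<open>f0 + 1 * g\<close> turns this into \<open>1 *\<close> the function
  \<open>- \<delta> (f0 V + V * g)\<close>, so that every term has the factor 1. The coefficient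
  \<open>c - \<delta>\<close> of \<open>f0 * V t\<close> and the derivative term both come from
  here.\<close>

lemma half_conv_identity:
  assumes V: "loc_bounded V" "continuous_on {0..} V" and f: "loc_bounded f" "continuous_on {0..} f"
    and N: "loc_integrable N" and K: "loc_integrable K" and g: "loc_integrable g"
    and V_eq: "\<And>t. 0 \<le> t \<Longrightarrow> (c - \<delta>) * V t = 1 + half_conv V N t + p * half_conv V (\<lambda>_. 1) t"
    and f_eq: "\<And>t. 0 \<le> t \<Longrightarrow> c * (f t - f0) = half_conv f N t - half_conv (\<lambda>_. 1) K t
        + q * half_conv f (\<lambda>_. 1) t + m * half_conv (\<lambda>_. 1) (\<lambda>_. 1) t"
    and f_g: "\<And>t. 0 \<le> t \<Longrightarrow> f t = f0 + half_conv (\<lambda>_. 1) g t"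
    and t: "0 \<le> t"
  shows "half_conv V K t = (c - \<delta>) * f0 * V t - f t - \<delta> * half_conv V g t
      + (q - p) * half_conv V f t + m * half_conv V (\<lambda>_. 1) t"
proof -
  define o1 where "o1 = (\<lambda>_::real. 1::real)"
  have o: "loc_bounded o1" by (simp add: o1_def loc_bounded_one)
  note oi = loc_bounded_imp_integrable[OF o] loc_bounded_imp_integrable[OF V(1)] loc_bounded_imp_integrable[OF f(1)]
  note bdd = loc_bounded_half_conv
  have lb_mult: "loc_bounded (\<lambda>x. k * h x)" if lb: "loc_bounded h" for k h
    unfolding loc_bounded_def
  proof (intro conjI allI)
    show "(\<lambda>x. k * h x) \<in> borel_measurable borel" using loc_bounded_measurable[OF that] by simp
    fix T
    obtain B where "\<And>y. 0 \<le> y \<Longrightarrow> y \<le> T \<Longrightarrow> \<bar>h y\<bar> \<le> B" "0 \<le> B" by (rule loc_boundedE[OF lb]) auto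
    then show "\<exists>B. \<forall>y\<in>{0..T}. \<bar>k * h y\<bar> \<le> B"
      by (intro exI[of _ "\<bar>k\<bar> * B"]) (auto simp: abs_mult intro!: mult_left_mono)
  qed
  have lb_add: "loc_bounded (\<lambda>x. h x + h' x)" if lb: "loc_bounded h" "loc_bounded h'" for h h'
    unfolding loc_bounded_def
  proof (intro conjI allI)
    show "(\<lambda>x. h x + h' x) \<in> borel_measurable borel" using that[THEN loc_bounded_measurable] by simp
    fix T
    obtain B where B: "\<And>y. 0 \<le> y \<Longrightarrow> y \<le> T \<Longrightarrow> \<bar>h y\<bar> \<le> B" "0 \<le> B" by (rule loc_boundedE[OF lb(1)]) auto
    obtain B' where B': "\<And>y. 0 \<le> y \<Longrightarrow> y \<le> T \<Longrightarrow> \<bar>h' y\<bar> \<le> B'" "0 \<le> B'" by (rule loc_boundedE[OF lb(2)]) auto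
    show "\<exists>B. \<forall>y\<in>{0..T}. \<bar>h y + h' y\<bar> \<le> B"
      using B B' by (intro exI[of _ "B + B'"]) (auto intro!: order.trans[OF abs_triangle_ineq] add_mono)
  qed
  \<comment> \<open>The claimed right-hand side, written with sums and coefficients only, to fit the
    linearity rules for the left argument.\<close>
  define R where "R = (\<lambda>t. ((c - \<delta>) * f0) * V t + ((- 1) * f t + ((- \<delta>) * half_conv V g t
      + ((q - p) * half_conv V f t + m * half_conv V o1 t))))"
  have conv1: "half_conv o1 (half_conv V h) t = half_conv (half_conv o1 V) h t"
    if "loc_integrable h" for h t
  proof -
    have "half_conv o1 (half_conv V h) t = half_conv (half_conv V h) o1 t" by (rule half_conv_commute)
    also have "\<dots> = half_conv (half_conv V o1) h t" by (rule half_conv_right_commute[OF V(1) oi(1) that])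
    also have "\<dots> = half_conv (half_conv o1 V) h t" by (rule half_conv_cong) (auto intro: half_conv_commute)
    finally show ?thesis .
  qed
  have cVo: "half_conv (half_conv V o1) h t = half_conv o1 (half_conv V h) t" if "loc_integrable h" for h t
    unfolding conv1[OF that] by (rule half_conv_cong) (auto intro: half_conv_commute)
  have eq: "half_conv o1 (half_conv V K) t = half_conv o1 R t" if t: "0 \<le> t" for t
  proof -
    have K1: "half_conv o1 K s = half_conv f N s + ((- c) * f s + ((c * f0) * o1 s
        + (q * half_conv f o1 s + m * half_conv o1 o1 s)))"
      if "0 \<le> s" for s
      using f_eq[OF that] by (simp add: o1_def algebra_simps)
    have "half_conv o1 (half_conv V K) t = half_conv (half_conv o1 V) K t" by (rule conv1[OF K])
    also have "\<dots> = half_conv (half_conv o1 K) V t"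
      by (rule half_conv_right_commute) (auto intro: o K oi)
    also have "\<dots> = half_conv (\<lambda>s. half_conv f N s + ((- c) * f s + ((c * f0) * o1 s
        + (q * half_conv f o1 s + m * half_conv o1 o1 s)))) V t"
      by (rule half_conv_cong) (auto simp: K1)
    also have "\<dots> = half_conv (half_conv f N) V t - c * half_conv f V t + c * f0 * half_conv o1 V t
        + q * half_conv (half_conv f o1) V t + m * half_conv (half_conv o1 o1) V t"
      by (simp only: half_conv_add_left half_conv_mult_left bdd lb_add lb_mult f o oi N)
    \<comment> \<open>Moving \<open>N\<close> from \<open>f\<close> to \<open>V\<close> makes the
      equation of \<open>V\<close> applicable.\<close>
    also have "half_conv (half_conv f N) V t = half_conv (half_conv V N) f t"
    proof -
      have "half_conv (half_conv f N) V t = half_conv (half_conv f V) N t"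
        by (rule half_conv_right_commute) (auto intro: f N oi)
      also have "\<dots> = half_conv (half_conv V f) N t"
        by (rule half_conv_cong) (auto intro: half_conv_commute)
      also have "\<dots> = half_conv (half_conv V N) f t"
        by (rule half_conv_right_commute) (auto intro: V N oi)
      finally show ?thesis .
    qed
    also have "\<dots> = half_conv (\<lambda>s. (c - \<delta>) * V s + ((- 1) * o1 s + (- p) * half_conv V o1 s)) f t"
      by (rule half_conv_cong) (auto simp: V_eq o1_def)
    also have "\<dots> = (c - \<delta>) * half_conv V f t - half_conv o1 f t - p * half_conv (half_conv V o1) f t"
      by (simp only: half_conv_add_left half_conv_mult_left bdd lb_add lb_mult f o oi V)
    finally have 1: "half_conv o1 (half_conv V K) t = (c - \<delta>) * half_conv V f t - half_conv o1 f t
       - p * half_conv (half_conv V o1) f t - c * half_conv f V t + c * f0 * half_conv o1 V t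
        + q * half_conv (half_conv f o1) V t + m * half_conv (half_conv o1 o1) V t" .
    have 2: "half_conv (half_conv V o1) f t = half_conv o1 (half_conv V f) t"
      by (rule cVo) (rule oi)
    have 3: "half_conv (half_conv f o1) V t = half_conv o1 (half_conv V f) t"
    proof -
      have "half_conv (half_conv f o1) V t = half_conv (half_conv f V) o1 t"
        by (rule half_conv_right_commute) (auto intro: f oi)
      also have "\<dots> = half_conv o1 (half_conv f V) t" by (rule half_conv_commute)
      also have "\<dots> = half_conv o1 (half_conv V f) t"
        by (rule half_conv_cong) (auto intro: half_conv_commute)
      finally show ?thesis .
    qed
    have 4: "half_conv (half_conv o1 o1) V t = half_conv o1 (half_conv V o1) t"
      unfolding conv1[OF oi(1)] by (rule half_conv_right_commute) (auto intro: o oi)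
    have "half_conv V f t = half_conv f V t" by (rule half_conv_commute)
    also have "\<dots> = half_conv (\<lambda>s. f0 * o1 s + half_conv o1 g s) V t"
      by (rule half_conv_cong) (auto simp: f_g o1_def)
    also have "\<dots> = f0 * half_conv o1 V t + half_conv (half_conv o1 g) V t"
      by (simp only: half_conv_add_left half_conv_mult_left bdd lb_add lb_mult f o oi V g)
    also have "half_conv (half_conv o1 g) V t = half_conv (half_conv o1 V) g t"
      by (rule half_conv_right_commute) (auto intro: o oi g)
    also have "\<dots> = half_conv o1 (half_conv V g) t" by (rule conv1[OF g, symmetric])
    finally have 5: "half_conv V f t = f0 * half_conv o1 V t + half_conv o1 (half_conv V g) t" .
    have 6: "half_conv f V t = half_conv V f t" by (rule half_conv_commute)
    have lbV: "loc_bounded (half_conv V g)" "loc_bounded (half_conv V f)" "loc_bounded (half_conv V o1)"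
      by (auto intro!: bdd V g oi)
    have "half_conv o1 R t = half_conv R o1 t" by (rule half_conv_commute)
    also have "\<dots> = ((c - \<delta>) * f0) * half_conv V o1 t - half_conv f o1 t - \<delta> * half_conv (half_conv V g) o1 t
      + (q - p) * half_conv (half_conv V f) o1 t + m * half_conv (half_conv V o1) o1 t"
      unfolding R_def
      by (simp only: half_conv_add_left half_conv_mult_left bdd lb_add lb_mult f o oi V g lbV)
    also have "\<dots> = ((c - \<delta>) * f0) * half_conv o1 V t - half_conv o1 f t - \<delta> * half_conv o1 (half_conv V g) t
      + (q - p) * half_conv o1 (half_conv V f) t + m * half_conv o1 (half_conv V o1) t"
      by (simp only: half_conv_commute[of _ o1])
    finally have 7: "half_conv o1 R t = \<dots>" .
    show ?thesis
      unfolding 1 2 3 4 6 7 using 5 by algebra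
  qed
  have "half_conv V K t - R t = 0"
  proof (rule continuous_eq_0_if_integrals_0[OF _ _ t])
    show "continuous_on {0..} (\<lambda>t. half_conv V K t - R t)"
      unfolding R_def by (intro continuous_intros half_conv_continuous V f K g oi)
    fix s :: real assume s: "0 \<le> s"
    have lbR: "loc_bounded R" unfolding R_def by (intro lb_add lb_mult V f bdd g oi)
    have "(LBINT y:{0..s}. half_conv V K y - R y) = (LBINT y:{0..s}. half_conv V K y) - (LBINT y:{0..s}. R y)"
      using loc_bounded_imp_integrable[OF lbR] loc_bounded_imp_integrable[OF bdd[OF V(1) K]]
      by (intro set_integral_diff) (auto simp: loc_integrable_def)
    also have "\<dots> = 0" using eq[OF s] by (simp add: o1_def half_conv_one)
    finally show "(LBINT y:{0..s}. half_conv V K y - R y) = 0" .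
  qed
  then show ?thesis by (simp add: R_def o1_def)
qed

text \<open>The substitution \<open>s = exp (- x)\<close> turns Laplace transforms at integer arguments into moments on \<open>{0..1}\<close>.\<close>

lemma laplace_transform_eq_0_imp_eq_0:
  fixes g :: "real \<Rightarrow> real"
  assumes cont: "continuous_on {0..} g"
    and int: "\<And>\<theta>. \<theta>0 \<le> \<theta> \<Longrightarrow> set_integrable lborel {0..} (\<lambda>x. exp (- \<theta> * x) * g x)"
    and z: "\<And>\<theta>. \<theta>0 \<le> \<theta> \<Longrightarrow> (LBINT x:{0..}. exp (- \<theta> * x) * g x) = 0"
    and x: "0 \<le> x"
  shows "g x = 0"
proof -
  \<comment> \<open>Damping at rate \<open>\<theta>0\<close> makes \<open>g\<close> integrable; an
    additional integer \<open>n\<close> in the rate becomes the power \<open>n\<close> of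
    \<open>exp (- x)\<close> against \<open>G\<close>.\<close>
  define G where "G = (\<lambda>x. indicator {0..} x * (exp (- \<theta>0 * x) * g x))"
  have G: "integrable lborel G"
    using int[of \<theta>0] by (simp add: G_def set_integrable_def)
  have [measurable]: "G \<in> borel_measurable borel" using borel_measurable_integrable[OF G] by simp
  have mom: "integrable lborel (\<lambda>x. exp (- x) ^ n * G x)" "(LINT x|lborel. exp (- x) ^ n * G x) = 0" for n
  proof -
    have "(\<lambda>x. exp (- x) ^ n * G x) = (\<lambda>x. indicator {0..} x *\<^sub>R (exp (- (\<theta>0 + n) * x) * g x))"
      by (auto simp: G_def fun_eq_iff exp_of_nat_mult[symmetric] exp_add[symmetric] algebra_simps split: split_indicator)
    then show "integrable lborel (\<lambda>x. exp (- x) ^ n * G x)" "(LINT x|lborel. exp (- x) ^ n * G x) = 0"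
      using int[of "\<theta>0 + n"] z[of "\<theta>0 + n"] by (simp_all add: set_integrable_def set_lebesgue_integral_def)
  qed
  have test: "integrable lborel (\<lambda>x. \<phi> (exp (- x)) * G x) \<and> (LINT x|lborel. \<phi> (exp (- x)) * G x) = 0"
    if \<phi>: "continuous_on UNIV \<phi>" for \<phi> :: "real \<Rightarrow> real"
  proof -
    let ?I = "LINT x|lborel. \<phi> (exp (- x)) * G x"
    have [measurable]: "\<phi> \<in> borel_measurable borel" by (rule borel_measurable_continuous_onI[OF \<phi>])
    have "compact (\<phi> ` {0..1})" by (intro compact_continuous_image continuous_on_subset[OF \<phi>]) auto
    then obtain B where B: "\<forall>y\<in>{0..1}. \<bar>\<phi> y\<bar> \<le> B"
      by (metis bounded_iff compact_imp_bounded imageI real_norm_def)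
    have supp: "G x = 0 \<or> exp (- x) \<in> {0..1}" for x by (auto simp: G_def split: split_indicator)
    have int\<phi>: "integrable lborel (\<lambda>x. \<phi> (exp (- x)) * G x)"
    proof (rule Bochner_Integration.integrable_bound)
      show "integrable lborel (\<lambda>x. B * G x)" using G by simp
      show "AE x in lborel. norm (\<phi> (exp (- x)) * G x) \<le> norm (B * G x)"
      proof (rule AE_I2)
        fix x
        show "norm (\<phi> (exp (- x)) * G x) \<le> norm (B * G x)"
          using supp[of x]
        proof
          assume "exp (- x) \<in> {0..1}"
          then have "\<bar>\<phi> (exp (- x))\<bar> \<le> \<bar>B\<bar>" using B by (meson abs_ge_self order.trans)
          then show ?thesis by (simp add: abs_mult mult_right_mono)
        qed simp
      qed
    qed measurable
    \<comment> \<open>Approximation on \<open>{0..1}\<close> suffices, since \<open>G\<close>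
      vanishes where \<open>exp (- x)\<close> lies outside. The polynomial part integrates to 0 by
      \<open>mom\<close>.\<close>
    have "\<bar>?I\<bar> \<le> e * (LINT x|lborel. \<bar>G x\<bar>)" if e: "0 < e" for e
    proof -
      have "continuous_on {0..1::real} \<phi>" by (intro continuous_on_subset[OF \<phi>]) auto
      then obtain P where P: "real_polynomial_function P" "\<And>x. x \<in> {0..1} \<Longrightarrow> \<bar>\<phi> x - P x\<bar> < e"
        using Stone_Weierstrass_real_polynomial_function[of "{0..1::real}" \<phi> e] e by auto
      obtain a n where P_eq: "P = (\<lambda>x. \<Sum>i\<le>n. a i * x ^ i)"
        using P(1) by (auto simp: real_polynomial_function_iff_sum)
      have PG: "(\<lambda>x. P (exp (- x)) * G x) = (\<lambda>x. \<Sum>i\<le>n. a i * (exp (- x) ^ i * G x))"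
        by (simp add: P_eq sum_distrib_right mult.assoc)
      have iPG: "integrable lborel (\<lambda>x. P (exp (- x)) * G x)"
        unfolding PG by (intro Bochner_Integration.integrable_sum integrable_mult_right mom)
      have zPG: "(LINT x|lborel. P (exp (- x)) * G x) = 0"
        unfolding PG by (subst Bochner_Integration.integral_sum) (auto intro: mom simp: mom(2))
      have "\<bar>?I\<bar> = \<bar>LINT x|lborel. \<phi> (exp (- x)) * G x - P (exp (- x)) * G x\<bar>"
        using zPG by (simp add: Bochner_Integration.integral_diff[OF int\<phi> iPG])
      also have "\<dots> \<le> (LINT x|lborel. \<bar>\<phi> (exp (- x)) * G x - P (exp (- x)) * G x\<bar>)"
        by (rule integral_abs_bound)
      also have "\<dots> \<le> (LINT x|lborel. e * \<bar>G x\<bar>)"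
      proof (rule integral_mono)
        show "integrable lborel (\<lambda>x. \<bar>\<phi> (exp (- x)) * G x - P (exp (- x)) * G x\<bar>)"
          by (intro integrable_abs Bochner_Integration.integrable_diff int\<phi> iPG)
        show "integrable lborel (\<lambda>x. e * \<bar>G x\<bar>)" using G by simp
        fix x
        have "\<bar>\<phi> (exp (- x)) - P (exp (- x))\<bar> * \<bar>G x\<bar> \<le> e * \<bar>G x\<bar>"
          using supp[of x]
        proof
          assume "exp (- x) \<in> {0..1}"
          from P(2)[OF this] show ?thesis by (intro mult_right_mono) auto
        qed simp
        then show "\<bar>\<phi> (exp (- x)) * G x - P (exp (- x)) * G x\<bar> \<le> e * \<bar>G x\<bar>"
          by (simp add: abs_mult[symmetric] left_diff_distrib)
      qed
      finally show ?thesis by simp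
    qed
    note bound = this
    have "\<bar>?I\<bar> \<le> 0"
    proof (rule field_le_epsilon)
      fix e :: real assume e: "0 < e"
      \<comment> \<open>Dividing by \<open>1 + I\<close> instead of \<open>I\<close> covers the case
        \<open>I = 0\<close>.\<close>
      define I where "I = (LINT x|lborel. \<bar>G x\<bar>)"
      have I: "0 \<le> I" by (simp add: I_def)
      have "\<bar>?I\<bar> \<le> e / (1 + I) * I"
        unfolding I_def[symmetric] using bound[of "e / (1 + I)"] e I by (simp add: I_def[symmetric])
      also have "\<dots> \<le> e" using e I by (simp add: field_simps)
      finally show "\<bar>?I\<bar> \<le> 0 + e" by simp
    qed
    with int\<phi> show ?thesis by simp
  qed
  have pos: "g x = 0" if x: "0 < x" for x
  proof (rule ccontr)
    assume gx: "g x \<noteq> 0"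
    have c: "isCont g x"
      using continuous_on_interior[OF cont] x by (auto simp: interior_Ici[of 0])
    have "eventually (\<lambda>y. 0 < g y * g x) (nhds x)"
    proof -
      have "((\<lambda>y. g y * g x) \<longlongrightarrow> g x * g x) (nhds x)"
        using c by (intro tendsto_intros) (simp add: isCont_def tendsto_nhds_iff)
      moreover have "0 < g x * g x" using gx by (simp add: zero_less_mult_iff) (meson not_less_iff_gr_or_eq)
      ultimately show ?thesis by (rule order_tendstoD(1))
    qed
    then obtain d where d: "0 < d" "\<And>y. \<bar>y - x\<bar> < d \<Longrightarrow> 0 < g y * g x"
      by (auto simp: eventually_nhds_metric dist_real_def)
    \<comment> \<open>\<open>r <= x\<close> keeps the window around \<open>x\<close> inside the
      half-line. The function \<open>\<phi>\<close> is a bump that is positive exactly between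
      \<open>lo\<close> and \<open>hi\<close>, the images of the window's ends, and the constant
      factor \<open>g x\<close> makes the integrand nonnegative; its integral 0 then forces it to
      vanish almost everywhere.\<close>
    define r where "r = min d x"
    have r: "0 < r" "r \<le> d" "r \<le> x" using d x by (auto simp: r_def)
    define lo hi where "lo = exp (- (x + r))" and "hi = exp (- (x - r))"
    define \<phi> where "\<phi> s = max 0 ((s - lo) * (hi - s))" for s :: real
    have \<phi>: "continuous_on UNIV \<phi>" unfolding \<phi>_def by (intro continuous_intros)
    have near: "\<bar>y - x\<bar> < r" if "0 < \<phi> (exp (- y))" for y
    proof -
      have "lo < hi" using r by (simp add: lo_def hi_def)
      then have "lo < exp (- y) \<and> exp (- y) < hi"
        using that by (auto simp: \<phi>_def zero_less_mult_iff less_max_iff_disj)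
      then show ?thesis by (auto simp: lo_def hi_def)
    qed
    have near2: "0 < \<phi> (exp (- y))" if "\<bar>y - x\<bar> < r" for y
      using that by (auto simp: \<phi>_def lo_def hi_def less_max_iff_disj intro!: mult_pos_pos)
    have "integrable lborel (\<lambda>y. \<phi> (exp (- y)) * G y * g x)" "(LINT y|lborel. \<phi> (exp (- y)) * G y * g x) = 0"
      using test[OF \<phi>] by auto
    moreover have nonneg: "0 \<le> \<phi> (exp (- y)) * G y * g x" for y
    proof (cases "0 < \<phi> (exp (- y))")
      case True
      then have "0 < g y * g x" using near[of y] r d by auto
      then have "0 \<le> \<phi> (exp (- y)) * (exp (- \<theta>0 * y) * (g y * g x))"
        using True by (meson exp_ge_zero less_imp_le mult_nonneg_nonneg)
      then show ?thesis by (auto simp: G_def mult_ac split: split_indicator)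
    next
      case False
      then have "\<phi> (exp (- y)) = 0" by (auto simp: \<phi>_def)
      then show ?thesis by simp
    qed
    ultimately have "AE y in lborel. \<phi> (exp (- y)) * G y * g x = 0"
      using integral_nonneg_eq_0_iff_AE[of lborel "\<lambda>y. \<phi> (exp (- y)) * G y * g x"] by auto
    then have "AE y in lborel. y \<notin> {x - r<..<x + r}"
    proof eventually_elim
      case (elim y)
      show ?case
      proof
        assume "y \<in> {x - r<..<x + r}"
        then have y: "\<bar>y - x\<bar> < r" by auto
        then have "0 < g y * g x" "0 < \<phi> (exp (- y))" "0 < y" using d r near2 by auto
        then show False using elim by (auto simp: G_def)
      qed
    qed
    then have "{x - r<..<x + r} \<in> null_sets lborel"
      by (subst (asm) AE_iff_null_sets[symmetric]) auto
    then have "emeasure lborel {x - r<..<x + r} = 0" by auto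
    then show False using r by simp
  qed
  show ?thesis
  proof (cases "x = 0")
    case True
    have "(g \<longlongrightarrow> g 0) (at_right 0)"
      using cont by (auto simp: continuous_on_def intro: tendsto_within_subset)
    moreover have "(g \<longlongrightarrow> 0) (at_right 0)"
      by (rule tendsto_eventually) (auto simp: eventually_at_filter pos)
    ultimately have "g 0 = 0" by (rule tendsto_unique[OF trivial_limit_at_right_real])
    with True show ?thesis by simp
  qed (use x pos in auto)
qed

section \<open>The renewal equation\<close>

text \<open>
  The solution is the supremum of the Picard iterates. The bound survives the iteration because
  \<open>x = (x - y) + y\<close> splits the convolution into two parts of which only the second one involves
  \<open>y * w y\<close>, and that part comes with a factor \<open>1/2\<close>.
\<close>

lemma renewal_equation_ennreal:
  fixes k :: "real \<Rightarrow> ennreal"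
  assumes [measurable]: "k \<in> borel_measurable borel"
    and k0: "\<And>x. x \<le> 0 \<Longrightarrow> k x = 0"
    and anti: "\<And>x y. 0 < x \<Longrightarrow> x \<le> y \<Longrightarrow> k y \<le> k x"
    and int: "(\<integral>\<^sup>+x. k x \<partial>lborel) \<le> 1 / 2"
  obtains w :: "real \<Rightarrow> ennreal" where "w \<in> borel_measurable borel"
    "\<And>x. w x = k x + (\<integral>\<^sup>+y. k (x - y) * w y \<partial>lborel)" "(\<integral>\<^sup>+x. w x \<partial>lborel) \<le> 1"
    "\<And>x. ennreal x * w x \<le> 2" "\<And>x. x \<le> 0 \<Longrightarrow> w x = 0"
proof -
  define wn :: "nat \<Rightarrow> real \<Rightarrow> ennreal"
    where "wn = rec_nat (\<lambda>_. 0) (\<lambda>_ u x. k x + (\<integral>\<^sup>+y. k (x - y) * u y \<partial>lborel))"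
  have wn_0: "wn 0 x = 0" and wn_Suc: "wn (Suc n) x = k x + (\<integral>\<^sup>+y. k (x - y) * wn n y \<partial>lborel)" for n x
    by (simp_all add: wn_def)
  have [measurable]: "wn n \<in> borel_measurable borel" for n
  proof (induction n)
    case 0
    have "wn 0 = (\<lambda>_. 0)" by (simp add: wn_def)
    then show ?case by simp
  next
    case (Suc n)
    note [measurable] = Suc
    have "wn (Suc n) = (\<lambda>x. k x + (\<integral>\<^sup>+y. k (x - y) * wn n y \<partial>lborel))" by (simp add: wn_def)
    then show ?case by simp
  qed
  have mono: "wn n x \<le> wn (Suc n) x" for n x
  proof (induction n arbitrary: x)
    case (Suc n)
    show ?case
      unfolding wn_Suc[of "Suc n"] wn_Suc[of n]
      by (intro add_left_mono nn_integral_mono mult_left_mono) (use Suc[unfolded wn_Suc] wn_Suc in auto)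
  qed (simp add: wn_0)
  have neg: "wn n x = 0" if "x \<le> 0" for n x
    using that
  proof (induction n arbitrary: x)
    case (Suc n)
    have "k (x - y) * wn n y = 0" for y
      using Suc k0[of "x - y"] by (cases "y \<le> 0") auto
    then show ?case using Suc.prems by (simp only: wn_Suc k0) simp
  qed (simp add: wn_0)
  have shift: "(\<integral>\<^sup>+x. k (x - y) \<partial>lborel) = (\<integral>\<^sup>+x. k x \<partial>lborel)" for y
    using nn_integral_real_affine[of k 1 "-y"] by (simp add: add.commute)
  have half2: "(1 / 2 :: ennreal) * 2 = 1"
    by (simp add: ennreal_divide_times)
  have half1: "(1 / 2 :: ennreal) + 1 / 2 = 1"
    by (metis half2 mult_2_right)
  have int_wn: "(\<integral>\<^sup>+x. wn n x \<partial>lborel) \<le> 1" for n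
  proof (induction n)
    case (Suc n)
    have "(\<integral>\<^sup>+x. wn (Suc n) x \<partial>lborel) = (\<integral>\<^sup>+x. k x \<partial>lborel) + (\<integral>\<^sup>+x. \<integral>\<^sup>+y. k (x - y) * wn n y \<partial>lborel \<partial>lborel)"
      by (simp add: wn_Suc nn_integral_add)
    also have "(\<integral>\<^sup>+x. \<integral>\<^sup>+y. k (x - y) * wn n y \<partial>lborel \<partial>lborel) = (\<integral>\<^sup>+y. \<integral>\<^sup>+x. k (x - y) * wn n y \<partial>lborel \<partial>lborel)"
      by (rule lborel_pair.Fubini') simp
    also have "\<dots> = (\<integral>\<^sup>+x. k x \<partial>lborel) * (\<integral>\<^sup>+y. wn n y \<partial>lborel)"
      by (simp add: nn_integral_multc shift nn_integral_cmult)
    also have "(\<integral>\<^sup>+x. k x \<partial>lborel) + \<dots> \<le> 1 / 2 + 1 / 2 * 1"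
      by (intro add_mono mult_mono int Suc) auto
    finally show ?case using half1 by simp
  qed (simp add: wn_0)
  \<comment> \<open>Since \<open>k\<close> is antitone, \<open>x * k x\<close> is at most the mass
    of \<open>k\<close> on \<open>{0<..x}\<close>.\<close>
  have xk: "ennreal x * k x \<le> 1 / 2" for x
  proof (cases "0 < x")
    case True
    have "ennreal x * k x = (\<integral>\<^sup>+y. k x * indicator {0<..x} y \<partial>lborel)"
      using True by (simp add: nn_integral_cmult mult.commute)
    also have "\<dots> \<le> (\<integral>\<^sup>+y. k y \<partial>lborel)"
      by (intro nn_integral_mono) (auto intro: anti split: split_indicator)
    finally show ?thesis using int by simp
  qed (simp add: k0)
  \<comment> \<open>The constant 2 solves \<open>B = 1/2 + 1/2 + B/2\<close>; the three terms bound
    \<open>x * k x\<close>, the part with \<open>x - y\<close> and the part with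
    \<open>y\<close>.\<close>
  have bound: "ennreal x * wn n x \<le> 2" for n x
  proof (induction n arbitrary: x)
    case (Suc n)
    have split: "ennreal x * (k (x - y) * wn n y)
        = ennreal (x - y) * k (x - y) * wn n y + k (x - y) * (ennreal y * wn n y)" for y
    proof (cases "0 < y \<and> y < x")
      case True
      then have "ennreal x = ennreal (x - y) + ennreal y" by (subst ennreal_plus[symmetric]) auto
      then show ?thesis by (simp add: distrib_left distrib_right mult_ac)
    next
      case False
      then have "wn n y = 0 \<or> k (x - y) = 0" using neg[of y n] k0[of "x - y"] by auto
      then show ?thesis by auto
    qed
    have "ennreal x * wn (Suc n) x = ennreal x * k x + (\<integral>\<^sup>+y. ennreal x * (k (x - y) * wn n y) \<partial>lborel)"
      by (simp add: wn_Suc distrib_left nn_integral_cmult)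
    also have "\<dots> = ennreal x * k x + ((\<integral>\<^sup>+y. ennreal (x - y) * k (x - y) * wn n y \<partial>lborel)
        + (\<integral>\<^sup>+y. k (x - y) * (ennreal y * wn n y) \<partial>lborel))"
      unfolding split by (subst nn_integral_add) auto
    also have "\<dots> \<le> 1 / 2 + ((\<integral>\<^sup>+y. 1 / 2 * wn n y \<partial>lborel) + (\<integral>\<^sup>+y. k (x - y) * 2 \<partial>lborel))"
      by (intro add_mono xk nn_integral_mono mult_mono Suc order.refl) auto
    also have "\<dots> = 1 / 2 + (1 / 2 * (\<integral>\<^sup>+y. wn n y \<partial>lborel) + (\<integral>\<^sup>+y. k (x - y) \<partial>lborel) * 2)"
      by (simp add: nn_integral_cmult nn_integral_multc)
    also have "(\<integral>\<^sup>+y. k (x - y) \<partial>lborel) = (\<integral>\<^sup>+y. k y \<partial>lborel)"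
      using nn_integral_real_affine[of k "-1" x] by simp
    also have "1 / 2 + (1 / 2 * (\<integral>\<^sup>+y. wn n y \<partial>lborel) + (\<integral>\<^sup>+y. k y \<partial>lborel) * 2) \<le> 1 / 2 + (1 / 2 * 1 + 1 / 2 * 2)"
      by (intro add_mono mult_mono int int_wn order.refl) auto
    also have "\<dots> = (1 / 2 + 1 / 2) + 1 / 2 * 2" by (simp add: add.assoc)
    also have "\<dots> = 2" unfolding half1 half2 by simp
    finally show ?case .
  qed (simp add: wn_0)
  define w where "w x = (SUP n. wn n x)" for x
  have inc: "incseq wn" by (rule incseq_SucI) (simp add: le_fun_def mono)
  show ?thesis
  proof
    show "w \<in> borel_measurable borel" unfolding w_def by measurable
    show "w x = k x + (\<integral>\<^sup>+y. k (x - y) * w y \<partial>lborel)" for x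
    proof -
      have inc': "incseq (\<lambda>n y. k (x - y) * wn n y)"
        by (rule incseq_SucI) (auto simp: le_fun_def intro!: mult_left_mono mono)
      have "(\<integral>\<^sup>+y. k (x - y) * w y \<partial>lborel) = (\<integral>\<^sup>+y. (SUP n. k (x - y) * wn n y) \<partial>lborel)"
        by (simp add: w_def SUP_mult_left_ennreal)
      also have "\<dots> = (SUP n. \<integral>\<^sup>+y. k (x - y) * wn n y \<partial>lborel)"
        by (rule nn_integral_monotone_convergence_SUP[OF inc']) auto
      finally have "k x + (\<integral>\<^sup>+y. k (x - y) * w y \<partial>lborel) = (SUP n. wn (Suc n) x)"
        by (simp add: wn_Suc ennreal_SUP_add_right)
      also have "\<dots> = w x"
        unfolding w_def
      proof (rule antisym)
        show "(SUP n. wn (Suc n) x) \<le> (SUP n. wn n x)" by (intro SUP_mono) auto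
        show "(SUP n. wn n x) \<le> (SUP n. wn (Suc n) x)" by (intro SUP_mono) (use mono in blast)
      qed
      finally show ?thesis by simp
    qed
    have "(\<integral>\<^sup>+x. w x \<partial>lborel) = (SUP n. \<integral>\<^sup>+x. wn n x \<partial>lborel)"
      unfolding w_def by (rule nn_integral_monotone_convergence_SUP[OF inc]) auto
    also have "\<dots> \<le> 1" by (rule SUP_least) (rule int_wn)
    finally show "(\<integral>\<^sup>+x. w x \<partial>lborel) \<le> 1" .
    show "ennreal x * w x \<le> 2" for x
      unfolding w_def SUP_mult_left_ennreal by (rule SUP_least) (rule bound)
    show "w x = 0" if "x \<le> 0" for x using neg[OF that] by (simp add: w_def)
  qed
qed

section \<open>Real solutions of the renewal equation and their continuity\<close>

lemma antimono_countable_discont: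
  fixes k :: "real \<Rightarrow> real"
  assumes "\<And>x y. 0 < x \<Longrightarrow> x \<le> y \<Longrightarrow> k y \<le> k x"
  shows "countable {x. 0 < x \<and> \<not> isCont k x}"
proof -
  have "mono_on {0<..} (\<lambda>x. - k x)" using assms by (auto simp: mono_on_def)
  then have "countable {a\<in>{0<..}. \<not> isCont (\<lambda>x. - k x) a}"
    by (intro mono_on_ctble_discont_open) auto
  moreover have "isCont (\<lambda>x. - k x) a \<longleftrightarrow> isCont k a" for a
    using continuous_minus[of "at a" "\<lambda>x. - k x"] continuous_minus[of "at a" k] by auto
  ultimately show ?thesis by simp
qed

text \<open>The bound on \<open>x * w x\<close> makes the solution finite away from 0. For
  continuity the kernel is cut off at height \<open>n\<close>: the bounded part has a continuous
  convolution with \<open>w\<close>, while the rest of the kernel is concentrated near 0 and meets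
  \<open>w\<close> only at arguments bounded away from 0. Its contribution is therefore uniformly
  small near each \<open>x0 > 0\<close>.\<close>

lemma renewal_equation_real:
  fixes k :: "real \<Rightarrow> real"
  assumes k_meas [measurable]: "k \<in> borel_measurable borel"
    and k0: "\<And>x. x \<le> 0 \<Longrightarrow> k x = 0" and knn: "\<And>x. 0 \<le> k x"
    and anti: "\<And>x y. 0 < x \<Longrightarrow> x \<le> y \<Longrightarrow> k y \<le> k x"
    and kint: "integrable lborel k" and int: "(LINT x|lborel. k x) \<le> 1 / 2"
  obtains w :: "real \<Rightarrow> real" where "integrable lborel w" "\<And>x. 0 \<le> w x" "\<And>x. x \<le> 0 \<Longrightarrow> w x = 0"
    "\<And>x. w x = k x + (LINT y|lborel. k (x - y) * w y)"
    "\<And>x. 0 < x \<Longrightarrow> isCont k x \<Longrightarrow> isCont w x"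
proof -
  let ?r = "\<lambda>n y. k y - min (k y) (real n)"
  have "(\<integral>\<^sup>+x. ennreal (k x) \<partial>lborel) = ennreal (LINT x|lborel. k x)"
    by (rule nn_integral_eq_integral[OF kint]) (simp add: knn)
  also have "\<dots> \<le> ennreal (1 / 2)" by (rule ennreal_leI[OF int])
  also have "\<dots> = 1 / 2" using divide_ennreal[of 1 2] by simp
  finally have int': "(\<integral>\<^sup>+x. ennreal (k x) \<partial>lborel) \<le> 1 / 2" .
  have km: "(\<lambda>x. ennreal (k x)) \<in> borel_measurable borel" by measurable
  have k0': "ennreal (k x) = 0" if "x \<le> 0" for x using k0[OF that] by simp
  have anti': "ennreal (k y) \<le> ennreal (k x)" if "0 < x" "x \<le> y" for x y
    by (rule ennreal_leI[OF anti[OF that]])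
  obtain u :: "real \<Rightarrow> ennreal" where u_meas [measurable]: "u \<in> borel_measurable borel"
    and u_eq: "\<And>x. u x = ennreal (k x) + (\<integral>\<^sup>+y. ennreal (k (x - y)) * u y \<partial>lborel)"
    and u_int: "(\<integral>\<^sup>+x. u x \<partial>lborel) \<le> 1"
    and u_bd: "\<And>x. ennreal x * u x \<le> 2" and u0: "\<And>x. x \<le> 0 \<Longrightarrow> u x = 0"
    by (rule renewal_equation_ennreal[OF km k0' anti' int']) (assumption | rule that)+
  have u_fin: "u x < \<top>" for x
  proof (cases "0 < x")
    case True
    show ?thesis
    proof (rule ccontr)
      assume "\<not> u x < \<top>"
      then have "u x = \<top>" by (metis top.not_eq_extremum)
      then have "ennreal x * u x = \<top>" using True by (simp add: ennreal_mult_top)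
      then show False using u_bd[of x] by (simp add: top_unique)
    qed
  qed (simp add: u0)
  define w where "w x = enn2real (u x)" for x
  have uw: "u x = ennreal (w x)" for x using u_fin by (simp add: w_def)
  have [measurable]: "w \<in> borel_measurable borel" unfolding w_def by measurable
  have wnn: "0 \<le> w x" for x by (simp add: w_def)
  have w0: "w x = 0" if "x \<le> 0" for x using u0[OF that] by (simp add: w_def)
  have w_bd: "x * w x \<le> 2" if "0 < x" for x
  proof -
    have "ennreal (x * w x) \<le> ennreal 2" using u_bd[of x] that wnn[of x] by (simp add: uw ennreal_mult)
    then show ?thesis by (subst (asm) ennreal_le_iff) auto
  qed
  have wint: "integrable lborel w"
  proof (rule integrableI_nonneg)
    show "(\<integral>\<^sup>+x. ennreal (w x) \<partial>lborel) < \<infinity>"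
      using u_int by (simp add: uw[symmetric]) (meson ennreal_one_less_top order_le_less_trans)
  qed (auto simp: wnn)
  have conv_int: "integrable lborel (\<lambda>y. k (x - y) * w y)" for x
  proof (rule integrableI_nonneg)
    have "(\<integral>\<^sup>+y. ennreal (k (x - y) * w y) \<partial>lborel) \<le> u x"
      unfolding u_eq[of x] by (simp add: uw knn wnn ennreal_mult)
    then show "(\<integral>\<^sup>+y. ennreal (k (x - y) * w y) \<partial>lborel) < \<infinity>"
      using u_fin[of x] by (auto intro: order_le_less_trans)
  qed (auto simp: wnn knn)
  have w_eq: "w x = k x + (LINT y|lborel. k (x - y) * w y)" for x
  proof -
    have "ennreal (w x) = ennreal (k x) + (\<integral>\<^sup>+y. ennreal (k (x - y) * w y) \<partial>lborel)"
      using u_eq[of x] by (simp add: uw knn wnn ennreal_mult)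
    also have "\<dots> = ennreal (k x) + ennreal (LINT y|lborel. k (x - y) * w y)"
      by (subst nn_integral_eq_integral[OF conv_int]) (auto simp: knn wnn)
    also have "\<dots> = ennreal (k x + (LINT y|lborel. k (x - y) * w y))"
      by (intro ennreal_plus[symmetric] knn integral_nonneg_AE) (auto simp: knn wnn)
    finally show ?thesis
      by (subst (asm) ennreal_inj) (auto simp: knn wnn intro!: add_nonneg_nonneg integral_nonneg_AE)
  qed
  \<comment> \<open>0 is added because \<open>k\<close> vanishes on the left of 0 but can blow up on
    the right.\<close>
  define D where "D = insert 0 {x. 0 < x \<and> \<not> isCont k x}"
  have D: "countable D" using antimono_countable_discont[of k] anti by (simp add: D_def)
  have k_cont: "isCont k x" if "x \<notin> D" for x
  proof (cases "0 < x")
    case False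
    then have "x < 0" using that by (auto simp: D_def)
    then have "eventually (\<lambda>y. k y = 0) (nhds x)"
      using eventually_nhds_in_open[of "{..<0}" x] by (auto elim!: eventually_mono intro: k0)
    then show ?thesis
      using k0[of x] \<open>x < 0\<close> isCont_cong[of k "\<lambda>_. 0" x] by auto
  qed (use that in \<open>auto simp: D_def\<close>)
  have trunc_cont: "isCont (\<lambda>x. LINT y|lborel. min (k (x - y)) (real n) * w y) x" for n x
    unfolding continuous_at_sequentially comp_def
  proof (intro allI impI)
    fix X assume X: "X \<longlonglongrightarrow> x"
    show "(\<lambda>i. LINT y|lborel. min (k (X i - y)) (real n) * w y) \<longlonglongrightarrow> (LINT y|lborel. min (k (x - y)) (real n) * w y)"
    proof (rule integral_dominated_convergence)
      show "integrable lborel (\<lambda>y. real n * w y)" using wint by simp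
      have "countable ((\<lambda>d. x - d) ` D)" using D by simp
      then have "AE y in lborel. y \<notin> (\<lambda>d. x - d) ` D" by (intro AE_not_in countable_imp_null_set_lborel)
      then show "AE y in lborel. (\<lambda>i. min (k (X i - y)) (real n) * w y) \<longlonglongrightarrow> min (k (x - y)) (real n) * w y"
      proof eventually_elim
        case (elim y)
        then have "x - y \<notin> D" by (metis diff_diff_eq2 add_diff_cancel_left' diff_add_cancel image_eqI)
        then have "(\<lambda>i. k (X i - y)) \<longlonglongrightarrow> k (x - y)"
          by (intro isCont_tendsto_compose[OF k_cont] tendsto_intros X)
        then show ?case by (intro tendsto_intros)
      qed
      show "AE y in lborel. norm (min (k (X i - y)) (real n) * w y) \<le> real n * w y" for i
        using knn wnn by (intro AE_I2) (auto simp: abs_mult intro!: mult_right_mono)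
    qed auto
  qed
  have rest_lim: "(\<lambda>n. LINT y|lborel. ?r n y) \<longlonglongrightarrow> integral\<^sup>L lborel (\<lambda>_::real. 0::real)"
  proof (rule integral_dominated_convergence[OF _ _ kint])
    show "AE y in lborel. (\<lambda>n. ?r n y) \<longlonglongrightarrow> 0"
    proof (rule AE_I2)
      fix y
      obtain n0 where "k y \<le> real n0" using real_arch_simple by blast
      then have "eventually (\<lambda>n. ?r n y = 0) sequentially"
        by (intro eventually_sequentiallyI[of n0]) auto
      then show "(\<lambda>n. ?r n y) \<longlonglongrightarrow> 0" by (rule tendsto_eventually)
    qed
    show "AE y in lborel. norm (?r n y) \<le> k y" for n
      using knn by (intro AE_I2) (auto simp: min_def)
  qed (auto intro: kint)
  have conv_cont: "isCont (\<lambda>x. LINT y|lborel. k (x - y) * w y) x0" if x0: "0 < x0" for x0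
  proof -
    let ?f = "\<lambda>n x. LINT y|lborel. min (k (x - y)) (real n) * w y"
    let ?l = "\<lambda>x. LINT y|lborel. k (x - y) * w y"
    have "uniform_limit {x0/2<..} ?f ?l sequentially"
      unfolding uniform_limit_iff
    proof (intro allI impI)
      fix e :: real assume e: "0 < e"
      \<comment> \<open>The tolerance contains \<open>x0 / 8\<close>, the reciprocal of the bound
        \<open>8 / x0\<close> on \<open>w\<close> found below.\<close>
      have ev: "eventually (\<lambda>n. (LINT y|lborel. ?r n y) < e * (x0 / 8)) sequentially"
        by (rule order_tendstoD(2)[OF rest_lim]) (use e x0 in auto)
      obtain n0 where n0: "k (x0/4) \<le> real n0" using real_arch_simple by blast
      from ev eventually_ge_at_top[of n0]
      show "eventually (\<lambda>n. \<forall>x\<in>{x0/2<..}. dist (?f n x) (?l x) < e) sequentially"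
      proof eventually_elim
        case (elim n)
        have "dist (?f n x) (?l x) < e" if x: "x0/2 < x" for x
        proof -
          have int_min: "integrable lborel (\<lambda>y. min (k (x - y)) (real n) * w y)"
            by (rule Bochner_Integration.integrable_bound[OF conv_int[of x]])
               (use knn wnn in \<open>auto simp: abs_mult intro!: mult_right_mono\<close>)
          have int_k: "integrable lborel (\<lambda>y. ?r n y)"
            by (rule Bochner_Integration.integrable_bound[OF kint]) (use knn in \<open>auto simp: min_def\<close>)
          have int_k': "integrable lborel (\<lambda>y. ?r n (x - y))"
            using lborel_integrable_real_affine[OF int_k, of "-1" x] by simp
          \<comment> \<open>At distances of at least \<open>x0/4\<close> the kernel is below
            \<open>n\<close> and the remainder is 0. A nonzero remainder thus forces
            \<open>x - y < x0/4\<close>, hence \<open>y > x0/4\<close>, and there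
            \<open>w y <= 2 / (x0/4)\<close>.\<close>
          have pt: "(?r n (x - y)) * w y \<le> (8 / x0) * (?r n (x - y))" for y
          proof (cases "k (x - y) \<le> real n")
            case False
            have "x - y < x0/4"
            proof (rule ccontr)
              assume "\<not> x - y < x0/4"
              then have "k (x - y) \<le> k (x0/4)" using x0 by (intro anti) auto
              then show False using False n0 elim by linarith
            qed
            then have y: "x0/4 < y" using x by simp
            then have "x0/4 * w y \<le> y * w y" by (intro mult_right_mono wnn) auto
            also have "\<dots> \<le> 2" using y x0 by (intro w_bd) auto
            finally have "w y \<le> 8 / x0" using x0 by (simp add: field_simps)
            then show ?thesis by (subst mult.commute) (intro mult_right_mono, auto)
          qed simp
          have "dist (?f n x) (?l x) = \<bar>?l x - ?f n x\<bar>" by (simp add: dist_real_def abs_minus_commute)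
          also have "?l x - ?f n x = (LINT y|lborel. (?r n (x - y)) * w y)"
            by (simp add: left_diff_distrib Bochner_Integration.integral_diff[OF conv_int int_min])
          also have "\<bar>\<dots>\<bar> = \<dots>" using wnn by (intro abs_of_nonneg integral_nonneg_AE AE_I2 mult_nonneg_nonneg) auto
          also have "\<dots> \<le> (LINT y|lborel. (8 / x0) * (?r n (x - y)))"
          proof (rule integral_mono)
            show "integrable lborel (\<lambda>y. (?r n (x - y)) * w y)"
              using Bochner_Integration.integrable_diff[OF conv_int int_min] by (simp add: left_diff_distrib)
          qed (intro integrable_mult_right int_k' pt)+
          also have "\<dots> = (8 / x0) * (LINT y|lborel. ?r n y)"
            unfolding integral_mult_right_zero
            using lborel_integral_real_affine[of "-1" "\<lambda>y. ?r n y" x] by simp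
          also have "\<dots> < e"
            using elim x0 by (simp add: field_simps)
          finally show ?thesis .
        qed
        then show ?case by auto
      qed
    qed
    then have "continuous_on {x0/2<..} ?l"
      by (rule uniform_limit_theorem[rotated])
         (auto intro!: always_eventually continuous_at_imp_continuous_on trunc_cont)
    then show ?thesis
      using x0 by (simp add: continuous_on_eq_continuous_at)
  qed
  show ?thesis
  proof (rule that[OF wint wnn w0 w_eq])
    show "isCont w x" if "0 < x" "isCont k x" for x
    proof -
      have "isCont (\<lambda>x. k x + (LINT y|lborel. k (x - y) * w y)) x"
        by (intro continuous_intros conv_cont that)
      moreover have "(\<lambda>x. k x + (LINT y|lborel. k (x - y) * w y)) = w"
        by (rule ext) (rule w_eq[symmetric])
      ultimately show ?thesis by simp
    qed
  qed
qed

section \<open>Exponential weights and Volterra equations\<close>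

lemma set_integrable_exp_Ici:
  assumes "0 < (a::real)" shows "set_integrable lborel {0..} (\<lambda>x. exp (- a * x))"
proof -
  have "(\<lambda>x. exp (- a * x)) absolutely_integrable_on {0..}"
    by (rule nonnegative_absolutely_integrable_1[OF integrable_on_exp_minus_to_infinity[OF assms]]) auto
  then have "integrable lebesgue (\<lambda>x. indicator {0..} x *\<^sub>R exp (- a * x))"
    by (simp add: set_integrable_def)
  then show ?thesis
    unfolding set_integrable_def by (subst (asm) integrable_completion) auto
qed

text \<open>Dominated convergence along growing rates; the majorant is \<open>|h|\<close> on
  \<open>{0..1}\<close> and, by antitonicity, \<open>h 1 * exp (- y)\<close> beyond. The weight
  gives a kernel of small mass on the whole half-line, so that Picard iteration and contraction need
  no restriction to short intervals.\<close>

lemma exp_weight_small: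
  fixes h :: "real \<Rightarrow> real"
  assumes h: "loc_integrable h" and hnn: "\<And>y. 0 < y \<Longrightarrow> 0 \<le> h y"
    and anti: "\<And>x y. 0 < x \<Longrightarrow> x \<le> y \<Longrightarrow> h y \<le> h x" and e: "0 < e"
  obtains l where "0 < l" "integrable lborel (\<lambda>y. indicator {0<..} y * (exp (- l * y) * h y))"
    "(LINT y|lborel. indicator {0<..} y * (exp (- l * y) * h y)) \<le> e"
proof -
  let ?f = "\<lambda>n y. indicator {0<..} y * (exp (- real (Suc n) * y) * h y)"
  have [measurable]: "h \<in> borel_measurable borel" by (rule loc_integrable_measurable[OF h])
  \<comment> \<open>The second summand is kept on all of \<open>{0..}\<close>; on
    \<open>{0..1}\<close> it only enlarges the majorant, since \<open>h 1\<close> is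
    nonnegative.\<close>
  let ?D = "\<lambda>y. indicator {0..1} y *\<^sub>R \<bar>h y\<bar> + h 1 * (indicator {0..} y *\<^sub>R exp (- 1 * y))"
  have D: "integrable lborel ?D"
    using set_integrable_abs[of lborel "{0..1}" h] h set_integrable_exp_Ici[of 1]
    by (intro Bochner_Integration.integrable_add integrable_mult_right) (auto simp: loc_integrable_def set_integrable_def)
  have dom: "norm (?f n y) \<le> ?D y" for n y
  proof (cases "0 < y")
    case True
    have "- real (Suc n) * y \<le> - 1 * y" using True by (intro mult_right_mono) auto
    then have "exp (- real (Suc n) * y) \<le> exp (- 1 * y)" by (simp only: exp_le_cancel_iff)
    moreover have "exp (- real (Suc n) * y) \<le> 1" using True by (simp add: mult_nonpos_nonneg)
    moreover define E where "E = exp (- real (Suc n) * y)"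
    ultimately have E: "E \<le> exp (- 1 * y)" "E \<le> 1" "0 \<le> E" by simp_all
    have hy: "0 \<le> h y" "0 \<le> h 1" using hnn True by auto
    have "E * h y \<le> ?D y"
    proof (cases "y \<le> 1")
      case le: True
      have "E * h y \<le> 1 * h y" using E hy by (intro mult_right_mono)
      moreover have "0 \<le> h 1 * exp (- 1 * y)" using hy by simp
      moreover have "?D y = h y + h 1 * exp (- 1 * y)" using True le hy by simp
      ultimately show ?thesis by linarith
    next
      case False
      have "E * h y \<le> exp (- 1 * y) * h 1" using E hy anti[of 1 y] False by (intro mult_mono) auto
      then show ?thesis using True False by (simp add: mult.commute)
    qed
    moreover have "norm (?f n y) = E * h y"
      using True hy by (simp add: E_def abs_mult)
    ultimately show ?thesis by simp
  qed (auto simp: hnn)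
  have int: "integrable lborel (\<lambda>y. ?f n y)" for n
    by (rule Bochner_Integration.integrable_bound[OF D]) (use dom in \<open>auto simp: hnn intro: order.trans[OF dom abs_ge_self]\<close>)
  have "(\<lambda>n. LINT y|lborel. ?f n y) \<longlonglongrightarrow> integral\<^sup>L lborel (\<lambda>_::real. 0::real)"
  proof (rule integral_dominated_convergence[OF _ _ D])
    show "AE y in lborel. (\<lambda>n. ?f n y) \<longlonglongrightarrow> 0"
    proof (rule AE_I2)
      fix y :: real
      show "(\<lambda>n. ?f n y) \<longlonglongrightarrow> 0"
      proof (cases "0 < y")
        case True
        have "(\<lambda>n. exp (- real n * y)) \<longlonglongrightarrow> 0"
        proof -
          have "(\<lambda>n. exp (- y) ^ n) \<longlonglongrightarrow> 0" using True by (intro LIMSEQ_power_zero) auto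
          then show ?thesis by (simp add: exp_of_nat_mult[symmetric])
        qed
        then have "(\<lambda>n. exp (- real (Suc n) * y)) \<longlonglongrightarrow> 0" by (rule LIMSEQ_Suc)
        then have "(\<lambda>n. exp (- real (Suc n) * y) * h y) \<longlonglongrightarrow> 0 * h y" by (intro tendsto_intros)
        then show ?thesis using True by (simp del: of_nat_Suc)
      qed simp
    qed
  qed (use dom in auto)
  then have "eventually (\<lambda>n. (LINT y|lborel. ?f n y) < e) sequentially"
    by (intro order_tendstoD(2)[of _ 0]) (use e in auto)
  from eventually_happens'[OF sequentially_bot this]
  obtain n where "(LINT y|lborel. ?f n y) < e" ..
  then show ?thesis by (intro that[of "real (Suc n)"] int) auto
qed

text \<open>Contraction in a weighted supremum norm: with weight \<open>exp (- l * t)\<close> the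
  kernel has mass at most \<open>c / 2\<close>, so the weighted maximum \<open>B\<close> over
  \<open>{0..T}\<close> satisfies \<open>c * B <= B * (c / 2)\<close>.\<close>

lemma volterra_unique:
  assumes h: "loc_integrable h" and hnn: "\<And>y. 0 < y \<Longrightarrow> 0 \<le> h y"
    and anti: "\<And>x y. 0 < x \<Longrightarrow> x \<le> y \<Longrightarrow> h y \<le> h x" and c: "0 < c"
    and D: "continuous_on {0..} D" "D \<in> borel_measurable borel"
    and eq: "\<And>t. 0 \<le> t \<Longrightarrow> c * D t = half_conv D h t" and T: "0 \<le> T"
  shows "D T = 0"
proof -
  let ?e = "\<lambda>l y. indicator {0<..} y * (exp (- l * y) * h y)"
  obtain l where l: "0 < l" and li: "integrable lborel (\<lambda>y. ?e l y)"
    and l_le: "(LINT y|lborel. ?e l y) \<le> c / 2"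
    by (rule exp_weight_small[OF h hnn anti, of "c / 2"]) (use c in auto)
  have "continuous_on {0..T} (\<lambda>t. exp (- l * t) * \<bar>D t\<bar>)"
    by (intro continuous_intros continuous_on_subset[OF D(1)]) auto
  then obtain s where s: "s \<in> {0..T}" and sup: "\<And>t. t \<in> {0..T} \<Longrightarrow> exp (- l * t) * \<bar>D t\<bar> \<le> exp (- l * s) * \<bar>D s\<bar>"
    using continuous_attains_sup[of "{0..T}" "\<lambda>t. exp (- l * t) * \<bar>D t\<bar>"] T by auto
  define B where "B = exp (- l * s) * \<bar>D s\<bar>"
  let ?q = "\<lambda>y. exp (- l * s) * (indicator {0..s} y *\<^sub>R (D (s - y) * h y))"
  have B0: "0 \<le> B" by (simp add: B_def)
  have "c * B = exp (- l * s) * \<bar>half_conv D h s\<bar>"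
    using eq[of s, symmetric] s c by (simp add: B_def abs_mult)
  also have "\<dots> = \<bar>LINT y|lborel. ?q y\<bar>"
    by (simp add: half_conv_def set_lebesgue_integral_def abs_mult)
  also have "\<dots> \<le> (LINT y|lborel. B * (?e l y))"
  proof (rule order.trans[OF integral_abs_bound integral_mono_AE])
    have "AE y in lborel. y \<noteq> (0::real)" by (rule AE_lborel_singleton)
    then show "AE y in lborel. \<bar>?q y\<bar>
        \<le> B * (?e l y)"
    proof eventually_elim
      case (elim y)
      show ?case
      proof (cases "0 < y \<and> y \<le> s")
        case True
        have "exp (- l * s) = exp (- l * y) * exp (- l * (s - y))"
          by (simp add: exp_add[symmetric] algebra_simps)
        then have "exp (- l * s) * \<bar>D (s - y)\<bar> = exp (- l * y) * (exp (- l * (s - y)) * \<bar>D (s - y)\<bar>)" by simp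
        also have "\<dots> \<le> exp (- l * y) * B"
          unfolding B_def using True s by (intro mult_left_mono sup) auto
        finally have "exp (- l * s) * \<bar>D (s - y)\<bar> * h y \<le> exp (- l * y) * B * h y"
          using True hnn by (intro mult_right_mono) auto
        then show ?thesis using True hnn[of y] by (simp add: abs_mult mult_ac)
      next
        case False
        then show ?thesis using elim B0 hnn[of y]
          by (auto split: split_indicator intro!: mult_nonneg_nonneg)
      qed
    qed
    show "integrable lborel (\<lambda>y. B * (?e l y))"
      using li by simp
    show "integrable lborel (\<lambda>y. \<bar>?q y\<bar>)"
      using half_conv_integrable[OF loc_bounded_of_continuous[OF D(2,1)] h, of s]
      by (intro integrable_abs integrable_mult_right) (simp add: set_integrable_def)
  qed
  also have "\<dots> = B * (LINT y|lborel. ?e l y)" by simp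
  also have "\<dots> \<le> B * (c / 2)" by (intro mult_left_mono l_le B0)
  finally have "B \<le> 0" using c mult_pos_pos[of B c] by (cases "0 < B") (auto simp: mult.commute)
  then have "exp (- l * T) * \<bar>D T\<bar> \<le> 0" using sup[of T] T unfolding B_def by auto
  then show ?thesis by (simp add: mult_le_0_iff)
qed

text \<open>Differentiating \<open>c W = 1 + W * h\<close> with \<open>W 0 = 1 / c\<close> suggests
  \<open>c w = h / c + h * w\<close>. Exponential weights pass through convolutions, so the weighted
  form is a renewal equation with kernel \<open>k\<close> of mass at most 1/2, which has a solution.
  The primitive \<open>V\<close> of \<open>w\<close> with \<open>V 0 = 1 / c\<close> then solves the
  equation of \<open>W\<close>, and \<open>volterra_unique\<close> identifies the two.\<close>

lemma renewal_density:
  fixes W h :: "real \<Rightarrow> real"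
  assumes h: "loc_integrable h" and hnn: "\<And>y. 0 < y \<Longrightarrow> 0 \<le> h y"
    and anti: "\<And>x y. 0 < x \<Longrightarrow> x \<le> y \<Longrightarrow> h y \<le> h x" and c: "0 < c"
    and W: "continuous_on {0..} W" "W \<in> borel_measurable borel"
    and W_eq: "\<And>t. 0 \<le> t \<Longrightarrow> c * W t = 1 + half_conv W h t"
  obtains w D where "loc_integrable w" "\<And>t. 0 \<le> t \<Longrightarrow> W t = W 0 + half_conv (\<lambda>_. 1) w t"
    "countable D" "\<And>x. 0 < x \<Longrightarrow> x \<notin> D \<Longrightarrow> (W has_real_derivative w x) (at x)"
proof -
  let ?e = "\<lambda>l y. indicator {0<..} y * (exp (- l * y) * h y)"
  let ?S = "half_conv (\<lambda>_. 1)"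
  have [measurable]: "h \<in> borel_measurable borel" by (rule loc_integrable_measurable[OF h])
  obtain l where l: "0 < l" and li: "integrable lborel (\<lambda>y. ?e l y)"
    and l_le: "(LINT y|lborel. ?e l y) \<le> c / 2"
    by (rule exp_weight_small[OF h hnn anti, of "c / 2"]) (use c in auto)
  define k where "k y = ?e l y / c" for y
  have k_meas [measurable]: "k \<in> borel_measurable borel" unfolding k_def by measurable
  have k0: "k x = 0" if "x \<le> 0" for x using that by (simp add: k_def)
  have knn: "0 \<le> k x" for x using hnn c by (simp add: k_def split: split_indicator)
  have kanti: "k y \<le> k x" if "0 < x" "x \<le> y" for x y
    using that l c hnn[of y] hnn[of x] anti[of x y]
    by (auto simp: k_def intro!: divide_right_mono mult_mono)
  have kint: "integrable lborel k" unfolding k_def using li by simp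
  have "(LINT x|lborel. k x) = (LINT y|lborel. ?e l y) / c"
    unfolding k_def by simp
  also have "\<dots> \<le> (c / 2) / c" using l_le c by (intro divide_right_mono) auto
  finally have kle: "(LINT x|lborel. k x) \<le> 1 / 2" using c by simp
  obtain u where u: "integrable lborel u" and unn: "\<And>x. 0 \<le> u x" and u0: "\<And>x. x \<le> 0 \<Longrightarrow> u x = 0"
    and u_eq: "\<And>x. u x = k x + (LINT y|lborel. k (x - y) * u y)"
    and u_cont: "\<And>x. 0 < x \<Longrightarrow> isCont k x \<Longrightarrow> isCont u x"
    by (rule renewal_equation_real[OF k_meas k0 knn kanti kint kle]) (assumption | rule that)+
  have [measurable]: "u \<in> borel_measurable borel" using borel_measurable_integrable[OF u] by simp
  \<comment> \<open>\<open>exp (l * x)\<close> removes the weight; the factor \<open>1 / c\<close>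
    is the value of \<open>W\<close> at 0.\<close>
  define w where "w x = (1 / c) * (exp (l * x) * u x)" for x
  have [measurable]: "w \<in> borel_measurable borel" unfolding w_def by measurable
  have w: "loc_integrable w"
    unfolding loc_integrable_def w_def
  proof (intro conjI allI)
    fix t
    have "set_integrable lborel {0..t} u"
      unfolding set_integrable_def by (rule integrable_mult_indicator[OF _ u]) auto
    then have "set_integrable lborel {0..t} (\<lambda>x. (1 / c * exp (l * x)) * u x)"
      using l c by (intro set_integrable_bounded_mult[where B="1 / c * exp (l * t)"]) (auto intro!: divide_right_mono)
    then show "set_integrable lborel {0..t} (\<lambda>x. 1 / c * (exp (l * x) * u x))" by (simp add: mult.assoc)
  qed measurable
  define V where "V t = 1 / c + ?S w t" for t
  have V_lb: "loc_bounded (?S w)" by (intro loc_bounded_half_conv loc_bounded_one w)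
  have V_cont: "continuous_on {0..} V"
    unfolding V_def by (intro continuous_intros half_conv_continuous loc_bounded_one w)
  have V_eq: "c * V t = 1 + half_conv V h t" if t: "0 \<le> t" for t
  proof -
    \<comment> \<open>Truncation to \<open>{0..t}\<close> turns local integrability into
      integrability, as Fubini requires, and changes nothing up to \<open>t\<close>.\<close>
    define H where "H y = indicator {0..t} y * h y" for y
    have H: "integrable lborel H" using h by (simp add: H_def[abs_def] loc_integrable_def set_integrable_def)
    have [measurable]: "H \<in> borel_measurable borel" unfolding H_def by measurable
    define w' where "w' y = indicator {0..t} y * w y" for y
    have w': "integrable lborel w'" using w by (simp add: w'_def[abs_def] loc_integrable_def set_integrable_def)
    have [measurable]: "w' \<in> borel_measurable borel" unfolding w'_def by measurable
    let ?\<Phi> = "\<lambda>y s. indicator {0..t} s * (H (s - y) * w' y)"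
    have prod: "integrable (lborel \<Otimes>\<^sub>M lborel) (\<lambda>(y, s). ?\<Phi> y s)"
    proof (rule Bochner_Integration.integrable_bound)
      show "integrable (lborel \<Otimes>\<^sub>M lborel) (\<lambda>(y, s). H (s - y) * w' y)"
        by (rule integrable_shear_mult[OF H w'])
    qed (auto split: split_indicator)
    have inner_w: "c * w s = h s / c + (LINT y|lborel. H (s - y) * w' y)" if "0 < s" "s \<le> t" for s
    proof -
      have "(LINT y|lborel. k (s - y) * u y) = (LINT y|lborel. exp (- l * s) * (c * (H (s - y) * w' y) / c))"
      proof (rule integral_cong_AE)
        \<comment> \<open>At \<open>y = s\<close> the two kernels disagree: \<open>k 0\<close> is 0
          by definition, whereas \<open>H 0\<close> is \<open>h 0\<close>.\<close>
        have "AE y in lborel. y \<noteq> s" by (rule AE_lborel_singleton)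
        then show "AE y in lborel. k (s - y) * u y = exp (- l * s) * (c * (H (s - y) * w' y) / c)"
        proof eventually_elim
          case (elim y)
          have e: "exp (- l * (s - y)) = exp (- l * s) * exp (l * y)"
            by (simp add: exp_add[symmetric] algebra_simps)
          show ?case
          proof (cases "0 < y \<and> y < s")
            case True
            then show ?thesis using that c by (simp add: k_def H_def w'_def w_def) (simp add: exp_add[symmetric] algebra_simps)
          next
            case False
            then have "u y = 0 \<or> k (s - y) = 0 \<and> H (s - y) = 0"
              using elim u0[of y] k0[of "s - y"] by (auto simp: H_def)
            then show ?thesis by (auto simp: w'_def w_def)
          qed
        qed
      qed measurable
      also have "\<dots> = exp (- l * s) * (LINT y|lborel. H (s - y) * w' y)" using c by simp
      finally have "u s = k s + exp (- l * s) * (LINT y|lborel. H (s - y) * w' y)" using u_eq[of s] by simp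
      moreover have "exp (l * s) * exp (- l * s) = 1" by (simp add: exp_add[symmetric])
      ultimately have "exp (l * s) * u s = h s / c + (LINT y|lborel. H (s - y) * w' y)"
        using that c by (simp add: k_def distrib_left) (simp add: mult.assoc[symmetric])
      then show ?thesis using c by (simp add: w_def field_simps)
    qed
    have int_h: "set_integrable lborel {0..t} h" using h by (simp add: loc_integrable_def)
    have "c * ?S w t = (LINT s|lborel. c * (indicator {0..t} s * w s))"
      by (simp add: half_conv_def set_lebesgue_integral_def)
    also have "\<dots> = (LINT s|lborel. (1 / c) * (indicator {0..t} s * h s)
        + (LINT y|lborel. ?\<Phi> y s))"
    proof (rule integral_cong_AE)
      have "AE s in lborel. s \<noteq> (0::real)" by (rule AE_lborel_singleton)
      then show "AE s in lborel. c * (indicator {0..t} s * w s) = (1 / c) * (indicator {0..t} s * h s)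
        + (LINT y|lborel. ?\<Phi> y s)"
      proof eventually_elim
        case (elim s)
        then show ?case using inner_w[of s] by (auto split: split_indicator)
      qed
    qed measurable
    also have "\<dots> = (LINT s|lborel. (1 / c) * (indicator {0..t} s * h s))
        + (LINT s|lborel. LINT y|lborel. ?\<Phi> y s)"
      using int_h lborel_pair.integrable_snd[OF prod]
      by (intro Bochner_Integration.integral_add integrable_mult_right) (auto simp: set_integrable_def)
    also have "(LINT s|lborel. LINT y|lborel. ?\<Phi> y s)
        = (LINT y|lborel. LINT s|lborel. ?\<Phi> y s)"
      by (rule lborel_pair.Fubini_integral[OF prod])
    also have "\<dots> = half_conv (?S h) w t"
      unfolding half_conv_def[of "?S h"] set_lebesgue_integral_def
    proof (intro Bochner_Integration.integral_cong refl)
      fix y :: real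
      show "(LINT s|lborel. ?\<Phi> y s)
          = indicator {0..t} y *\<^sub>R (?S h (t - y) * w y)"
      proof (cases "y \<in> {0..t}")
        case True
        have "?S h (t - y) = (LINT z|lborel. indicator {0..t - y} z * h z)"
          by (simp add: half_conv_def set_lebesgue_integral_def)
        also have "\<dots> = (LINT s|lborel. indicator {0..t - y} (s - y) * h (s - y))"
          using lborel_integral_real_affine[of 1 "\<lambda>z. indicator {0..t - y} z * h z" "-y"] by simp
        also have "\<dots> = (LINT s|lborel. indicator {0..t} s * H (s - y))"
          using True by (intro Bochner_Integration.integral_cong) (auto simp: H_def split: split_indicator)
        finally show ?thesis using True by (simp add: w'_def mult.assoc[symmetric])
      qed (simp add: w'_def)
    qed
    also have "\<dots> = half_conv (?S w) h t"
      by (rule half_conv_right_commute[OF loc_bounded_one w h])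
    finally have 1: "c * ?S w t = (1 / c) * ?S h t + half_conv (?S w) h t"
      by (simp add: half_conv_def[of "\<lambda>_. 1" h] set_lebesgue_integral_def)
    have "half_conv V h t = half_conv (\<lambda>t. (1 / c) * 1 + ?S w t) h t"
      by (simp add: V_def[abs_def])
    also have "\<dots> = half_conv (\<lambda>t. (1 / c) * 1) h t + half_conv (?S w) h t"
      by (rule half_conv_add_left[OF _ V_lb h]) (auto simp: loc_bounded_def)
    also have "half_conv (\<lambda>t. (1 / c) * 1) h t = (1 / c) * ?S h t"
      by (rule half_conv_mult_left)
    finally have "half_conv V h t = c * ?S w t" using 1 by simp
    then show ?thesis using c by (simp add: V_def[of t] distrib_left)
  qed
  have V_meas: "V \<in> borel_measurable borel"
    unfolding V_def using loc_bounded_measurable[OF V_lb] by simp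
  have WV: "W t = V t" if t: "0 \<le> t" for t
  proof -
    have "W t + (- 1) * V t = 0"
    proof (rule volterra_unique[OF h hnn anti c _ _ _ t])
      show "continuous_on {0..} (\<lambda>t. W t + (- 1) * V t)" by (intro continuous_intros W V_cont)
      show "(\<lambda>t. W t + (- 1) * V t) \<in> borel_measurable borel" using W(2) V_meas by simp
      fix t :: real assume t: "0 \<le> t"
      have "half_conv (\<lambda>t. W t + (- 1) * V t) h t = half_conv W h t + half_conv (\<lambda>t. (- 1) * V t) h t"
        using V_meas by (intro half_conv_add_left loc_bounded_of_continuous W h continuous_intros V_cont) auto
      also have "half_conv (\<lambda>t. (- 1) * V t) h t = (- 1) * half_conv V h t" by (rule half_conv_mult_left)
      finally show "c * (W t + (- 1) * V t) = half_conv (\<lambda>t. W t + (- 1) * V t) h t"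
        using W_eq[OF t] V_eq[OF t] by (simp add: algebra_simps)
    qed auto
    then show ?thesis by simp
  qed
  show ?thesis
  proof
    show "loc_integrable w" by (rule w)
    show "W t = W 0 + ?S w t" if "0 \<le> t" for t
      using WV[OF that] WV[of 0] by (simp add: V_def half_conv_0)
    show "countable {x. 0 < x \<and> \<not> isCont h x}" by (rule antimono_countable_discont[OF anti])
    fix x :: real assume x: "0 < x" "x \<notin> {x. 0 < x \<and> \<not> isCont h x}"
    have "isCont (\<lambda>y. exp (- l * y) * h y / c) x" using x c by (intro continuous_intros) auto
    moreover have "eventually (\<lambda>y. k y = exp (- l * y) * h y / c) (nhds x)"
      by (rule eventually_mono[OF eventually_nhds_in_open[of "{0<..}" x]]) (use x in \<open>auto simp: k_def\<close>)
    ultimately have "isCont k x" using isCont_cong by metis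
    then have "isCont w x" unfolding w_def using u_cont[OF x(1)] by (intro continuous_intros) auto
    \<comment> \<open>Continuity of \<open>w\<close> at this one point suffices for its primitive to
      have derivative \<open>w x\<close> there; elsewhere \<open>w\<close> may be
      discontinuous.\<close>
    then have cw: "continuous (at x within ({0..x + 1} - {})) w" by (simp add: continuous_at_imp_continuous_at_within)
    have w_set: "set_integrable lborel {0..t} w" for t using w by (simp add: loc_integrable_def)
    have "((\<lambda>u. integral {0..u} w) has_vector_derivative w x) (at x within ({0..x + 1} - {}))"
      by (rule integral_has_vector_derivative_continuous_at[OF _ _ _ cw])
         (use x set_borel_integral_eq_integral(1)[OF w_set] in auto)
    moreover have "at x within ({0..x + 1} - {}) = at x"
      using x by (intro at_within_interior) auto
    ultimately have "((\<lambda>u. integral {0..u} w) has_real_derivative w x) (at x)"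
      by (simp add: has_real_derivative_iff_has_vector_derivative)
    then have "((\<lambda>u. 1 / c + integral {0..u} w) has_real_derivative w x) (at x)"
      by (auto intro!: derivative_eq_intros)
    then show "(W has_real_derivative w x) (at x)"
    proof (rule has_field_derivative_transform_within_open[of _ _ _ "{0<..}"])
      show "1 / c + integral {0..u} w = W u" if "u \<in> {0<..}" for u
        using that WV[of u] set_borel_integral_eq_integral(2)[OF w_set] by (simp add: V_def half_conv_one)
    qed (use x in auto)
  qed
qed

section \<open>The tail of the Levy measure\<close>

locale bv_jumps =
  fixes \<nu> :: "real measure"
  assumes bv: "bv_levy_measure \<nu>"
begin

lemma sets_nu [simp, measurable_cong]: "sets \<nu> = sets borel"
  using bv by (simp add: bv_levy_measure_def)

lemma space_nu [simp]: "space \<nu> = UNIV"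
  using sets_eq_imp_space_eq[OF sets_nu] by simp

lemma AE_neg: "AE u in \<nu>. u < 0"
proof (rule AE_I')
  show "{0..} \<in> null_sets \<nu>" using bv by (auto simp: bv_levy_measure_def null_sets_def)
qed auto

lemma integrable_min_1: "integrable \<nu> (\<lambda>u. min 1 \<bar>u\<bar>)"
proof (rule integrableI_nonneg)
  show "(\<integral>\<^sup>+ u. ennreal (min 1 \<bar>u\<bar>) \<partial>\<nu>) < \<infinity>"
    using bv by (simp add: bv_levy_measure_def)
qed auto

lemma integrable_min: "integrable \<nu> (\<lambda>u. min t \<bar>u\<bar>)" if "0 \<le> t"
proof (rule Bochner_Integration.integrable_bound)
  show "integrable \<nu> (\<lambda>u. (1 + t) * min 1 \<bar>u\<bar>)" by (intro integrable_mult_right integrable_min_1)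
  have "min t \<bar>u\<bar> \<le> (1 + t) * min 1 \<bar>u\<bar>" for u
  proof (cases "1 \<le> \<bar>u\<bar>")
    case False
    then have "1 * \<bar>u\<bar> \<le> (1 + t) * \<bar>u\<bar>" using that by (intro mult_right_mono) auto
    then show ?thesis using False by auto
  qed auto
  then show "AE u in \<nu>. norm (min t \<bar>u\<bar>) \<le> norm ((1 + t) * min 1 \<bar>u\<bar>)"
    using that by (intro AE_I2) (auto intro: order.trans[OF _ abs_ge_self])
qed auto

text \<open>Markov's inequality for \<open>min y |u|\<close>, which equals \<open>y\<close> on the
  tail.\<close>

lemma emeasure_tail_finite: "emeasure \<nu> {..<-y} < \<infinity>" if "0 < y"
proof -
  have "emeasure \<nu> {..<-y} = (\<integral>\<^sup>+ u. indicator {..<-y} u \<partial>\<nu>)" by simp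
  also have "\<dots> \<le> (\<integral>\<^sup>+ u. ennreal (min y \<bar>u\<bar> / y) \<partial>\<nu>)"
    by (intro nn_integral_mono) (use that in \<open>auto split: split_indicator simp: min_def\<close>)
  also have "\<dots> < \<infinity>"
  proof -
    have "integrable \<nu> (\<lambda>u. min y \<bar>u\<bar> / y)" using integrable_min[of y] that by simp
    then have "(\<integral>\<^sup>+ u. ennreal (norm (min y \<bar>u\<bar> / y)) \<partial>\<nu>) < \<infinity>" by (simp add: integrable_iff_bounded)
    moreover have "norm (min y \<bar>u\<bar> / y) = min y \<bar>u\<bar> / y" for u using that by simp
    ultimately show ?thesis by simp
  qed
  finally show ?thesis .
qed

text \<open>This makes Fubini available for infinite \<open>\<nu>\<close>: mass can accumulate only
  at 0, and the tails beyond \<open>1 / Suc n\<close> exhaust the negative half-line.\<close>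

sublocale sigma_finite_measure \<nu>
proof
  let ?A = "range (\<lambda>n. {..<-(1 / real (Suc n))}) \<union> {{0..}}"
  have "u \<in> \<Union>?A" for u
  proof (cases "u < 0")
    case True
    then obtain n where "1 / real (Suc n) < - u" using nat_approx_posE[of "-u"] by auto
    then show ?thesis by (auto intro!: exI[of _ n] simp del: of_nat_Suc)
  qed auto
  moreover have "\<forall>a\<in>?A. emeasure \<nu> a \<noteq> \<infinity>"
    using emeasure_tail_finite[of "1 / real (Suc _)"] bv by (auto simp: bv_levy_measure_def less_top simp del: of_nat_Suc)
  ultimately show "\<exists>A. countable A \<and> A \<subseteq> sets \<nu> \<and> \<Union>A = space \<nu> \<and> (\<forall>a\<in>A. emeasure \<nu> a \<noteq> \<infinity>)"
    by (intro exI[of _ ?A]) auto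
qed

sublocale pair: pair_sigma_finite lborel \<nu> ..

text \<open>For infinite \<open>\<nu>\<close> the value at \<open>y \<le> 0\<close> is the junk value \<open>0\<close> of \<^const>\<open>measure\<close>.\<close>

definition tail :: "real \<Rightarrow> real" where "tail y = measure \<nu> {..<-y}"

lemma tail_eq_integral: "tail y = (LINT u|\<nu>. (if u < - y then 1 else 0))"
proof -
  have "(LINT u|\<nu>. (if u < - y then 1 else (0::real))) = (LINT u|\<nu>. indicator {..<-y} u)"
    by (intro Bochner_Integration.integral_cong) auto
  then show ?thesis by (simp add: tail_def)
qed

lemma tail_nonneg: "0 \<le> tail y"
  by (simp add: tail_def)

lemma tail_antimono: "0 < x \<Longrightarrow> x \<le> y \<Longrightarrow> tail y \<le> tail x"
  unfolding tail_def using emeasure_tail_finite[of x]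
  by (intro measure_mono_fmeasurable) (auto simp: fmeasurable_def)

lemma tail_measurable [measurable]: "tail \<in> borel_measurable borel"
proof -
  have "(\<lambda>y. LINT u|\<nu>. (if u < - y then 1 else (0::real))) \<in> borel_measurable borel"
    by measurable
  then show ?thesis by (simp add: tail_eq_integral[abs_def])
qed

text \<open>Here bounded variation enters Fubini: for fixed \<open>u < 0\<close> the admissible
  \<open>y\<close> form an interval of length \<open>min t |u|\<close>, and this length is
  \<open>\<nu>\<close>-integrable. A bound growing linearly in \<open>u\<close> costs a first moment
  of \<open>\<nu>\<close>, which is demanded only if \<open>k\<close> is not 0.\<close>

lemma wedge_integrable:
  assumes \<phi>: "(\<lambda>(y, u). \<phi> y u) \<in> borel_measurable (lborel \<Otimes>\<^sub>M \<nu>)"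
    and t: "0 \<le> t" and C: "0 \<le> C" and k: "0 \<le> k" "k = 0 \<or> integrable \<nu> (\<lambda>u. u)"
    and bound: "\<And>y u. 0 \<le> y \<Longrightarrow> y \<le> t \<Longrightarrow> u < - y \<Longrightarrow> \<bar>\<phi> y u\<bar> \<le> C - k * u"
  shows "integrable (lborel \<Otimes>\<^sub>M \<nu>) (\<lambda>(y, u). if 0 \<le> y \<and> y \<le> t \<and> u < - y then \<phi> y u else (0::real))"
proof (rule Bochner_Integration.integrable_bound)
  let ?h = "\<lambda>u. C * min t \<bar>u\<bar> + t * (k * \<bar>u\<bar>)"
  let ?P = "\<lambda>y u. if 0 \<le> y \<and> y \<le> t \<and> u < - y then \<phi> y u else (0::real)"
  let ?B = "\<lambda>y u. if 0 \<le> y \<and> y \<le> t \<and> u < - y then C - k * u else (0::real)"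
  have nn: "0 \<le> ?B y u" for y u
    using C k by (auto simp: mult_nonneg_nonpos intro: order.trans[of _ 0])
  show "integrable (lborel \<Otimes>\<^sub>M \<nu>) (\<lambda>(y, u). ?B y u)"
  proof (rule integrableI_nonneg)
    have "(\<integral>\<^sup>+ p. ennreal (case p of (y, u) \<Rightarrow> ?B y u) \<partial>(lborel \<Otimes>\<^sub>M \<nu>))
        = (\<integral>\<^sup>+ u. \<integral>\<^sup>+ y. ennreal (?B y u) \<partial>lborel \<partial>\<nu>)"
      by (subst pair.nn_integral_snd[symmetric]) auto
    also have "\<dots> \<le> (\<integral>\<^sup>+ u. ennreal (?h u) \<partial>\<nu>)"
    proof (intro nn_integral_mono)
      fix u
      show "(\<integral>\<^sup>+ y. ennreal (?B y u) \<partial>lborel) \<le> ennreal (?h u)"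
      proof (cases "u < 0")
        case True
        have D: "0 \<le> C - k * u" using C k True by (simp add: mult_nonneg_nonpos order.trans[of _ 0])
        have "(\<integral>\<^sup>+ y. ennreal (?B y u) \<partial>lborel) \<le> (\<integral>\<^sup>+ y. ennreal (C - k * u) * indicator {0..min t (-u)} y \<partial>lborel)"
          by (intro nn_integral_mono) (auto split: split_indicator)
        also have "\<dots> = ennreal (C - k * u) * ennreal (min t (- u))"
          using t True by (simp add: nn_integral_cmult)
        also have "\<dots> = ennreal ((C - k * u) * min t (- u))"
          using D t True by (intro ennreal_mult[symmetric]) auto
        also have "\<dots> \<le> ennreal (?h u)"
        proof (rule ennreal_leI)
          have "(k * \<bar>u\<bar>) * min t \<bar>u\<bar> \<le> (k * \<bar>u\<bar>) * t" using k by (intro mult_left_mono) auto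
          then show "(C - k * u) * min t (- u) \<le> ?h u"
            using True by (simp add: algebra_simps)
        qed
        finally show ?thesis .
      next
        case False
        then have "(\<integral>\<^sup>+ y. ennreal (?B y u) \<partial>lborel) = (\<integral>\<^sup>+ (y::real). 0 \<partial>lborel)"
          by (intro nn_integral_cong) auto
        then show ?thesis by simp
      qed
    qed
    also have "\<dots> < \<infinity>"
    proof -
      have "integrable \<nu> (\<lambda>u. t * (k * \<bar>u\<bar>))"
        using k(2)
      proof
        assume "integrable \<nu> (\<lambda>u. u)"
        then show ?thesis by (intro integrable_mult_right integrable_abs)
      qed simp
      then have "integrable \<nu> (\<lambda>u. ?h u)"
        by (rule Bochner_Integration.integrable_add[OF integrable_mult_right[OF integrable_min[OF t]]])
      then have "(\<integral>\<^sup>+ u. ennreal (norm (?h u)) \<partial>\<nu>) < \<infinity>"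
        unfolding integrable_iff_bounded by simp
      moreover have "norm (?h u) = ?h u" for u
        using C t k by simp
      ultimately show ?thesis by simp
    qed
    finally show "(\<integral>\<^sup>+ p. ennreal (case p of (y, u) \<Rightarrow> ?B y u) \<partial>(lborel \<Otimes>\<^sub>M \<nu>)) < \<infinity>" .
  qed (use nn in auto)
  show "(\<lambda>(y, u). ?P y u) \<in> borel_measurable (lborel \<Otimes>\<^sub>M \<nu>)"
    using \<phi> by measurable
  have "norm (?P y u) \<le> norm (?B y u)" for y u
    using bound[of y u] by auto
  then show "AE p in lborel \<Otimes>\<^sub>M \<nu>. norm (case p of (y, u) \<Rightarrow> ?P y u)
     \<le> norm (case p of (y, u) \<Rightarrow> ?B y u)" by auto
qed

text \<open>Read through Fubini, integrability of the tail near 0 is integrability of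
  \<open>min t |u|\<close>.\<close>

lemma tail_loc_integrable: "loc_integrable tail"
  unfolding loc_integrable_def
proof (intro conjI allI)
  fix t
  show "set_integrable lborel {0..t} tail"
  proof (cases "0 \<le> t")
    case True
    have "integrable (lborel \<Otimes>\<^sub>M \<nu>) (\<lambda>(y, u). if 0 \<le> y \<and> y \<le> t \<and> u < - y then 1 else (0::real))"
      by (rule wedge_integrable[OF _ True, where C=1 and k=0]) auto
    from pair.integrable_fst[OF this]
    have "integrable lborel (\<lambda>y. LINT u|\<nu>. (if 0 \<le> y \<and> y \<le> t \<and> u < - y then 1 else (0::real)))" .
    moreover have "(LINT u|\<nu>. (if 0 \<le> y \<and> y \<le> t \<and> u < - y then 1 else (0::real))) = indicator {0..t} y *\<^sub>R tail y" for y
      by (auto simp: tail_eq_integral split: split_indicator)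
    ultimately show ?thesis by (simp add: set_integrable_def)
  qed (simp add: set_integrable_def)
qed measurable

text \<open>The \<open>K\<close> of the overview for base level \<open>a\<close>: a jump
  \<open>u\<close> from height \<open>y\<close> above \<open>a\<close> that lands below
  \<open>a\<close>, with \<open>F\<close> evaluated at the landing point.\<close>

definition overshoot :: "(real \<Rightarrow> real) \<Rightarrow> real \<Rightarrow> real \<Rightarrow> real" where
  "overshoot F a y = (LINT u|\<nu>. (if u < - y then F (a + y + u) else 0))"

text \<open>Landing points lie below the base level, so bounds on half-lines \<open>z <= R\<close>
  are what matters. \<open>k = 0\<close> serves for \<open>W\<close> and \<open>Z\<close>, which are
  bounded there; \<open>k = 1\<close> serves for \<open>Zbar\<close>, which falls off linearly, at
  the price of a first moment.\<close>

definition lin_growth :: "(real \<Rightarrow> real) \<Rightarrow> bool" where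
  "lin_growth F \<longleftrightarrow> F \<in> borel_measurable borel \<and>
     (\<forall>R. \<exists>C k. 0 \<le> C \<and> 0 \<le> k \<and> (k = 0 \<or> integrable \<nu> (\<lambda>u. u)) \<and> (\<forall>z\<le>R. \<bar>F z\<bar> \<le> C + k * \<bar>z\<bar>))"

lemma lin_growth_bound:
  assumes "lin_growth F"
  obtains B where "0 \<le> B" "\<And>z. L \<le> z \<Longrightarrow> z \<le> R \<Longrightarrow> \<bar>F z\<bar> \<le> B"
proof -
  obtain C k where *: "0 \<le> C" "0 \<le> k" "\<And>z. z \<le> R \<Longrightarrow> \<bar>F z\<bar> \<le> C + k * \<bar>z\<bar>"
    using assms unfolding lin_growth_def by blast
  show ?thesis
  proof (rule that[of "C + k * (\<bar>L\<bar> + \<bar>R\<bar>)"])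
    fix z assume "L \<le> z" "z \<le> R"
    then have "k * \<bar>z\<bar> \<le> k * (\<bar>L\<bar> + \<bar>R\<bar>)" using * by (intro mult_left_mono) auto
    then show "\<bar>F z\<bar> \<le> C + k * (\<bar>L\<bar> + \<bar>R\<bar>)" using *(3)[OF \<open>z \<le> R\<close>] by simp
  qed (use * in auto)
qed

lemma lin_growth_set_integrable:
  assumes F: "lin_growth F"
  shows "set_integrable lborel {L..R} (\<lambda>y. F (a + y))"
proof -
  obtain B where B: "\<And>z. a + L \<le> z \<Longrightarrow> z \<le> a + R \<Longrightarrow> \<bar>F z\<bar> \<le> B" using lin_growth_bound[OF F] by blast
  have [measurable]: "F \<in> borel_measurable borel" using F by (simp add: lin_growth_def)
  have "set_integrable lborel {L..R} (\<lambda>y. F (a + y) * 1)"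
    by (rule set_integrable_bounded_mult[OF set_integrable_const_Icc, where B=B]) (use B in auto)
  then show ?thesis by simp
qed

lemma overshoot_wedge:
  assumes F: "lin_growth F" and t: "0 \<le> t"
  shows "integrable (lborel \<Otimes>\<^sub>M \<nu>) (\<lambda>(y, u). if 0 \<le> y \<and> y \<le> t \<and> u < - y then F (a + y + u) else 0)"
proof -
  have [measurable]: "F \<in> borel_measurable borel" using F by (simp add: lin_growth_def)
  obtain C k where *: "0 \<le> C" "0 \<le> k" "k = 0 \<or> integrable \<nu> (\<lambda>u. u)" "\<And>z. z \<le> a \<Longrightarrow> \<bar>F z\<bar> \<le> C + k * \<bar>z\<bar>"
    using F unfolding lin_growth_def by blast
  show ?thesis
  proof (rule wedge_integrable[OF _ t _ *(2,3)])
    show "0 \<le> C + k * \<bar>a\<bar>" using * by simp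
    fix y u assume yu: "0 \<le> y" "y \<le> t" "u < - y"
    then have "\<bar>F (a + y + u)\<bar> \<le> C + k * \<bar>a + y + u\<bar>" by (intro *(4)) auto
    also have "k * \<bar>a + y + u\<bar> \<le> k * (\<bar>a\<bar> - u)" using yu * by (intro mult_left_mono) auto
    finally show "\<bar>F (a + y + u)\<bar> \<le> C + k * \<bar>a\<bar> - k * u" by (simp add: algebra_simps)
  qed measurable
qed

lemma overshoot_loc_integrable:
  assumes F: "lin_growth F"
  shows "loc_integrable (overshoot F a)"
  unfolding loc_integrable_def
proof (intro conjI allI)
  have [measurable]: "F \<in> borel_measurable borel" using F by (simp add: lin_growth_def)
  have "(\<lambda>y. LINT u|\<nu>. (if u < - y then F (a + y + u) else 0)) \<in> borel_measurable borel" by measurable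
  then show "overshoot F a \<in> borel_measurable borel" by (simp add: overshoot_def[abs_def])
  fix t
  show "set_integrable lborel {0..t} (overshoot F a)"
  proof (cases "0 \<le> t")
    case True
    from pair.integrable_fst[OF overshoot_wedge[OF F this]]
    have "integrable lborel (\<lambda>y. LINT u|\<nu>. (if 0 \<le> y \<and> y \<le> t \<and> u < - y then F (a + y + u) else 0))" .
    moreover have "(LINT u|\<nu>. (if 0 \<le> y \<and> y \<le> t \<and> u < - y then F (a + y + u) else 0)) = indicator {0..t} y *\<^sub>R overshoot F a y" for y
      by (auto simp: overshoot_def split: split_indicator)
    ultimately show ?thesis by (simp add: set_integrable_def)
  qed (simp add: set_integrable_def)
qed

text \<open>An integration by parts against \<open>\<nu>\<close>: increments over all jumps are
  traded for the tail and the overshoots. Integrating over \<open>y\<close> first makes the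
  increments of order \<open>|u|\<close> for small jumps, so the outer integral converges although
  \<open>F\<close> need not be continuous.\<close>

lemma increment_integral:
  assumes F: "lin_growth F" and t: "0 \<le> t"
  shows "integrable \<nu> (\<lambda>u. LBINT y:{0..t}. F (a + y) - F (a + y + u))" (is ?thesis1)
    and "(LINT u|\<nu>. (LBINT y:{0..t}. F (a + y) - F (a + y + u)))
      = half_conv (\<lambda>z. F (a + z)) tail t - half_conv (\<lambda>_. 1) (overshoot F a) t" (is ?thesis2)
proof -
  let ?L = "\<lambda>u. LBINT y:{0..t}. F (a + y) - F (a + y + u)"
  have [measurable]: "F \<in> borel_measurable borel" using F by (simp add: lin_growth_def)
  let ?A = "\<lambda>y u. if 0 \<le> y \<and> y \<le> t \<and> u < - y then F (a + (t - y)) else 0"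
  let ?B = "\<lambda>y u. if 0 \<le> y \<and> y \<le> t \<and> u < - y then F (a + y + u) else 0"
  obtain B where B: "0 \<le> B" "\<And>z. a \<le> z \<Longrightarrow> z \<le> a + t \<Longrightarrow> \<bar>F z\<bar> \<le> B" using lin_growth_bound[OF F] by blast
  have A: "integrable (lborel \<Otimes>\<^sub>M \<nu>) (\<lambda>(y, u). ?A y u)"
    by (rule wedge_integrable[OF _ t B(1), where k=0]) (use B in auto)
  have Bi: "integrable (lborel \<Otimes>\<^sub>M \<nu>) (\<lambda>(y, u). ?B y u)" by (rule overshoot_wedge[OF F t])
  have "half_conv (\<lambda>z. F (a + z)) tail t = (LINT y|lborel. LINT u|\<nu>. ?A y u)"
    unfolding half_conv_def set_lebesgue_integral_def
  proof (intro Bochner_Integration.integral_cong refl)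
    fix y
    have "(LINT u|\<nu>. ?A y u) = (LINT u|\<nu>. (indicator {0..t} y * F (a + (t - y))) * (if u < - y then 1 else 0))"
      by (intro Bochner_Integration.integral_cong) (auto split: split_indicator)
    then show "indicator {0..t} y *\<^sub>R (F (a + (t - y)) * tail y) = (LINT u|\<nu>. ?A y u)"
      by (simp add: tail_eq_integral)
  qed
  also have "\<dots> = (LINT u|\<nu>. LINT y|lborel. ?A y u)"
    by (rule pair.Fubini_integral[OF A, symmetric])
  finally have eqA: "half_conv (\<lambda>z. F (a + z)) tail t = (LINT u|\<nu>. LINT y|lborel. ?A y u)" .
  have "half_conv (\<lambda>_. 1) (overshoot F a) t = (LINT y|lborel. LINT u|\<nu>. ?B y u)"
    unfolding half_conv_def set_lebesgue_integral_def overshoot_def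
    by (intro Bochner_Integration.integral_cong refl) (auto split: split_indicator)
  also have "\<dots> = (LINT u|\<nu>. LINT y|lborel. ?B y u)"
    by (rule pair.Fubini_integral[OF Bi, symmetric])
  finally have eqB: "half_conv (\<lambda>_. 1) (overshoot F a) t = (LINT u|\<nu>. LINT y|lborel. ?B y u)" .
  have diff: "(LINT y|lborel. ?A y u) - (LINT y|lborel. ?B y u) = ?L u"
    if u: "u < 0" for u
  proof -
    define f0 where "f0 y = indicator {0..t} y * F (a + y)" for y
    define f1 where "f1 y = indicator {0..t} y * F (a + y + u)" for y
    have f0: "integrable lborel f0"
      using lin_growth_set_integrable[OF F, of 0 t a] by (simp add: set_integrable_def f0_def[abs_def])
    have f1: "integrable lborel f1"
      using lin_growth_set_integrable[OF F, of 0 t "a + u"] by (simp add: set_integrable_def f1_def[abs_def] add_ac)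
    have [measurable]: "f0 \<in> borel_measurable borel" "f1 \<in> borel_measurable borel"
      unfolding f0_def f1_def by measurable
    \<comment> \<open>\<open>?P\<close> and \<open>?Q\<close> are the overlap of the two windows
      seen from either one; the shift by \<open>- u\<close> carries one into the other. For a jump
      longer than \<open>t\<close> both vanish.\<close>
    let ?P = "\<lambda>y. indicator {..t + u} y * f0 y"
    let ?Q = "\<lambda>y. indicator {-u..} y * f1 y"
    have iP: "integrable lborel ?P" and iQ: "integrable lborel ?Q"
      using integrable_mult_indicator[OF _ f0, of "{..t + u}"] integrable_mult_indicator[OF _ f1, of "{-u..}"] by simp_all
    have "(LINT y|lborel. ?A y u) = (LINT y|lborel. ?A (t + - 1 * y) u)"
      using lborel_integral_real_affine[of "-1" "\<lambda>y. ?A y u" t] by (simp only:) simp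
    also have "\<dots> = (LINT y|lborel. f0 y - ?P y)"
      by (intro Bochner_Integration.integral_cong) (auto simp: f0_def split: split_indicator)
    finally have 1: "(LINT y|lborel. ?A y u) = (LINT y|lborel. f0 y) - (LINT y|lborel. ?P y)"
      by (simp add: Bochner_Integration.integral_diff[OF f0 iP])
    have "(LINT y|lborel. ?B y u) = (LINT y|lborel. f1 y - ?Q y)"
      by (intro Bochner_Integration.integral_cong) (auto simp: f1_def split: split_indicator)
    then have 2: "(LINT y|lborel. ?B y u) = (LINT y|lborel. f1 y) - (LINT y|lborel. ?Q y)"
      by (simp add: Bochner_Integration.integral_diff[OF f1 iQ])
    have "(LINT y|lborel. ?Q y) = (LINT y|lborel. ?Q (- u + 1 * y))"
      using lborel_integral_real_affine[of 1 ?Q "-u"] by simp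
    also have "\<dots> = (LINT y|lborel. ?P y)"
      using u by (intro Bochner_Integration.integral_cong) (auto simp: f0_def f1_def split: split_indicator)
    finally have 3: "(LINT y|lborel. ?Q y) = (LINT y|lborel. ?P y)" .
    have "?L u = (LINT y|lborel. f0 y - f1 y)"
      by (simp add: set_lebesgue_integral_def f0_def f1_def right_diff_distrib)
    also have "\<dots> = (LINT y|lborel. f0 y) - (LINT y|lborel. f1 y)" by (rule Bochner_Integration.integral_diff[OF f0 f1])
    finally show ?thesis using 1 2 3 by simp
  qed
  have AEd: "AE u in \<nu>. (LINT y|lborel. ?A y u) - (LINT y|lborel. ?B y u) = ?L u"
    using AE_neg by eventually_elim (rule diff)
  have m [measurable]: "(\<lambda>u. LBINT y:{0..t}. F (a + y) - F (a + y + u)) \<in> borel_measurable \<nu>"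
    unfolding set_lebesgue_integral_def by measurable
  have i: "integrable \<nu> (\<lambda>u. (LINT y|lborel. ?A y u) - (LINT y|lborel. ?B y u))"
    by (intro Bochner_Integration.integrable_diff pair.integrable_snd A Bi)
  show ?thesis1
    by (rule integrable_cong_AE_imp[OF i m]) (use AEd in auto)
  have "(LINT u|\<nu>. ?L u) = (LINT u|\<nu>. (LINT y|lborel. ?A y u) - (LINT y|lborel. ?B y u))"
    by (rule integral_cong_AE) (use AEd i in auto)
  also have "\<dots> = (LINT u|\<nu>. LINT y|lborel. ?A y u) - (LINT u|\<nu>. LINT y|lborel. ?B y u)"
    by (intro Bochner_Integration.integral_diff pair.integrable_snd A Bi)
  finally show ?thesis2 unfolding eqA eqB .
qed

end

section \<open>Laplace exponents and scale functions\<close>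

lemma laplace_half_conv:
  assumes [measurable]: "f \<in> borel_measurable borel" "g \<in> borel_measurable borel"
    and f: "set_integrable lborel {0..} (\<lambda>x. exp (- \<theta> * x) * f x)"
    and g: "set_integrable lborel {0..} (\<lambda>x. exp (- \<theta> * x) * g x)"
  shows "set_integrable lborel {0..} (\<lambda>x. exp (- \<theta> * x) * half_conv f g x)"
    and "(LBINT x:{0..}. exp (- \<theta> * x) * half_conv f g x)
      = (LBINT x:{0..}. exp (- \<theta> * x) * f x) * (LBINT x:{0..}. exp (- \<theta> * x) * g x)"
proof -
  let ?c = "(LBINT x:{0..}. exp (- \<theta> * x) * half_conv f g x)"
  define F where "F x = indicator {0..} x * (exp (- \<theta> * x) * f x)" for x
  define G where "G x = indicator {0..} x * (exp (- \<theta> * x) * g x)" for x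
  have F: "integrable lborel F" and G: "integrable lborel G"
    using f g by (simp_all add: set_integrable_def F_def[abs_def] G_def[abs_def])
  note prod = integrable_shear_mult[OF F G]
  have conv: "(LINT y|lborel. F (t - y) * G y) = indicator {0..} t *\<^sub>R (exp (- \<theta> * t) * half_conv f g t)" for t
  proof -
    have "F (t - y) * G y = indicator {0..} t * exp (- \<theta> * t) * (indicator {0..t} y * (f (t - y) * g y))" for y
    proof (cases "0 \<le> y \<and> y \<le> t")
      case True
      have "exp (- \<theta> * t) = exp (- \<theta> * (t - y)) * exp (- \<theta> * y)"
        by (simp add: exp_add[symmetric] algebra_simps)
      then show ?thesis using True by (simp add: F_def G_def)
    qed (auto simp: F_def G_def split: split_indicator)
    then show ?thesis by (simp add: half_conv_def set_lebesgue_integral_def)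
  qed
  show "set_integrable lborel {0..} (\<lambda>x. exp (- \<theta> * x) * half_conv f g x)"
    using lborel_pair.integrable_snd[OF prod] by (simp add: conv set_integrable_def)
  have "?c = (LINT t|lborel. LINT y|lborel. F (t - y) * G y)"
    by (simp add: conv set_lebesgue_integral_def)
  also have "\<dots> = (LINT y|lborel. LINT t|lborel. F (t - y) * G y)"
    by (rule lborel_pair.Fubini_integral[OF prod])
  also have "\<dots> = (LINT y|lborel. (LINT t|lborel. F t) * G y)"
  proof (intro Bochner_Integration.integral_cong refl)
    fix y
    show "(LINT t|lborel. F (t - y) * G y) = (LINT t|lborel. F t) * G y"
      using lborel_integral_real_affine[of 1 F "-y"] by (simp add: add.commute)
  qed
  also have "\<dots> = (LINT t|lborel. F t) * (LINT y|lborel. G y)" by simp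
  finally show "?c
      = (LBINT x:{0..}. exp (- \<theta> * x) * f x) * (LBINT x:{0..}. exp (- \<theta> * x) * g x)"
    by (simp add: F_def G_def set_lebesgue_integral_def)
qed

lemma laplace_one:
  assumes "0 < (\<theta>::real)" shows "(LBINT x:{0..}. exp (- \<theta> * x)) = 1 / \<theta>"
  using set_borel_integral_eq_integral(2)[OF set_integrable_exp_Ici[OF assms]]
    integral_unique[OF has_integral_exp_minus_to_infinity[OF assms, of 0]] by simp

section \<open>The Laplace transform of the tail\<close>

context bv_jumps
begin

lemma one_minus_exp_bounds:
  assumes "0 \<le> \<theta>" "u < (0::real)"
  shows "0 \<le> 1 - exp (\<theta> * u)" "1 - exp (\<theta> * u) \<le> 1" "1 - exp (\<theta> * u) \<le> \<theta> * \<bar>u\<bar>"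
proof -
  have "1 + \<theta> * u \<le> exp (\<theta> * u)" by (rule exp_ge_add_one_self)
  moreover have "\<theta> * \<bar>u\<bar> = - (\<theta> * u)" using assms by simp
  ultimately show "1 - exp (\<theta> * u) \<le> \<theta> * \<bar>u\<bar>" by linarith
qed (use assms in \<open>auto simp: mult_nonneg_nonpos\<close>)

lemma integrable_one_minus_exp:
  assumes "0 \<le> \<theta>" shows "integrable \<nu> (\<lambda>u. indicator {..<0} u * (1 - exp (\<theta> * u)))"
proof (rule Bochner_Integration.integrable_bound)
  show "integrable \<nu> (\<lambda>u. (1 + \<theta>) * min 1 \<bar>u\<bar>)" by (intro integrable_mult_right integrable_min_1)
  have "norm (indicator {..<0} u * (1 - exp (\<theta> * u))) \<le> norm ((1 + \<theta>) * min 1 \<bar>u\<bar>)" for u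
  proof (cases "u < 0")
    case True
    note b = one_minus_exp_bounds[OF assms True]
    have "1 - exp (\<theta> * u) \<le> (1 + \<theta>) * min 1 \<bar>u\<bar>"
    proof (cases "1 \<le> \<bar>u\<bar>")
      case True
      have "1 - exp (\<theta> * u) \<le> 1 + \<theta>" using assms exp_ge_zero[of "\<theta> * u"] by linarith
      then show ?thesis using True by simp
    next
      case False
      have "\<theta> * \<bar>u\<bar> \<le> (1 + \<theta>) * \<bar>u\<bar>" by (intro mult_right_mono) auto
      then show ?thesis using b(3) False by simp
    qed
    then show ?thesis using True b(1) by (auto intro: order.trans[OF _ abs_ge_self])
  qed simp
  then show "AE u in \<nu>. norm (indicator {..<0} u * (1 - exp (\<theta> * u))) \<le> norm ((1 + \<theta>) * min 1 \<bar>u\<bar>)" by auto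
qed measurable

text \<open>Exchanging the integrals over \<open>0 <= y < - u\<close> leaves the integral of
  \<open>exp (- \<theta> * y)\<close> over \<open>{0..-u}\<close>, which is
  \<open>(1 - exp (\<theta> * u)) / \<theta>\<close>. The integrands are nonnegative, so Tonelli
  also yields the integrability.\<close>

lemma laplace_tail:
  assumes \<theta>: "0 < \<theta>"
  shows "set_integrable lborel {0..} (\<lambda>y. exp (- \<theta> * y) * tail y)"
    and "\<theta> * (LBINT y:{0..}. exp (- \<theta> * y) * tail y) = (LINT u:{..<0}|\<nu>. 1 - exp (\<theta> * u))"
proof -
  let ?\<phi> = "\<lambda>y u. if 0 \<le> y \<and> u < - y then exp (- \<theta> * y) else (0::real)"
  let ?h = "\<lambda>u. indicator {..<0} u * (1 - exp (\<theta> * u)) / \<theta>"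
  have inner: "(\<integral>\<^sup>+ y. ennreal (?\<phi> y u) \<partial>lborel) = ennreal (?h u)"
    and inner_int: "integrable lborel (\<lambda>y. ?\<phi> y u)" "(LINT y|lborel. ?\<phi> y u) = ?h u" for u
  proof -
    have "has_bochner_integral lborel (\<lambda>y. ?\<phi> y u) (?h u)"
    proof (cases "u < 0")
      case True
      have "has_bochner_integral lborel (\<lambda>y. exp (- \<theta> * y) * indicator {0..-u} y)
          (- exp (- \<theta> * (-u)) / \<theta> - (- exp (- \<theta> * 0) / \<theta>))"
      proof (rule has_bochner_integral_FTC_Icc_nonneg)
        show "((\<lambda>y. - exp (- \<theta> * y) / \<theta>) has_real_derivative exp (- \<theta> * y)) (at y)" for y
          using \<theta> by (auto intro!: derivative_eq_intros)
      qed (use True in auto)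
      moreover have "(- exp (- \<theta> * (-u)) / \<theta> - (- exp (- \<theta> * 0) / \<theta>)) = ?h u"
        using True by (simp add: diff_divide_distrib)
      ultimately have "has_bochner_integral lborel (\<lambda>y. exp (- \<theta> * y) * indicator {0..-u} y) (?h u)" by simp
      \<comment> \<open>The strict inequality in \<open>?\<phi>\<close> drops the endpoint
        \<open>- u\<close>, a null set.\<close>
      moreover have "AE y in lborel. exp (- \<theta> * y) * indicator {0..-u} y = ?\<phi> y u"
        using AE_lborel_singleton[of "-u"] by eventually_elim (auto split: split_indicator)
      ultimately show ?thesis
        by (subst (asm) has_bochner_integral_cong_AE) auto
    next
      case False
      then have "(\<lambda>y. ?\<phi> y u) = (\<lambda>y. 0)" by auto
      then show ?thesis using False by (simp add: has_bochner_integral_zero)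
    qed
    then show i: "integrable lborel (\<lambda>y. ?\<phi> y u)" and e: "(LINT y|lborel. ?\<phi> y u) = ?h u"
      by (auto simp: has_bochner_integral_iff)
    show "(\<integral>\<^sup>+ y. ennreal (?\<phi> y u) \<partial>lborel) = ennreal (?h u)"
      using nn_integral_eq_integral[OF i] e by simp
  qed
  have hnn: "0 \<le> ?h u" for u
    using one_minus_exp_bounds[of \<theta> u] \<theta> by (auto split: split_indicator)
  have hint: "integrable \<nu> ?h" using integrable_one_minus_exp[of \<theta>] \<theta> by simp
  have int: "integrable (lborel \<Otimes>\<^sub>M \<nu>) (\<lambda>(y, u). ?\<phi> y u)"
  proof (rule integrableI_nonneg)
    have "(\<integral>\<^sup>+ p. ennreal (case p of (y, u) \<Rightarrow> ?\<phi> y u) \<partial>(lborel \<Otimes>\<^sub>M \<nu>)) = (\<integral>\<^sup>+ u. ennreal (?h u) \<partial>\<nu>)"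
      by (subst pair.nn_integral_snd[symmetric]) (auto simp: inner)
    also have "\<dots> = ennreal (LINT u|\<nu>. ?h u)" by (rule nn_integral_eq_integral[OF hint]) (simp add: hnn)
    finally show "(\<integral>\<^sup>+ p. ennreal (case p of (y, u) \<Rightarrow> ?\<phi> y u) \<partial>(lborel \<Otimes>\<^sub>M \<nu>)) < \<infinity>" by simp
  qed auto
  have outer: "(LINT u|\<nu>. ?\<phi> y u) = indicator {0..} y *\<^sub>R (exp (- \<theta> * y) * tail y)" for y
  proof -
    have "(LINT u|\<nu>. ?\<phi> y u) = (LINT u|\<nu>. (indicator {0..} y * exp (- \<theta> * y)) * (if u < - y then 1 else 0))"
      by (intro Bochner_Integration.integral_cong) (auto split: split_indicator)
    then show ?thesis by (simp add: tail_eq_integral)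
  qed
  show "set_integrable lborel {0..} (\<lambda>y. exp (- \<theta> * y) * tail y)"
    using pair.integrable_fst[OF int] by (simp add: outer set_integrable_def)
  have "(LBINT y:{0..}. exp (- \<theta> * y) * tail y) = (LINT y|lborel. LINT u|\<nu>. ?\<phi> y u)"
    by (simp add: outer set_lebesgue_integral_def)
  also have "\<dots> = (LINT u|\<nu>. LINT y|lborel. ?\<phi> y u)"
    by (rule pair.Fubini_integral[OF int, symmetric])
  also have "\<dots> = (LINT u|\<nu>. indicator {..<0} u * (1 - exp (\<theta> * u))) / \<theta>"
    by (simp add: inner_int)
  finally show "\<theta> * (LBINT y:{0..}. exp (- \<theta> * y) * tail y) = (LINT u:{..<0}|\<nu>. 1 - exp (\<theta> * u))"
    using \<theta> by (simp add: set_lebesgue_integral_def)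
qed

end

lemma scale_function_measurable:
  assumes "is_scale_function \<psi> q W" shows "W \<in> borel_measurable borel"
proof -
  have "(\<lambda>x. indicator {0..} x *\<^sub>R W x) \<in> borel_measurable borel"
    using assms by (intro borel_measurable_continuous_on_indicator) (auto simp: is_scale_function_def)
  moreover have "(\<lambda>x. indicator {0..} x *\<^sub>R W x) = W"
    using assms by (auto simp: is_scale_function_def fun_eq_iff split: split_indicator)
  ultimately show ?thesis by simp
qed

section \<open>The equation of a scale function, and the slope of the exponent at 0\<close>

context bv_jumps
begin

text \<open>The difference \<open>g\<close> of the two sides has transform \<open>(c - L tail
  \<theta> - q / \<theta>) * L W \<theta> - 1 / \<theta>\<close>. The bracket is
  \<open>(\<psi> \<theta> - q) / \<theta>\<close>, so its product with \<open>L W \<theta>\<close>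
  is \<open>1 / \<theta>\<close> and the transform vanishes for all large
  \<open>\<theta>\<close>.\<close>

lemma scale_function_convolution_eq:
  assumes c: "0 < c" and q: "0 \<le> q"
    and \<psi>: "\<And>\<theta>. 0 \<le> \<theta> \<Longrightarrow> \<psi> \<theta> = c * \<theta> - (LINT u:{..<0}|\<nu>. 1 - exp (\<theta> * u))"
    and W: "is_scale_function \<psi> q W" and t: "0 \<le> t"
  shows "c * W t = 1 + half_conv W tail t + q * half_conv W (\<lambda>_. 1) t"
proof -
  have Wm [measurable]: "W \<in> borel_measurable borel" by (rule scale_function_measurable[OF W])
  have Wc: "continuous_on {0..} W" using W by (simp add: is_scale_function_def)
  have Wb: "loc_bounded W" by (rule loc_bounded_of_continuous[OF Wm Wc])
  note oi = loc_bounded_imp_integrable[OF loc_bounded_one]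
  define L :: "(real \<Rightarrow> real) \<Rightarrow> real \<Rightarrow> real" where "L f \<theta> = (LBINT x:{0..}. exp (- \<theta> * x) * f x)" for f \<theta>
  obtain l where l: "0 < l" "integrable lborel (\<lambda>y. indicator {0<..} y * (exp (- l * y) * tail y))"
    "(LINT y|lborel. indicator {0<..} y * (exp (- l * y) * tail y)) \<le> c / 2"
    by (rule exp_weight_small[OF tail_loc_integrable tail_nonneg tail_antimono, of "c / 2"]) (use c in auto)
  \<comment> \<open>Beyond \<open>l\<close> the transform of the tail is at most
    \<open>c / 2\<close>; beyond \<open>2 * q / c\<close> this gives
    \<open>\<psi> \<theta> > q\<close>, so that the quotient by \<open>\<psi> \<theta> - q\<close>
    is a genuine one; the last bound makes the defining transform of \<open>W\<close>
    available.\<close>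
  define \<theta>0 where "\<theta>0 = max l (max (2 * q / c + 1) (right_inverse_exponent \<psi> q + 1))"
  have Lt: "L tail \<theta> \<le> c / 2" if "l \<le> \<theta>" for \<theta>
  proof -
    have "L tail \<theta> \<le> (LINT y|lborel. indicator {0<..} y * (exp (- l * y) * tail y))"
      unfolding L_def set_lebesgue_integral_def
    proof (rule integral_mono_AE)
      show "integrable lborel (\<lambda>x. indicator {0..} x *\<^sub>R (exp (- \<theta> * x) * tail x))"
        using laplace_tail(1)[of \<theta>] l that by (simp add: set_integrable_def)
      have "AE y in lborel. y \<noteq> (0::real)" by (rule AE_lborel_singleton)
      then show "AE y in lborel. indicator {0..} y *\<^sub>R (exp (- \<theta> * y) * tail y) \<le> indicator {0<..} y * (exp (- l * y) * tail y)"
        by eventually_elim (use that tail_nonneg in \<open>auto intro!: mult_right_mono split: split_indicator\<close>)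
    qed (rule l)
    with l show ?thesis by simp
  qed
  define g where "g t = c * W t - 1 - half_conv W tail t - q * half_conv W (\<lambda>_. 1) t" for t
  have "g t = 0"
  proof (rule laplace_transform_eq_0_imp_eq_0[of g \<theta>0, OF _ _ _ t])
    show "continuous_on {0..} g"
      unfolding g_def by (intro continuous_intros half_conv_continuous Wb Wc tail_loc_integrable oi)
    fix \<theta> assume "\<theta>0 \<le> \<theta>"
    then have \<theta>: "l \<le> \<theta>" "2 * q / c < \<theta>" "right_inverse_exponent \<psi> q < \<theta>" "0 < \<theta>"
      using l by (auto simp: \<theta>0_def)
    have iW: "set_integrable lborel {0..} (\<lambda>x. exp (- \<theta> * x) * W x)" and LW: "L W \<theta> = 1 / (\<psi> \<theta> - q)"
      using W \<theta> by (auto simp: is_scale_function_def L_def)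
    have io: "set_integrable lborel {0..} (\<lambda>x. exp (- \<theta> * x) * 1)" and Lo: "L (\<lambda>_. 1) \<theta> = 1 / \<theta>"
      using set_integrable_exp_Ici[OF \<theta>(4)] laplace_one[OF \<theta>(4)] by (simp_all add: L_def)
    have iWt: "set_integrable lborel {0..} (\<lambda>x. exp (- \<theta> * x) * half_conv W tail x)"
      and LWt: "L (half_conv W tail) \<theta> = L W \<theta> * L tail \<theta>"
      using laplace_half_conv[OF _ _ iW laplace_tail(1)[OF \<theta>(4)]] by (simp_all add: L_def)
    have iWo: "set_integrable lborel {0..} (\<lambda>x. exp (- \<theta> * x) * half_conv W (\<lambda>_. 1) x)"
      and LWo: "L (half_conv W (\<lambda>_. 1)) \<theta> = L W \<theta> * L (\<lambda>_. 1) \<theta>"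
      using laplace_half_conv[OF _ _ iW io] by (simp_all add: L_def)
    have g_eq: "exp (- \<theta> * x) * g x = c * (exp (- \<theta> * x) * W x) - exp (- \<theta> * x) * 1
        - exp (- \<theta> * x) * half_conv W tail x - q * (exp (- \<theta> * x) * half_conv W (\<lambda>_. 1) x)" for x
      by (simp add: g_def algebra_simps)
    show "set_integrable lborel {0..} (\<lambda>x. exp (- \<theta> * x) * g x)"
      unfolding g_eq by (intro set_integral_diff set_integrable_mult_right iW io iWt iWo)
    have "(LBINT x:{0..}. exp (- \<theta> * x) * g x) = c * L W \<theta> - L (\<lambda>_. 1) \<theta> - L (half_conv W tail) \<theta> - q * L (half_conv W (\<lambda>_. 1)) \<theta>"
      unfolding g_eq L_def
      by (simp only: set_integral_diff set_integrable_mult_right iW io iWt iWo set_integral_mult_right)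
    also have "\<dots> = (c - L tail \<theta> - q / \<theta>) * L W \<theta> - 1 / \<theta>"
      by (simp add: LWt LWo Lo algebra_simps)
    also have "\<dots> = 0"
    proof -
      have \<psi>\<theta>: "\<psi> \<theta> = \<theta> * (c - L tail \<theta>)"
        using \<psi>[of \<theta>] laplace_tail(2)[OF \<theta>(4)] \<theta> by (simp add: L_def algebra_simps)
      have "q < \<theta> * (c / 2)" using \<theta>(2) c by (simp add: field_simps)
      also have "\<dots> \<le> \<psi> \<theta>" unfolding \<psi>\<theta> using Lt[OF \<theta>(1)] \<theta>(4) by (intro mult_left_mono) auto
      finally have "\<psi> \<theta> - q \<noteq> 0" by simp
      moreover have "c - L tail \<theta> - q / \<theta> = (\<psi> \<theta> - q) / \<theta>" unfolding \<psi>\<theta> using \<theta>(4) by (simp add: field_simps)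
      ultimately show ?thesis unfolding LW by simp
    qed
    finally show "(LBINT x:{0..}. exp (- \<theta> * x) * g x) = 0" .
  qed
  then show ?thesis by (simp add: g_def)
qed

lemma integrable_exp_weight:
  assumes "0 < \<theta>" shows "integrable \<nu> (\<lambda>u. \<bar>u\<bar> * exp (\<theta> * u))"
proof (rule Bochner_Integration.integrable_bound)
  show "integrable \<nu> (\<lambda>u. (1 + 1 / \<theta>) * min 1 \<bar>u\<bar>)" by (intro integrable_mult_right integrable_min_1)
  show "AE u in \<nu>. norm (\<bar>u\<bar> * exp (\<theta> * u)) \<le> norm ((1 + 1 / \<theta>) * min 1 \<bar>u\<bar>)"
    using AE_neg
  proof eventually_elim
    case (elim u)
    have e1: "exp (\<theta> * u) \<le> 1" using elim assms by (simp add: mult_nonneg_nonpos)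
    have "\<bar>u\<bar> * exp (\<theta> * u) \<le> (1 + 1 / \<theta>) * min 1 \<bar>u\<bar>"
    proof (cases "1 \<le> \<bar>u\<bar>")
      case True
      have "- \<theta> * u \<le> exp (- \<theta> * u)" using exp_ge_add_one_self[of "- \<theta> * u"] by linarith
      then have "- \<theta> * u * exp (\<theta> * u) \<le> exp (- \<theta> * u) * exp (\<theta> * u)" by (intro mult_right_mono) auto
      then have "\<theta> * (\<bar>u\<bar> * exp (\<theta> * u)) \<le> 1" using elim by (simp add: exp_add[symmetric] mult_ac)
      then have "\<bar>u\<bar> * exp (\<theta> * u) \<le> 1 / \<theta>" using assms by (simp add: field_simps)
      then show ?thesis using True assms by simp
    next
      case False
      have "\<bar>u\<bar> * exp (\<theta> * u) \<le> \<bar>u\<bar> * (1 + 1 / \<theta>)" using e1 assms by (intro mult_left_mono) (auto intro: order.trans)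
      then show ?thesis using False by (simp add: mult.commute)
    qed
    moreover have "\<bar>1 + 1 / \<theta>\<bar> = 1 + 1 / \<theta>" using assms by simp
    ultimately show ?case by (simp add: abs_mult)
  qed
qed measurable

text \<open>A mean value estimate with a rate \<open>m\<close> below both exponents. With
  \<open>m = \<theta>/2\<close> it dominates the difference quotients at
  \<open>\<theta>\<close>.\<close>

lemma abs_exp_diff_le:
  assumes "m \<le> a" "m \<le> b" "u \<le> (0::real)"
  shows "\<bar>exp (a * u) - exp (b * u)\<bar> \<le> \<bar>a - b\<bar> * (\<bar>u\<bar> * exp (m * u))"
  using assms
proof (induction a b rule: linorder_wlog)
  case (le a b)
  have "exp (a * u) - exp (b * u) = exp (a * u) * (1 - exp ((b - a) * u))"
    by (simp add: right_diff_distrib exp_add[symmetric] algebra_simps)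
  also have "\<dots> \<le> exp (m * u) * ((b - a) * \<bar>u\<bar>)"
  proof (intro mult_mono)
    show "exp (a * u) \<le> exp (m * u)" using le by (simp add: mult_right_mono_neg)
    show "1 - exp ((b - a) * u) \<le> (b - a) * \<bar>u\<bar>" using exp_ge_add_one_self[of "(b - a) * u"] le by (simp add: algebra_simps)
    show "0 \<le> 1 - exp ((b - a) * u)" using le by (simp add: mult_nonneg_nonpos)
  qed auto
  finally have "exp (a * u) - exp (b * u) \<le> \<bar>a - b\<bar> * (\<bar>u\<bar> * exp (m * u))" using le by (simp add: mult_ac)
  moreover have "exp (b * u) \<le> exp (a * u)" using le by (simp add: mult_right_mono_neg)
  ultimately show ?case by simp
next
  case (sym a b)
  then show ?case by (simp add: abs_minus_commute)
qed

text \<open>Differentiation under the integral with majorant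
  \<open>|u| * exp (\<theta>/2 * u)\<close>, in which long jumps are damped. At 0 this damping
  disappears, so the limit there splits according to the first moment of
  \<open>\<nu>\<close>.\<close>

lemma exponent_has_derivative:
  assumes \<psi>: "\<And>\<theta>. 0 \<le> \<theta> \<Longrightarrow> \<psi> \<theta> = c * \<theta> - (LINT u:{..<0}|\<nu>. 1 - exp (\<theta> * u))" and \<theta>: "0 < \<theta>"
  shows "(\<psi> has_real_derivative c + (LINT u|\<nu>. u * exp (\<theta> * u))) (at \<theta>)"
proof -
  define E where "E a = (LINT u:{..<0}|\<nu>. 1 - exp (a * u))" for a
  have E_AE: "E a = (LINT u|\<nu>. indicator {..<0} u * (1 - exp (a * u)))" for a
    by (simp add: E_def set_lebesgue_integral_def)
  have "((\<lambda>a. (E a - E \<theta>) / (a - \<theta>)) \<longlongrightarrow> - (LINT u|\<nu>. u * exp (\<theta> * u))) (at \<theta> within {\<theta>/2<..})"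
    unfolding tendsto_at_iff_sequentially comp_def
  proof (intro allI impI)
    fix X :: "nat \<Rightarrow> real" assume X: "\<forall>i. X i \<in> {\<theta>/2<..} - {\<theta>}" "X \<longlonglongrightarrow> \<theta>"
    let ?d = "\<lambda>i u. indicator {..<0} u * ((exp (\<theta> * u) - exp (X i * u)) / (X i - \<theta>))"
    have "(\<lambda>i. LINT u|\<nu>. ?d i u) \<longlonglongrightarrow> (LINT u|\<nu>. - (u * exp (\<theta> * u)))"
    proof (rule integral_dominated_convergence)
      show "integrable \<nu> (\<lambda>u. \<bar>u\<bar> * exp (\<theta>/2 * u))" using \<theta> by (intro integrable_exp_weight) auto
      show "AE u in \<nu>. (\<lambda>i. ?d i u) \<longlonglongrightarrow> - (u * exp (\<theta> * u))"
        using AE_neg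
      proof eventually_elim
        case (elim u)
        have "((\<lambda>a. exp (a * u)) has_real_derivative u * exp (\<theta> * u)) (at \<theta>)"
          by (auto intro!: derivative_eq_intros)
        then have "((\<lambda>a. (exp (a * u) - exp (\<theta> * u)) / (a - \<theta>)) \<longlongrightarrow> u * exp (\<theta> * u)) (at \<theta>)"
          by (simp add: has_field_derivative_iff)
        then have "(\<lambda>i. (exp (X i * u) - exp (\<theta> * u)) / (X i - \<theta>)) \<longlonglongrightarrow> u * exp (\<theta> * u)"
          using X unfolding tendsto_at_iff_sequentially comp_def by auto
        then have "(\<lambda>i. - ((exp (X i * u) - exp (\<theta> * u)) / (X i - \<theta>))) \<longlonglongrightarrow> - (u * exp (\<theta> * u))"
          by (rule tendsto_minus)
        then show ?case using elim by (simp add: minus_divide_left)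
      qed
      show "AE u in \<nu>. norm (?d i u) \<le> \<bar>u\<bar> * exp (\<theta>/2 * u)" for i
      proof (rule AE_I2)
        fix u
        show "norm (?d i u) \<le> \<bar>u\<bar> * exp (\<theta>/2 * u)"
        proof (cases "u < 0")
          case True
          have "\<bar>exp (\<theta> * u) - exp (X i * u)\<bar> \<le> \<bar>\<theta> - X i\<bar> * (\<bar>u\<bar> * exp (\<theta>/2 * u))"
            using X(1) \<theta> True by (intro abs_exp_diff_le) (auto intro: less_imp_le)
          moreover have "0 < \<bar>X i - \<theta>\<bar>" using X(1) by auto
          ultimately show ?thesis using True by (simp add: abs_mult pos_divide_le_eq abs_minus_commute mult_ac)
        qed simp
      qed
    qed measurable
    moreover have "(LINT u|\<nu>. ?d i u) = (E (X i) - E \<theta>) / (X i - \<theta>)" for i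
    proof -
      have p: "0 \<le> X i" "0 \<le> \<theta>" using X(1)[rule_format, of i] \<theta> by auto
      have "E (X i) - E \<theta> = (LINT u|\<nu>. indicator {..<0} u * (1 - exp (X i * u)) - indicator {..<0} u * (1 - exp (\<theta> * u)))"
        unfolding E_AE by (rule Bochner_Integration.integral_diff[symmetric]; rule integrable_one_minus_exp[OF p(1)] integrable_one_minus_exp[OF p(2)])
      also have "\<dots> = (LINT u|\<nu>. indicator {..<0} u * (exp (\<theta> * u) - exp (X i * u)))"
        by (intro Bochner_Integration.integral_cong) (auto simp: algebra_simps)
      finally show ?thesis by simp
    qed
    ultimately show "(\<lambda>i. (E (X i) - E \<theta>) / (X i - \<theta>)) \<longlonglongrightarrow> - (LINT u|\<nu>. u * exp (\<theta> * u))"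
      by (simp only: integral_minus)
  qed
  moreover have "at \<theta> within {\<theta>/2<..} = at \<theta>" using \<theta> by (intro at_within_open) auto
  ultimately have "(E has_real_derivative - (LINT u|\<nu>. u * exp (\<theta> * u))) (at \<theta>)"
    by (simp add: has_field_derivative_iff)
  then have "((\<lambda>a. c * a - E a) has_real_derivative c + (LINT u|\<nu>. u * exp (\<theta> * u))) (at \<theta>)"
    by (auto intro!: derivative_eq_intros)
  then show ?thesis
    by (rule has_field_derivative_transform_within_open[of _ _ _ "{0<..}"]) (use \<theta> \<psi> in \<open>auto simp: E_def\<close>)
qed

text \<open>Dominated convergence with majorant \<open>|u|\<close>. It identifies the constant that
  the generator produces for \<open>Zbar\<close> as the right-hand slope of the exponent at
  0.\<close>

lemma deriv_zero_plus_finite: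
  assumes \<psi>: "\<And>\<theta>. 0 \<le> \<theta> \<Longrightarrow> \<psi> \<theta> = c * \<theta> - (LINT u:{..<0}|\<nu>. 1 - exp (\<theta> * u))"
    and int: "integrable \<nu> (\<lambda>u. u)"
  shows "deriv_zero_plus \<psi> = ereal (c + (LINT u|\<nu>. u))"
  unfolding deriv_zero_plus_def
proof (rule tendsto_Lim)
  have "((\<lambda>\<theta>. c + (LINT u|\<nu>. u * exp (\<theta> * u))) \<longlongrightarrow> c + (LINT u|\<nu>. u)) (at_right 0)"
  proof (intro tendsto_add tendsto_const)
    show "((\<lambda>\<theta>. LINT u|\<nu>. u * exp (\<theta> * u)) \<longlongrightarrow> (LINT u|\<nu>. u)) (at_right 0)"
      unfolding tendsto_at_iff_sequentially comp_def
    proof (intro allI impI)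
      fix X :: "nat \<Rightarrow> real" assume X: "\<forall>i. X i \<in> {0<..} - {0}" "X \<longlonglongrightarrow> 0"
      show "(\<lambda>i. LINT u|\<nu>. u * exp (X i * u)) \<longlonglongrightarrow> (LINT u|\<nu>. u)"
      proof (rule integral_dominated_convergence)
        show "integrable \<nu> (\<lambda>u. \<bar>u\<bar>)" using int by (rule integrable_abs)
        show "AE u in \<nu>. (\<lambda>i. u * exp (X i * u)) \<longlonglongrightarrow> u"
        proof (rule AE_I2)
          fix u
          have "(\<lambda>i. u * exp (X i * u)) \<longlonglongrightarrow> u * exp (0 * u)" by (intro tendsto_intros X)
          then show "(\<lambda>i. u * exp (X i * u)) \<longlonglongrightarrow> u" by simp
        qed
        show "AE u in \<nu>. norm (u * exp (X i * u)) \<le> \<bar>u\<bar>" for i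
          using AE_neg
        proof eventually_elim
          case (elim u)
          have "exp (X i * u) \<le> 1" using elim X(1) by (auto simp: mult_nonneg_nonpos less_imp_le)
          then show ?case by (simp add: abs_mult mult_left_le)
        qed
      qed measurable
    qed
  qed
  then have "((\<lambda>\<theta>. ereal (c + (LINT u|\<nu>. u * exp (\<theta> * u)))) \<longlongrightarrow> ereal (c + (LINT u|\<nu>. u))) (at_right 0)"
    by simp
  then show "((\<lambda>\<theta>. ereal (deriv \<psi> \<theta>)) \<longlongrightarrow> ereal (c + (LINT u|\<nu>. u))) (at_right 0)"
  proof (rule Lim_transform_eventually)
    show "eventually (\<lambda>\<theta>. ereal (c + (LINT u|\<nu>. u * exp (\<theta> * u))) = ereal (deriv \<psi> \<theta>)) (at_right 0)"
      using eventually_at_right_less[of "0::real"]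
      by eventually_elim (simp add: DERIV_imp_deriv[OF exponent_has_derivative[OF \<psi>]])
  qed
qed simp

text \<open>Monotone instead of dominated convergence: for \<open>u < 0\<close> the function
  \<open>|u| * exp (\<theta> * u)\<close> increases to \<open>|u|\<close> as \<open>\<theta>\<close>
  decreases to 0, and the integral of \<open>|u|\<close> is infinite.\<close>

lemma deriv_zero_plus_infinite:
  assumes \<psi>: "\<And>\<theta>. 0 \<le> \<theta> \<Longrightarrow> \<psi> \<theta> = c * \<theta> - (LINT u:{..<0}|\<nu>. 1 - exp (\<theta> * u))"
    and nint: "\<not> integrable \<nu> (\<lambda>u. u)"
  shows "deriv_zero_plus \<psi> = - \<infinity>"
  unfolding deriv_zero_plus_def
proof (rule tendsto_Lim)
  let ?g = "\<lambda>(n::nat) u. ennreal (\<bar>u\<bar> * exp (u / real (Suc n))) * indicator {..<0} u"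
  define I where "I \<theta> = (LINT u|\<nu>. \<bar>u\<bar> * exp (\<theta> * u))" for \<theta>
  have I_nn: "ennreal (I \<theta>) = (\<integral>\<^sup>+ u. ennreal (\<bar>u\<bar> * exp (\<theta> * u)) \<partial>\<nu>)" if "0 < \<theta>" for \<theta>
    unfolding I_def by (rule nn_integral_eq_integral[OF integrable_exp_weight[OF that], symmetric]) auto
  have I_neg: "(LINT u|\<nu>. u * exp (\<theta> * u)) = - I \<theta>" for \<theta>
  proof -
    have "(LINT u|\<nu>. u * exp (\<theta> * u)) = (LINT u|\<nu>. - (\<bar>u\<bar> * exp (\<theta> * u)))"
      by (rule integral_cong_AE) (use AE_neg in auto)
    then show ?thesis by (simp add: I_def)
  qed
  have top: "(SUP n. \<integral>\<^sup>+ u. ?g n u \<partial>\<nu>) = \<infinity>"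
  proof -
    have mono: "incseq (\<lambda>n u. ?g n u)"
    proof (rule incseq_SucI, rule le_funI)
      fix n u
      have "u / real (Suc n) \<le> u / real (Suc (Suc n))" if "u < 0"
        using that by (intro divide_left_mono_neg) auto
      then show "?g n u \<le> ennreal (\<bar>u\<bar> * exp (u / real (Suc (Suc n)))) * indicator {..<0} u"
        by (auto simp del: of_nat_Suc intro!: ennreal_leI mult_left_mono split: split_indicator)
    qed
    have "(SUP n. \<integral>\<^sup>+ u. ?g n u \<partial>\<nu>)
        = (\<integral>\<^sup>+ u. (SUP n. ?g n u) \<partial>\<nu>)"
      by (rule nn_integral_monotone_convergence_SUP[OF mono, symmetric]) measurable
    also have "\<dots> = (\<integral>\<^sup>+ u. ennreal (norm u) \<partial>\<nu>)"
    proof (rule nn_integral_cong_AE)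
      show "AE u in \<nu>. (SUP n. ?g n u) = ennreal (norm u)"
        using AE_neg
      proof eventually_elim
        case (elim u)
        have inc: "incseq (\<lambda>n. ?g n u)"
          using mono by (simp add: incseq_def le_fun_def)
        have "(\<lambda>n. u / real (Suc n)) \<longlonglongrightarrow> 0" by (rule LIMSEQ_Suc[OF lim_const_over_n])
        then have "(\<lambda>n. \<bar>u\<bar> * exp (u / real (Suc n))) \<longlonglongrightarrow> \<bar>u\<bar> * exp 0" by (intro tendsto_intros)
        then have "(\<lambda>n. ennreal (\<bar>u\<bar> * exp (u / real (Suc n)))) \<longlonglongrightarrow> ennreal (\<bar>u\<bar> * exp 0)"
          by (rule tendsto_ennrealI)
        then have "(\<lambda>n. ?g n u) \<longlonglongrightarrow> ennreal (norm u)"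
          using elim by simp
        then show ?case using LIMSEQ_unique LIMSEQ_SUP[OF inc] by blast
      qed
    qed
    also have "\<dots> = \<infinity>"
    proof (rule ccontr)
      assume "\<not> ?thesis"
      then have "integrable \<nu> (\<lambda>u. u)" by (simp add: integrable_iff_bounded less_top)
      then show False using nint by simp
    qed
    finally show ?thesis .
  qed
  have "filterlim I at_top (at_right 0)"
    unfolding filterlim_at_top
  proof
    fix K :: real
    obtain n where n: "ennreal (max K 0) < (\<integral>\<^sup>+ u. ?g n u \<partial>\<nu>)"
      using less_SUP_iff[of "ennreal (max K 0)" "\<lambda>n. \<integral>\<^sup>+ u. ?g n u \<partial>\<nu>" UNIV]
      unfolding top by auto
    \<comment> \<open>Monotonicity in \<open>\<theta>\<close> extends the bound at the rate
      \<open>1 / Suc n\<close> to all smaller rates, hence from a sequence to the filter at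
      0.\<close>
    have "K \<le> I \<theta>" if "0 < \<theta>" "\<theta> < 1 / real (Suc n)" for \<theta>
    proof -
      have "ennreal (max K 0) < ennreal (I \<theta>)"
        unfolding I_nn[OF that(1)]
      proof (rule less_le_trans[OF n], rule nn_integral_mono)
        fix u
        show "?g n u \<le> ennreal (\<bar>u\<bar> * exp (\<theta> * u))"
        proof (cases "u < 0")
          case True
          have "1 / real (Suc n) * u \<le> \<theta> * u" using that True by (intro mult_right_mono_neg) auto
          then show ?thesis using True by (auto simp del: of_nat_Suc intro!: ennreal_leI mult_left_mono)
        qed simp
      qed
      then show ?thesis by (metis ennreal_leI less_le_not_le max.cobounded1 max.coboundedI1 not_le)
    qed
    then show "eventually (\<lambda>\<theta>. K \<le> I \<theta>) (at_right 0)"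
      unfolding eventually_at_right_field by (intro exI[of _ "1 / real (Suc n)"]) (auto simp del: of_nat_Suc)
  qed
  then have "((\<lambda>\<theta>. ereal (I \<theta>)) \<longlongrightarrow> \<infinity>) (at_right 0)"
    by (rule tendsto_PInfty_eq_at_top[THEN iffD2])
  then have "((\<lambda>\<theta>. ereal c + - ereal (I \<theta>)) \<longlongrightarrow> ereal c + - \<infinity>) (at_right 0)"
    by (intro tendsto_add_ereal_general tendsto_intros) auto
  then have "((\<lambda>\<theta>. ereal (c - I \<theta>)) \<longlongrightarrow> - \<infinity>) (at_right 0)" by simp
  then show "((\<lambda>\<theta>. ereal (deriv \<psi> \<theta>)) \<longlongrightarrow> - \<infinity>) (at_right 0)"
  proof (rule Lim_transform_eventually)
    show "eventually (\<lambda>\<theta>. ereal (c - I \<theta>) = ereal (deriv \<psi> \<theta>)) (at_right 0)"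
      using eventually_at_right_less[of "0::real"]
      by eventually_elim (simp add: DERIV_imp_deriv[OF exponent_has_derivative[OF \<psi>]] I_neg)
  qed
qed simp

end

text \<open>The only point where the law of the process is used; from here on it is represented by
  \<open>c\<close> and \<open>\<nu>\<close>. Since \<open>S 0 = 0\<close> holds almost surely only,
  the integrands are compared almost everywhere.\<close>

lemma laplace_exponent_bv:
  assumes X: "spectrally_negative_bv M X c \<nu>" and \<theta>: "0 \<le> \<theta>"
  shows "laplace_exponent M X \<theta> = c * \<theta> - (LINT u:{..<0}|\<nu>. 1 - exp (\<theta> * u))"
proof -
  obtain x0 S where S: "driftless_subordinator M S \<nu>"
    and XS: "\<And>t \<omega>. 0 \<le> t \<Longrightarrow> \<omega> \<in> space M \<Longrightarrow> X t \<omega> = x0 + c * t - S t \<omega>"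
    using X by (auto simp: spectrally_negative_bv_def)
  have levy: "levy_process M S" using S by (simp add: driftless_subordinator_def subordinator_def)
  have [measurable]: "S t \<in> borel_measurable M" if "0 \<le> t" for t using levy that by (simp add: levy_process_def)
  have [measurable]: "S 0 \<in> borel_measurable M" "S 1 \<in> borel_measurable M" by simp_all
  have S0: "AE \<omega> in M. S 0 \<omega> = 0" using levy by (simp add: levy_process_def)
  have "(LINT \<omega>|M. exp (\<theta> * (X 1 \<omega> - X 0 \<omega>))) = (LINT \<omega>|M. exp (\<theta> * (c - S 1 \<omega> + S 0 \<omega>)))"
    by (intro Bochner_Integration.integral_cong) (auto simp: XS)
  also have "\<dots> = (LINT \<omega>|M. exp (\<theta> * c) * exp (- \<theta> * S 1 \<omega>))"
  proof (rule integral_cong_AE)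
    show "AE \<omega> in M. exp (\<theta> * (c - S 1 \<omega> + S 0 \<omega>)) = exp (\<theta> * c) * exp (- \<theta> * S 1 \<omega>)"
      using S0 by eventually_elim (simp add: exp_add[symmetric] algebra_simps)
  qed measurable
  also have "\<dots> = exp (\<theta> * c) * (LINT \<omega>|M. exp (- \<theta> * S 1 \<omega>))" by simp
  also have "(LINT \<omega>|M. exp (- \<theta> * S 1 \<omega>)) = exp (- 1 * (LINT u:{..<0}|\<nu>. 1 - exp (\<theta> * u)))"
    using S \<theta> unfolding driftless_subordinator_def by (metis zero_le_one)
  also have "exp (\<theta> * c) * \<dots> = exp (c * \<theta> - (LINT u:{..<0}|\<nu>. 1 - exp (\<theta> * u)))"
    by (simp add: exp_add[symmetric] algebra_simps)
  finally show ?thesis by (simp add: laplace_exponent_def)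
qed

text \<open>The subordinator stays the same, hence so does \<open>\<nu>\<close>. The equations of
  the two scale functions therefore share one tail, on which the elimination of \<open>V * N\<close>
  relies.\<close>

lemma spectrally_negative_bv_drift:
  assumes "spectrally_negative_bv M X c \<nu>" "\<delta> < c"
  shows "spectrally_negative_bv M (\<lambda>t \<omega>. X t \<omega> - \<delta> * t) (c - \<delta>) \<nu>"
  using assms unfolding spectrally_negative_bv_def by (fastforce simp: algebra_simps)

section \<open>Generator identities\<close>

text \<open>Since \<open>F\<close> vanishes below 0, the base point \<open>s\<close> may be
  negative. This covers base points \<open>a + u\<close> reached by a long jump.\<close>

lemma half_conv_one_increment:
  assumes F: "loc_integrable F" and F0: "\<And>x. x < 0 \<Longrightarrow> F x = 0" and t: "0 \<le> t"
  shows "half_conv (\<lambda>_. 1) F (s + t) - half_conv (\<lambda>_. 1) F s = (LBINT y:{0..t}. F (s + y))"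
proof -
  let ?S = "half_conv (\<lambda>_. 1)"
  have i: "integrable lborel (\<lambda>y. indicator {0..r} y * F y)" for r
    using F by (simp add: loc_integrable_def set_integrable_def)
  have [measurable]: "F \<in> borel_measurable borel" by (rule loc_integrable_measurable[OF F])
  have "?S F (s + t) - ?S F s
      = (LINT y|lborel. indicator {0..s + t} y * F y - indicator {0..s} y * F y)"
    by (simp add: half_conv_def set_lebesgue_integral_def Bochner_Integration.integral_diff[OF i i])
  also have "\<dots> = (LINT y|lborel. indicator {s..s + t} y * F y)"
  proof (rule integral_cong_AE)
    show "AE y in lborel. indicator {0..s + t} y * F y - indicator {0..s} y * F y = indicator {s..s + t} y * F y"
      using AE_lborel_singleton[of s]
      by eventually_elim (use t F0 in \<open>auto split: split_indicator\<close>)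
  qed measurable
  also have "\<dots> = (LINT y|lborel. indicator {s..s + t} (s + 1 * y) * F (s + 1 * y))"
    using lborel_integral_real_affine[of 1 "\<lambda>y. indicator {s..s + t} y * F y" s] by simp
  also have "\<dots> = (LBINT y:{0..t}. F (s + y))"
    unfolding set_lebesgue_integral_def
    by (intro Bochner_Integration.integral_cong) (auto split: split_indicator)
  finally show ?thesis .
qed

lemma half_conv_neg: "t < 0 \<Longrightarrow> half_conv f g t = 0"
  by (simp add: half_conv_def set_lebesgue_integral_def)

lemma half_conv_one_mono:
  assumes F: "loc_integrable F" and F0: "\<And>x. x < 0 \<Longrightarrow> F x = 0" and nn: "\<And>x. 0 \<le> F x"
  shows "mono (half_conv (\<lambda>_. 1) F)"
proof (rule monoI)
  let ?S = "half_conv (\<lambda>_. 1)"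
  fix r s :: real assume "r \<le> s"
  then have "?S F s - ?S F r = (LBINT y:{0..s - r}. F (r + y))"
    using half_conv_one_increment[OF F F0, of "s - r" r] by simp
  also have "0 \<le> \<dots>"
    unfolding set_lebesgue_integral_def by (intro integral_nonneg_AE) (auto simp: nn)
  finally show "?S F r \<le> ?S F s" by simp
qed

section \<open>Integrating a pointwise generator identity\<close>

context bv_jumps
begin

lemma integral_cong_neg:
  fixes f g :: "real \<Rightarrow> real"
  assumes f: "integrable \<nu> f" and g: "g \<in> borel_measurable borel" and eq: "\<And>u. u < 0 \<Longrightarrow> f u = g u"
  shows "integrable \<nu> g" "(LINT u|\<nu>. g u) = (LINT u|\<nu>. f u)"
proof -
  have AE: "AE u in \<nu>. f u = g u" using AE_neg by eventually_elim (rule eq)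
  have g': "g \<in> borel_measurable \<nu>" using g by simp
  show "integrable \<nu> g" by (rule integrable_cong_AE_imp[OF f g']) (use AE in auto)
  show "(LINT u|\<nu>. g u) = (LINT u|\<nu>. f u)"
    by (rule integral_cong_AE) (use AE f g' in auto)
qed

text \<open>For monotone \<open>F\<close> the increments over downward jumps are nonnegative.
  Absolute integrability of the double integral is therefore read off from the known inner value
  \<open>\<gamma>\<close>, and Fubini applies.\<close>

lemma generator_integrate:
  fixes F \<gamma> :: "real \<Rightarrow> real"
  assumes F [measurable]: "F \<in> borel_measurable borel" and mono: "mono F"
    and int: "\<And>z. 0 \<le> z \<Longrightarrow> integrable \<nu> (\<lambda>u. F z - F (z + u))"
    and val: "\<And>z. 0 \<le> z \<Longrightarrow> (LINT u|\<nu>. F z - F (z + u)) = \<gamma> z"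
    and \<gamma>: "set_integrable lborel {0..t} (\<lambda>y. \<gamma> (a + y))" and a: "0 \<le> a"
  shows "(LINT u|\<nu>. (LBINT y:{0..t}. F (a + y) - F (a + y + u))) = (LBINT y:{0..t}. \<gamma> (a + y))"
proof -
  let ?L = "\<lambda>u. LBINT y:{0..t}. F (a + y) - F (a + y + u)"
  let ?\<Phi> = "\<lambda>y u. indicator {0..t} y * (indicator {..<0} u * (F (a + y) - F (a + y + u)))"
  have inner: "integrable \<nu> (\<lambda>u. ?\<Phi> y u)" "(LINT u|\<nu>. ?\<Phi> y u) = indicator {0..t} y * \<gamma> (a + y)" for y
  proof -
    have "integrable \<nu> (\<lambda>u. ?\<Phi> y u) \<and> (LINT u|\<nu>. ?\<Phi> y u) = indicator {0..t} y * \<gamma> (a + y)"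
    proof (cases "y \<in> {0..t}")
      case True
      then have "0 \<le> a + y" using a by auto
      note 1 = integral_cong_neg[OF int[OF this], of "\<lambda>u. indicator {..<0} u * (F (a + y) - F (a + y + u))"]
      show ?thesis using 1 True val[OF \<open>0 \<le> a + y\<close>] by simp
    qed simp
    then show "integrable \<nu> (\<lambda>u. ?\<Phi> y u)" "(LINT u|\<nu>. ?\<Phi> y u) = indicator {0..t} y * \<gamma> (a + y)" by auto
  qed
  have nn: "0 \<le> ?\<Phi> y u" for y u using mono by (auto simp: mono_def split: split_indicator)
  have prod: "integrable (lborel \<Otimes>\<^sub>M \<nu>) (\<lambda>(y, u). ?\<Phi> y u)"
  proof (rule pair.Fubini_integrable)
    have "(LINT u|\<nu>. norm (case (y, u) of (y, u) \<Rightarrow> ?\<Phi> y u)) = indicator {0..t} y * \<gamma> (a + y)" for y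
      by (simp only: split_conv real_norm_def abs_of_nonneg[OF nn] inner(2))
    then show "integrable lborel (\<lambda>y. LINT u|\<nu>. norm (case (y, u) of (y, u) \<Rightarrow> ?\<Phi> y u))"
      using \<gamma> by (simp add: set_integrable_def)
    show "AE y in lborel. integrable \<nu> (\<lambda>u. case (y, u) of (y, u) \<Rightarrow> ?\<Phi> y u)" using inner(1) by simp
  qed measurable
  have "(LINT u|\<nu>. ?L u) = (LINT u|\<nu>. LINT y|lborel. ?\<Phi> y u)"
  proof (rule integral_cong_AE)
    show "AE u in \<nu>. ?L u = (LINT y|lborel. ?\<Phi> y u)"
      using AE_neg by eventually_elim (simp add: set_lebesgue_integral_def)
    show "(\<lambda>u. LBINT y:{0..t}. F (a + y) - F (a + y + u)) \<in> borel_measurable \<nu>"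
      unfolding set_lebesgue_integral_def by measurable
  qed measurable
  also have "\<dots> = (LINT y|lborel. LINT u|\<nu>. ?\<Phi> y u)" by (rule pair.Fubini_integral[OF prod])
  also have "\<dots> = (LBINT y:{0..t}. \<gamma> (a + y))"
    by (simp only: inner(2) set_lebesgue_integral_def real_scaleR_def)
  finally show ?thesis .
qed

end

text \<open>This lists what is used of a scale function once its transform has been exploited. It is
  interpreted twice over the same \<open>\<nu>\<close>: for \<open>W\<close> with drift
  \<open>c\<close> and rate \<open>q\<close>, and for \<open>WW\<close> with drift
  \<open>c - \<delta>\<close> and rate \<open>p\<close>.\<close>

locale bv_scale = bv_jumps +
  fixes c q :: real and W :: "real \<Rightarrow> real"
  assumes c: "0 < c" and q: "0 \<le> q"
    and W_neg: "\<And>x. x < 0 \<Longrightarrow> W x = 0" and W_cont: "continuous_on {0..} W"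
    and W_mono_on: "mono_on {0..} W" and W_meas: "W \<in> borel_measurable borel"
    and W_eq: "\<And>t. 0 \<le> t \<Longrightarrow> c * W t = 1 + half_conv W tail t + q * half_conv W (\<lambda>_. 1) t"
begin

section \<open>Iterated primitives of the scale function\<close>

definition "Wbar = half_conv (\<lambda>_. 1) W"
definition "Wbarbar = half_conv (\<lambda>_. 1) Wbar"
definition "Z x = 1 + q * Wbar x"
text \<open>The second term vanishes for \<open>x <= 0\<close>, so \<open>Zbar x = x\<close> there
  without an oriented integral; \<open>scale_Zbar_eq\<close> links the two forms.\<close>

definition "Zbar x = x + q * Wbarbar x"

lemma W_0: "W 0 = 1 / c"
  using W_eq[of 0] c by (simp add: half_conv_0 field_simps)

lemma W_pos: "0 \<le> x \<Longrightarrow> 0 < W x"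
  using monotone_onD[OF W_mono_on, of 0 x] W_0 c zero_less_divide_1_iff[of c]
  by (metis atLeast_iff order.refl order_less_le_trans)

lemma W_nonneg: "0 \<le> W x"
  using W_pos[of x] W_neg[of x] by (cases "0 \<le> x") auto

lemma mono_W: "mono W"
proof (rule monoI)
  fix x y :: real assume "x \<le> y"
  then show "W x \<le> W y"
    using monotone_onD[OF W_mono_on, of x y] W_neg[of x] W_nonneg[of y] by (cases "0 \<le> x") auto
qed

lemma W_bounded: "loc_bounded W"
  by (rule loc_bounded_of_continuous[OF W_meas W_cont])

lemmas W_int = loc_bounded_imp_integrable[OF W_bounded]

lemma Wbar_bounded: "loc_bounded Wbar" and Wbar_cont: "continuous_on {0..} Wbar"
  unfolding Wbar_def by (intro loc_bounded_half_conv half_conv_continuous loc_bounded_one W_int continuous_on_const)+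

lemmas Wbar_int = loc_bounded_imp_integrable[OF Wbar_bounded]

lemma Wbarbar_bounded: "loc_bounded Wbarbar" and Wbarbar_cont: "continuous_on {0..} Wbarbar"
  unfolding Wbarbar_def by (intro loc_bounded_half_conv half_conv_continuous loc_bounded_one Wbar_int continuous_on_const)+

lemma meas [measurable]: "W \<in> borel_measurable borel" "Wbar \<in> borel_measurable borel" "Wbarbar \<in> borel_measurable borel"
  "Z \<in> borel_measurable borel" "Zbar \<in> borel_measurable borel"
  using W_meas loc_bounded_measurable[OF Wbar_bounded] loc_bounded_measurable[OF Wbarbar_bounded]
  by (simp_all add: Z_def[abs_def] Zbar_def[abs_def])

lemma Wbar_neg: "x < 0 \<Longrightarrow> Wbar x = 0" and Wbarbar_neg: "x < 0 \<Longrightarrow> Wbarbar x = 0"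
  by (simp_all add: Wbar_def Wbarbar_def half_conv_neg)

lemma Wbar_0: "Wbar 0 = 0" and Wbarbar_0: "Wbarbar 0 = 0"
  by (simp_all add: Wbar_def Wbarbar_def half_conv_0)

lemma mono_Wbar: "mono Wbar" unfolding Wbar_def by (rule half_conv_one_mono[OF W_int W_neg W_nonneg])

lemma Wbar_nonneg: "0 \<le> Wbar x"
  using monoD[OF mono_Wbar, of 0 x] Wbar_neg[of x] by (cases "0 \<le> x") (auto simp: Wbar_0)

lemma mono_Wbarbar: "mono Wbarbar" unfolding Wbarbar_def by (rule half_conv_one_mono[OF Wbar_int Wbar_neg Wbar_nonneg])

lemma Wbarbar_nonneg: "0 \<le> Wbarbar x"
  using monoD[OF mono_Wbarbar, of 0 x] Wbarbar_neg[of x] by (cases "0 \<le> x") (auto simp: Wbarbar_0)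

lemma mono_Z: "mono Z" and mono_Zbar: "mono Zbar"
  using mono_Wbar mono_Wbarbar q by (auto simp: mono_def Z_def Zbar_def intro!: add_mono mult_left_mono)

lemma Wbar_increment: "0 \<le> t \<Longrightarrow> Wbar (s + t) - Wbar s = (LBINT y:{0..t}. W (s + y))"
  unfolding Wbar_def by (rule half_conv_one_increment[OF W_int W_neg])

lemma Wbarbar_increment: "0 \<le> t \<Longrightarrow> Wbarbar (s + t) - Wbarbar s = (LBINT y:{0..t}. Wbar (s + y))"
  unfolding Wbarbar_def by (rule half_conv_one_increment[OF Wbar_int Wbar_neg])

lemma lin_growth_mono:
  assumes "mono F" "\<And>x. 0 \<le> F x" "F \<in> borel_measurable borel"
  shows "lin_growth F"
  unfolding lin_growth_def
proof (intro conjI allI assms)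
  fix R
  show "\<exists>C k. 0 \<le> C \<and> 0 \<le> k \<and> (k = 0 \<or> integrable \<nu> (\<lambda>u. u)) \<and> (\<forall>z\<le>R. \<bar>F z\<bar> \<le> C + k * \<bar>z\<bar>)"
    using assms by (intro exI[of _ "F R"] exI[of _ 0]) (auto simp: mono_def)
qed

lemma lin_growth_W: "lin_growth W" and lin_growth_Wbar: "lin_growth Wbar" and lin_growth_Z: "lin_growth Z"
  using q Wbar_nonneg by (auto intro!: lin_growth_mono mono_W mono_Wbar mono_Z W_nonneg meas simp: Z_def)

lemma lin_growth_Zbar:
  assumes i: "integrable \<nu> (\<lambda>u. u)" shows "lin_growth Zbar"
  unfolding lin_growth_def
proof (intro conjI allI meas)
  fix R
  show "\<exists>C k. 0 \<le> C \<and> 0 \<le> k \<and> (k = 0 \<or> integrable \<nu> (\<lambda>u. u)) \<and> (\<forall>z\<le>R. \<bar>Zbar z\<bar> \<le> C + k * \<bar>z\<bar>)"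
  proof (rule exI[of _ "q * Wbarbar R"], rule exI[of _ 1], intro conjI allI impI)
    fix z assume "z \<le> R"
    then have "q * Wbarbar z \<le> q * Wbarbar R" using q monoD[OF mono_Wbarbar] by (intro mult_left_mono) auto
    moreover have "0 \<le> q * Wbarbar z" using q Wbarbar_nonneg by simp
    ultimately show "\<bar>Zbar z\<bar> \<le> q * Wbarbar R + 1 * \<bar>z\<bar>" by (simp add: Zbar_def)
  qed (use i q Wbarbar_nonneg in auto)
qed

text \<open>The increment identity at base point 0: \<open>W\<close> vanishes below 0, so there is
  no overshoot, and the renewal equation evaluates the remaining \<open>W * N\<close>. Passing to
  the primitive avoids the question whether increments of \<open>W\<close> itself are
  integrable.\<close>

lemma generator_Wbar:
  assumes "0 \<le> r"
  shows "integrable \<nu> (\<lambda>u. Wbar r - Wbar (r + u))" "(LINT u|\<nu>. Wbar r - Wbar (r + u)) = c * W r - 1 - q * Wbar r"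
proof -
  have eq: "(LBINT y:{0..r}. W (0 + y) - W (0 + y + u)) = Wbar r - Wbar (r + u)" if "u < 0" for u
  proof -
    have "(LBINT y:{0..r}. W (0 + y) - W (u + y)) = (LBINT y:{0..r}. W (0 + y)) - (LBINT y:{0..r}. W (u + y))"
      by (intro set_integral_diff lin_growth_set_integrable lin_growth_W)
    also have "\<dots> = Wbar r - Wbar (r + u)"
      using Wbar_increment[OF assms, of 0] Wbar_increment[OF assms, of u] Wbar_neg[OF that] by (simp add: Wbar_0 add.commute)
    finally show ?thesis by (simp add: add.commute)
  qed
  have ov: "overshoot W 0 y = 0" if "0 \<le> y" for y
  proof -
    have "overshoot W 0 y = (LINT u|\<nu>. 0)"
      unfolding overshoot_def by (intro Bochner_Integration.integral_cong) (auto intro: W_neg)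
    then show ?thesis by simp
  qed
  have "half_conv (\<lambda>_. 1) (overshoot W 0) r = half_conv (\<lambda>_. 1) (\<lambda>_. 0) r"
    by (rule half_conv_cong) (auto simp: ov)
  then have ov0: "half_conv (\<lambda>_. 1) (overshoot W 0) r = 0" by (simp add: half_conv_def)
  note I = increment_integral[OF lin_growth_W assms, of 0]
  note C = integral_cong_neg[OF I(1), of "\<lambda>u. Wbar r - Wbar (r + u)", OF _ eq]
  show "integrable \<nu> (\<lambda>u. Wbar r - Wbar (r + u))" by (rule C) auto
  have "(LINT u|\<nu>. Wbar r - Wbar (r + u)) = half_conv (\<lambda>z. W (0 + z)) tail r"
    using C(2) I(2) ov0 by simp
  also have "\<dots> = c * W r - 1 - q * Wbar r"
    using W_eq[OF assms] by (simp add: Wbar_def half_conv_commute[of _ "\<lambda>_. 1"])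
  finally show "(LINT u|\<nu>. Wbar r - Wbar (r + u)) = c * W r - 1 - q * Wbar r" .
qed

text \<open>The difference of the generator identities for \<open>Wbar\<close> at
  \<open>a + t\<close> and at \<open>a\<close>; the constant 1 cancels. The second difference of
  \<open>Wbar\<close> is the increment of \<open>W\<close> integrated over the window.\<close>

lemma convolution_W:
  assumes a: "0 \<le> a" and t: "0 \<le> t"
  shows "c * (W (a + t) - W a) = half_conv (\<lambda>z. W (a + z)) tail t - half_conv (\<lambda>_. 1) (overshoot W a) t
     + q * half_conv (\<lambda>z. W (a + z)) (\<lambda>_. 1) t"
proof -
  have at: "0 \<le> a + t" using a t by simp
  have eq: "(Wbar (a + t) - Wbar (a + t + u)) - (Wbar a - Wbar (a + u)) = (LBINT y:{0..t}. W (a + y) - W (a + y + u))" for u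
  proof -
    have "(LBINT y:{0..t}. W (a + y) - W (a + u + y)) = (LBINT y:{0..t}. W (a + y)) - (LBINT y:{0..t}. W (a + u + y))"
      by (intro set_integral_diff lin_growth_set_integrable lin_growth_W)
    then show ?thesis using Wbar_increment[OF t, of a] Wbar_increment[OF t, of "a + u"] by (simp add: add_ac)
  qed
  have "half_conv (\<lambda>z. W (a + z)) tail t - half_conv (\<lambda>_. 1) (overshoot W a) t
      = (LINT u|\<nu>. (Wbar (a + t) - Wbar (a + t + u)) - (Wbar a - Wbar (a + u)))"
    unfolding eq by (rule increment_integral(2)[OF lin_growth_W t, symmetric])
  also have "\<dots> = (c * W (a + t) - 1 - q * Wbar (a + t)) - (c * W a - 1 - q * Wbar a)"
    using generator_Wbar[OF a] generator_Wbar[OF at] by (simp add: Bochner_Integration.integral_diff)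
  also have "\<dots> = c * (W (a + t) - W a) - q * (Wbar (a + t) - Wbar a)" by (simp add: algebra_simps)
  also have "Wbar (a + t) - Wbar a = half_conv (\<lambda>z. W (a + z)) (\<lambda>_. 1) t"
    using Wbar_increment[OF t] by (simp add: half_conv_commute[of _ "\<lambda>_. 1"] half_conv_one)
  finally show ?thesis by simp
qed

text \<open>\<open>Z\<close> and \<open>q * Wbar\<close> differ by a constant, so the generator
  gives \<open>q\<close> times its value on \<open>Wbar\<close>, which is
  \<open>q * c * W - q * Z\<close>; the constant has been absorbed by \<open>Z\<close>. Over the
  window, \<open>q * W\<close> integrates to the increment of \<open>Z\<close>.\<close>

lemma convolution_Z:
  assumes a: "0 \<le> a" and t: "0 \<le> t"
  shows "c * (Z (a + t) - Z a) = half_conv (\<lambda>z. Z (a + z)) tail t - half_conv (\<lambda>_. 1) (overshoot Z a) t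
     + q * half_conv (\<lambda>z. Z (a + z)) (\<lambda>_. 1) t"
proof -
  have iW: "set_integrable lborel {0..t} (\<lambda>y. W (a + y))" and iZ: "set_integrable lborel {0..t} (\<lambda>y. Z (a + y))"
    by (intro lin_growth_set_integrable lin_growth_W lin_growth_Z)+
  have ZWbar: "Z z - Z (z + u) = q * (Wbar z - Wbar (z + u))" for z u by (simp add: Z_def algebra_simps)
  have "half_conv (\<lambda>z. Z (a + z)) tail t - half_conv (\<lambda>_. 1) (overshoot Z a) t
      = (LINT u|\<nu>. (LBINT y:{0..t}. Z (a + y) - Z (a + y + u)))"
    by (rule increment_integral(2)[OF lin_growth_Z t, symmetric])
  also have "\<dots> = (LBINT y:{0..t}. (q * c) * W (a + y) - q * Z (a + y))"
  proof (rule generator_integrate[where \<gamma>="\<lambda>z. (q * c) * W z - q * Z z"])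
    show "integrable \<nu> (\<lambda>u. Z z - Z (z + u))" if "0 \<le> z" for z
      unfolding ZWbar by (intro integrable_mult_right generator_Wbar that)
    show "(LINT u|\<nu>. Z z - Z (z + u)) = (q * c) * W z - q * Z z" if "0 \<le> z" for z
      unfolding ZWbar by (simp only: integral_mult_right_zero generator_Wbar(2)[OF that]) (simp add: Z_def algebra_simps)
  qed (auto intro!: mono_Z a set_integral_diff set_integrable_mult_right iW iZ)
  also have "\<dots> = (q * c) * (LBINT y:{0..t}. W (a + y)) - q * (LBINT y:{0..t}. Z (a + y))"
    by (simp only: set_integral_diff set_integrable_mult_right iW iZ set_integral_mult_right)
  also have "(q * c) * (LBINT y:{0..t}. W (a + y)) = c * (Z (a + t) - Z a)"
    unfolding Wbar_increment[OF t, symmetric] by (simp add: Z_def algebra_simps)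
  finally show ?thesis by (simp add: half_conv_commute[of _ "\<lambda>_. 1"] half_conv_one)
qed

text \<open>Integrating the identity for \<open>Wbar\<close> over \<open>{0..z}\<close> treats the
  part \<open>q * Wbarbar\<close>; the linear part contributes \<open>- u\<close>, whose integral is
  the first moment. The constant \<open>c\<close> arises from
  \<open>c * q * Wbar z = c * (Z z - 1)\<close>.\<close>

lemma generator_Zbar:
  assumes int: "integrable \<nu> (\<lambda>u. u)" and z: "0 \<le> z"
  shows "integrable \<nu> (\<lambda>u. Zbar z - Zbar (z + u))"
    "(LINT u|\<nu>. Zbar z - Zbar (z + u)) = c * Z z - q * Zbar z - (c + (LINT u|\<nu>. u))"
proof -
  have iW: "set_integrable lborel {0..z} (\<lambda>y. W (0 + y))" and iWbar: "set_integrable lborel {0..z} (\<lambda>y. Wbar (0 + y))"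
    and iWbaru: "set_integrable lborel {0..z} (\<lambda>y. Wbar (u + y))" for u
    by (intro lin_growth_set_integrable lin_growth_W lin_growth_Wbar)+
  note i1 = set_integrable_const_Icc[of 0 z "1::real"]
  define K where "K u = (LBINT y:{0..z}. Wbar (0 + y) - Wbar (0 + y + u))" for u
  have K_int: "integrable \<nu> K"
    unfolding K_def[abs_def] by (rule increment_integral(1)[OF lin_growth_Wbar z])
  have "(LINT u|\<nu>. K u) = (LBINT y:{0..z}. c * W (0 + y) - 1 - q * Wbar (0 + y))"
    unfolding K_def
  proof (rule generator_integrate[where \<gamma>="\<lambda>z. c * W z - 1 - q * Wbar z"])
    show "set_integrable lborel {0..z} (\<lambda>y. c * W (0 + y) - 1 - q * Wbar (0 + y))"
      by (intro set_integral_diff set_integrable_mult_right iW iWbar i1)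
  qed (auto intro: mono_Wbar generator_Wbar)
  also have "\<dots> = c * (LBINT y:{0..z}. W (0 + y)) - (LBINT y:{0..z}. 1) - q * (LBINT y:{0..z}. Wbar (0 + y))"
    by (simp only: set_integral_diff set_integrable_mult_right iW iWbar i1 set_integral_mult_right)
  also have "(LBINT y:{0..z}. (1::real)) = z" using z by (simp add: set_lebesgue_integral_def)
  also have "(LBINT y:{0..z}. W (0 + y)) = Wbar z" using Wbar_increment[OF z, of 0] by (simp add: Wbar_0)
  also have "(LBINT y:{0..z}. Wbar (0 + y)) = Wbarbar z" using Wbarbar_increment[OF z, of 0] by (simp add: Wbarbar_0)
  finally have K_val: "(LINT u|\<nu>. K u) = c * Wbar z - z - q * Wbarbar z" .
  have eq: "q * K u - u = Zbar z - Zbar (z + u)" if "u < 0" for u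
  proof -
    have "K u = (LBINT y:{0..z}. Wbar (0 + y) - Wbar (u + y))" by (simp add: K_def add.commute)
    also have "\<dots> = (LBINT y:{0..z}. Wbar (0 + y)) - (LBINT y:{0..z}. Wbar (u + y))"
      by (rule set_integral_diff[OF iWbar iWbaru])
    also have "\<dots> = Wbarbar z - Wbarbar (z + u)"
      using Wbarbar_increment[OF z, of 0] Wbarbar_increment[OF z, of u] Wbarbar_neg[OF that] by (simp add: Wbarbar_0 add.commute)
    finally have K: "K u = Wbarbar z - Wbarbar (z + u)" .
    show ?thesis unfolding K by (simp add: Zbar_def algebra_simps)
  qed
  have i: "integrable \<nu> (\<lambda>u. q * K u - u)" using K_int int by simp
  note C = integral_cong_neg[OF i, of "\<lambda>u. Zbar z - Zbar (z + u)", OF _ eq]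
  show "integrable \<nu> (\<lambda>u. Zbar z - Zbar (z + u))" by (rule C) auto
  have "(LINT u|\<nu>. Zbar z - Zbar (z + u)) = (LINT u|\<nu>. q * K u - u)" by (rule C) auto
  also have "\<dots> = q * (LINT u|\<nu>. K u) - (LINT u|\<nu>. u)" using K_int int by simp
  finally show "(LINT u|\<nu>. Zbar z - Zbar (z + u)) = c * Z z - q * Zbar z - (c + (LINT u|\<nu>. u))"
    unfolding K_val by (simp add: Z_def Zbar_def algebra_simps)
qed

lemma Zbar_increment:
  assumes t: "0 \<le> t"
  shows "Zbar (a + t) - Zbar a = (LBINT y:{0..t}. Z (a + y))"
proof -
  note i1 = set_integrable_const_Icc[of 0 t "1::real"]
  have iWbar: "set_integrable lborel {0..t} (\<lambda>y. Wbar (a + y))"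
    by (intro lin_growth_set_integrable lin_growth_Wbar)
  have "(LBINT y:{0..t}. Z (a + y)) = (LBINT y:{0..t}. 1) + q * (LBINT y:{0..t}. Wbar (a + y))"
    unfolding Z_def by (simp only: set_integral_add set_integrable_mult_right iWbar i1 set_integral_mult_right)
  also have "(LBINT y:{0..t}. (1::real)) = t" using t by (simp add: set_lebesgue_integral_def)
  finally show ?thesis unfolding Wbarbar_increment[OF t, symmetric] by (simp add: Zbar_def algebra_simps)
qed

text \<open>The constant of \<open>generator_Zbar\<close> is neither cancelled by a difference, as
  for \<open>W\<close>, nor absorbed, as for \<open>Z\<close>. Integrated over the window it becomes
  a multiple of \<open>1 * 1\<close>.\<close>

lemma convolution_Zbar:
  assumes int: "integrable \<nu> (\<lambda>u. u)" and a: "0 \<le> a" and t: "0 \<le> t"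
  shows "c * (Zbar (a + t) - Zbar a) = half_conv (\<lambda>z. Zbar (a + z)) tail t - half_conv (\<lambda>_. 1) (overshoot Zbar a) t
     + q * half_conv (\<lambda>z. Zbar (a + z)) (\<lambda>_. 1) t + (c + (LINT u|\<nu>. u)) * half_conv (\<lambda>_. 1) (\<lambda>_. 1) t"
proof -
  let ?m = "c + (LINT u|\<nu>. u)"
  have iZ: "set_integrable lborel {0..t} (\<lambda>y. Z (a + y))" and iZb: "set_integrable lborel {0..t} (\<lambda>y. Zbar (a + y))"
    by (intro lin_growth_set_integrable lin_growth_Z lin_growth_Zbar int)+
  note im = set_integrable_const_Icc[of 0 t "?m * 1"]
  have "half_conv (\<lambda>z. Zbar (a + z)) tail t - half_conv (\<lambda>_. 1) (overshoot Zbar a) t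
      = (LINT u|\<nu>. (LBINT y:{0..t}. Zbar (a + y) - Zbar (a + y + u)))"
    by (rule increment_integral(2)[OF lin_growth_Zbar[OF int] t, symmetric])
  also have "\<dots> = (LBINT y:{0..t}. c * Z (a + y) - q * Zbar (a + y) - ?m * 1)"
  proof (rule generator_integrate[where \<gamma>="\<lambda>z. c * Z z - q * Zbar z - ?m * 1"])
    show "(LINT u|\<nu>. Zbar z - Zbar (z + u)) = c * Z z - q * Zbar z - ?m * 1" if "0 \<le> z" for z
      using generator_Zbar(2)[OF int that] by simp
    show "set_integrable lborel {0..t} (\<lambda>y. c * Z (a + y) - q * Zbar (a + y) - ?m * 1)"
      by (intro set_integral_diff set_integrable_mult_right iZ iZb im)
  qed (auto intro: mono_Zbar a generator_Zbar int)
  also have "\<dots> = c * (LBINT y:{0..t}. Z (a + y)) - q * (LBINT y:{0..t}. Zbar (a + y)) - ?m * (LBINT y:{0..t}. 1)"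
    by (simp only: set_integral_diff set_integrable_mult_right iZ iZb im set_integral_mult_right)
  finally show ?thesis
    unfolding Zbar_increment[OF t, symmetric]
    by (simp add: half_conv_commute[of "\<lambda>z. Zbar (a + z)"] half_conv_one)
qed

text \<open>The rate \<open>q\<close> is absorbed into the kernel: \<open>tail y + q\<close> is
  again nonnegative and antitone, so \<open>renewal_density\<close> applies. Setting the density to
  0 below 0 makes \<open>half_conv_one_increment\<close> applicable at every base point
  \<open>a\<close>.\<close>

lemma W_density:
  obtains w D where "loc_integrable w" "\<And>x. x < 0 \<Longrightarrow> w x = 0"
    "\<And>a t. 0 \<le> a \<Longrightarrow> 0 \<le> t \<Longrightarrow> W (a + t) = W a + half_conv (\<lambda>_. 1) (\<lambda>z. w (a + z)) t"
    "countable D" "\<And>x. 0 < x \<Longrightarrow> x \<notin> D \<Longrightarrow> deriv W x = w x"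
proof -
  let ?S = "half_conv (\<lambda>_. 1)"
  let ?h = "\<lambda>y. tail y + q * 1"
  have h: "loc_integrable ?h"
    using tail_loc_integrable loc_bounded_imp_integrable[OF loc_bounded_one]
    unfolding loc_integrable_def by (intro conjI allI set_integral_add set_integrable_mult_right) auto
  have eq: "c * W t = 1 + half_conv W ?h t" if "0 \<le> t" for t
  proof -
    have "half_conv W ?h t = half_conv W tail t + q * half_conv W (\<lambda>_. 1) t"
    proof -
      have "half_conv W ?h t = (LBINT y:{0..t}. W (t - y) * tail y + q * (W (t - y) * 1))"
        by (simp add: half_conv_def algebra_simps)
      also have "\<dots> = half_conv W tail t + q * half_conv W (\<lambda>_. 1) t"
        unfolding half_conv_def
        by (simp only: set_integral_add set_integrable_mult_right set_integral_mult_right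
            half_conv_integrable[OF W_bounded tail_loc_integrable]
            half_conv_integrable[OF W_bounded loc_bounded_imp_integrable[OF loc_bounded_one]])
      finally show ?thesis .
    qed
    then show ?thesis using W_eq[OF that] by simp
  qed
  obtain w D where w: "loc_integrable w" and W_w: "\<And>t. 0 \<le> t \<Longrightarrow> W t = W 0 + ?S w t"
    and D: "countable D" "\<And>x. 0 < x \<Longrightarrow> x \<notin> D \<Longrightarrow> (W has_real_derivative w x) (at x)"
  proof (rule renewal_density[OF h _ _ c W_cont W_meas eq])
    show "0 \<le> ?h y" if "0 < y" for y using tail_nonneg q by simp
    show "?h y \<le> ?h x" if "0 < x" "x \<le> y" for x y using tail_antimono[OF that] by simp
  qed (assumption | rule that)+
  define w' where "w' x = indicator {0..} x * w x" for x
  have w': "loc_integrable w'"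
    unfolding loc_integrable_def
  proof (intro conjI allI)
    show "w' \<in> borel_measurable borel"
      unfolding w'_def using loc_integrable_measurable[OF w] by simp
    fix t
    have "set_integrable lborel {0..t} w" using w by (simp add: loc_integrable_def)
    then show "set_integrable lborel {0..t} w'"
      by (rule set_integrable_cong[THEN iffD1, rotated -1]) (auto simp: w'_def)
  qed
  have w'0: "w' x = 0" if "x < 0" for x using that by (simp add: w'_def)
  have W_w': "W t = W 0 + ?S w' t" if "0 \<le> t" for t
  proof -
    have "?S w t = ?S w' t" by (rule half_conv_cong) (auto simp: w'_def)
    then show ?thesis using W_w[OF that] by simp
  qed
  show ?thesis
  proof (rule that[OF w' w'0 _ D(1)])
    fix a t :: real assume at: "0 \<le> a" "0 \<le> t"
    have "W (a + t) - W a = ?S w' (a + t) - ?S w' a"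
      using W_w'[of "a + t"] W_w'[of a] at by simp
    also have "\<dots> = ?S (\<lambda>z. w' (a + z)) t"
      using half_conv_one_increment[OF w' w'0 at(2)] by (simp add: half_conv_one)
    finally show "W (a + t) = W a + ?S (\<lambda>z. w' (a + z)) t" by simp
  qed (use D in \<open>auto simp: w'_def intro: DERIV_imp_deriv\<close>)
qed

end

section \<open>The main identities\<close>

lemma ext_integral_ereal:
  fixes f :: "'a \<Rightarrow> real"
  assumes f: "set_integrable M A f" and A: "A \<in> sets M"
  shows "ext_integral M A (\<lambda>x. ereal (f x)) = ereal (set_lebesgue_integral M A f)"
proof -
  let ?g = "\<lambda>x. indicator A x *\<^sub>R f x"
  have g: "integrable M ?g" using f by (simp add: set_integrable_def)
  have pos: "(\<integral>\<^sup>+ x. ennreal (?g x) \<partial>M) \<noteq> \<infinity>" and neg: "(\<integral>\<^sup>+ x. ennreal (- ?g x) \<partial>M) \<noteq> \<infinity>"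
    using g unfolding real_integrable_def by blast+
  have 1: "(\<integral>\<^sup>+ x\<in>A. e2ennreal (ereal (f x)) \<partial>M) = (\<integral>\<^sup>+ x. ennreal (?g x) \<partial>M)"
    by (intro nn_integral_cong) (auto split: split_indicator simp: e2ennreal_ereal)
  have 2: "(\<integral>\<^sup>+ x\<in>A. e2ennreal (- ereal (f x)) \<partial>M) = (\<integral>\<^sup>+ x. ennreal (- ?g x) \<partial>M)"
    by (intro nn_integral_cong) (auto split: split_indicator simp: e2ennreal_ereal)
  have "enn2ereal a - enn2ereal b = ereal (enn2real a - enn2real b)" if "a \<noteq> \<infinity>" "b \<noteq> \<infinity>" for a b :: ennreal
    using that by (cases a; cases b) (auto simp: enn2ereal_ennreal)
  from this[OF pos neg] show ?thesis
    unfolding ext_integral_def 1 2 real_lebesgue_integral_def[OF g] set_lebesgue_integral_def by simp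
qed

lemma ext_integral_cong_AE:
  assumes "AE x in M. x \<in> A \<longrightarrow> f x = g x"
  shows "ext_integral M A f = ext_integral M A g"
proof -
  have "(\<integral>\<^sup>+ x\<in>A. e2ennreal (f x) \<partial>M) = (\<integral>\<^sup>+ x\<in>A. e2ennreal (g x) \<partial>M)"
    "(\<integral>\<^sup>+ x\<in>A. e2ennreal (- f x) \<partial>M) = (\<integral>\<^sup>+ x\<in>A. e2ennreal (- g x) \<partial>M)"
    by (rule nn_integral_cong_AE; use assms in eventually_elim; auto split: split_indicator)+
  then show ?thesis by (simp add: ext_integral_def)
qed

lemma interval_integral_eq_half_conv:
  fixes V F :: "real \<Rightarrow> real"
  assumes "b \<le> x"
  shows "(LBINT y=b..x. V (x - y) * F (y - v)) = half_conv V (\<lambda>z. F (b - v + z)) (x - b)"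
proof -
  have "(LBINT y=b..x. V (x - y) * F (y - v)) = (LBINT y:{b..x}. V (x - y) * F (y - v))"
    by (rule interval_integral_Icc[OF assms])
  also have "\<dots> = (LINT y|lborel. indicator {b..x} (b + 1 * y) *\<^sub>R (V (x - (b + 1 * y)) * F (b + 1 * y - v)))"
    unfolding set_lebesgue_integral_def
    using lborel_integral_real_affine[of 1 "\<lambda>y. indicator {b..x} y *\<^sub>R (V (x - y) * F (y - v))" b]
    by simp
  also have "\<dots> = half_conv V (\<lambda>z. F (b - v + z)) (x - b)"
    unfolding half_conv_def set_lebesgue_integral_def
    by (intro Bochner_Integration.integral_cong) (auto simp: algebra_simps split: split_indicator)
  finally show ?thesis .
qed

lemma interval_integral_0_neg:
  fixes F :: "real \<Rightarrow> real"
  assumes "x \<le> 0"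
  shows "(LBINT y=0..ereal x. F y) = - (LBINT y:{x..0}. F y)"
  using interval_integral_endpoints_reverse[of 0 "ereal x" F] interval_integral_Icc[OF assms, of F]
  by (simp add: zero_ereal_def)

lemma interval_integral_0_eq_half_conv:
  assumes "\<And>x. x < 0 \<Longrightarrow> F x = 0"
  shows "(LBINT y=0..ereal x. F y) = half_conv (\<lambda>_. 1) F x"
proof (cases "0 \<le> x")
  case True
  then have "(LBINT y=ereal 0..ereal x. F y) = (LBINT y:{0..x}. F y)" by (rule interval_integral_Icc)
  then show ?thesis by (simp add: half_conv_one zero_ereal_def)
next
  case False
  then have x: "x \<le> 0" by simp
  have "(LBINT y:{x..0}. F y) = 0"
    unfolding set_lebesgue_integral_def
  proof (rule integral_eq_zero_AE)
    show "AE y in lborel. indicator {x..0} y *\<^sub>R F y = 0"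
      using AE_lborel_singleton[of "0::real"] by eventually_elim (auto simp: assms split: split_indicator)
  qed
  then show ?thesis using False by (simp add: half_conv_neg interval_integral_0_neg[OF x])
qed

context bv_jumps
begin

lemma overshoot_integrable:
  assumes F: "lin_growth F" and y: "0 < y"
  shows "set_integrable \<nu> {..<-y} (\<lambda>u. F (a + y + u))"
proof -
  let ?d = "\<lambda>C k u. (C + k * \<bar>a + y\<bar>) * indicator {..<-y} u + k * \<bar>u\<bar>"
  let ?f = "\<lambda>u. indicator {..<-y} u *\<^sub>R F (a + y + u)"
  have [measurable]: "F \<in> borel_measurable borel" using F by (simp add: lin_growth_def)
  obtain C k where *: "0 \<le> C" "0 \<le> k" "k = 0 \<or> integrable \<nu> (\<lambda>u. u)" "\<And>z. z \<le> a \<Longrightarrow> \<bar>F z\<bar> \<le> C + k * \<bar>z\<bar>"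
    using F unfolding lin_growth_def by blast
  have "integrable \<nu> (\<lambda>u. k * \<bar>u\<bar>)"
    using *(3)
  proof
    assume "integrable \<nu> (\<lambda>u. u)"
    then show ?thesis by (intro integrable_mult_right integrable_abs)
  qed simp
  moreover have "integrable \<nu> (\<lambda>u. (C + k * \<bar>a + y\<bar>) * indicator {..<-y} u)"
    using emeasure_tail_finite[OF y] by (intro integrable_mult_right integrable_real_indicator) auto
  ultimately have int: "integrable \<nu> (\<lambda>u. ?d C k u)"
    by (rule Bochner_Integration.integrable_add[rotated])
  have "norm (?f u) \<le> norm (?d C k u)" for u
  proof (cases "u < - y")
    case True
    have "\<bar>F (a + y + u)\<bar> \<le> C + k * \<bar>a + y + u\<bar>" using True by (intro *(4)) auto
    also have "k * \<bar>a + y + u\<bar> \<le> k * (\<bar>a + y\<bar> + \<bar>u\<bar>)" using * by (intro mult_left_mono) auto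
    finally show ?thesis using True by (auto simp: algebra_simps intro: order.trans[OF _ abs_ge_self])
  qed simp
  then show ?thesis
    unfolding set_integrable_def by (intro Bochner_Integration.integrable_bound[OF int]) auto
qed

text \<open>Under integrability an extended integral is the real one, and the factor
  \<open>V (t - y)\<close> cuts the range \<open>{0..}\<close> down to
  \<open>{0..t}\<close>.\<close>

lemma ext_integral_overshoot:
  assumes F: "lin_growth F" and V: "loc_bounded V" and V_neg: "\<And>x. x < 0 \<Longrightarrow> V x = 0"
  shows "ext_integral lborel {0..} (\<lambda>y. ext_integral \<nu> {..<-y} (\<lambda>u. ereal (F (a + y + u) * V (t - y))))
    = ereal (half_conv V (overshoot F a) t)"
proof -
  let ?I = "\<lambda>y. ext_integral \<nu> {..<-y} (\<lambda>u. ereal (F (a + y + u) * V (t - y)))"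
  have "ext_integral lborel {0..} (\<lambda>y. ?I y)
     = ext_integral lborel {0..} (\<lambda>y. ereal (V (t - y) * overshoot F a y))"
  proof (rule ext_integral_cong_AE)
    \<comment> \<open>At \<open>y = 0\<close> the inner integral runs over all jumps and may
      diverge; this single point is discarded.\<close>
    show "AE y in lborel. y \<in> {0..} \<longrightarrow> ?I y = ereal (V (t - y) * overshoot F a y)"
      using AE_lborel_singleton[of "0::real"]
    proof (eventually_elim, intro impI)
      fix y :: real assume "y \<noteq> 0" "y \<in> {0..}"
      then have y: "0 < y" by auto
      have "?I y = ereal (LINT u:{..<-y}|\<nu>. F (a + y + u) * V (t - y))"
        by (rule ext_integral_ereal) (auto intro!: set_integrable_mult_left overshoot_integrable F y)
      also have "(LINT u:{..<-y}|\<nu>. F (a + y + u) * V (t - y)) = (LINT u:{..<-y}|\<nu>. F (a + y + u)) * V (t - y)"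
        by (rule set_integral_mult_left)
      also have "(LINT u:{..<-y}|\<nu>. F (a + y + u)) = overshoot F a y"
        unfolding overshoot_def set_lebesgue_integral_def
        by (intro Bochner_Integration.integral_cong) auto
      finally show "?I y = ereal (V (t - y) * overshoot F a y)"
        by (simp add: mult.commute)
    qed
  qed
  also have "\<dots> = ereal (LBINT y:{0..}. V (t - y) * overshoot F a y)"
  proof (rule ext_integral_ereal)
    have "set_integrable lborel {0..t} (\<lambda>y. V (t - y) * overshoot F a y)"
      by (rule half_conv_integrable[OF V overshoot_loc_integrable[OF F]])
    moreover have "indicator {0..t} y *\<^sub>R (V (t - y) * overshoot F a y) = indicator {0..} y *\<^sub>R (V (t - y) * overshoot F a y)" for y
      using V_neg[of "t - y"] by (auto split: split_indicator)
    ultimately show "set_integrable lborel {0..} (\<lambda>y. V (t - y) * overshoot F a y)"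
      unfolding set_integrable_def by (simp only:)
  qed simp
  also have "(LBINT y:{0..}. V (t - y) * overshoot F a y) = half_conv V (overshoot F a) t"
    unfolding half_conv_def set_lebesgue_integral_def
    by (intro Bochner_Integration.integral_cong refl) (use V_neg in \<open>auto split: split_indicator\<close>)
  finally show ?thesis .
qed

text \<open>Jumps of size at most \<open>y\<close> contribute no more than the finite integral of
  \<open>min y |u|\<close>, so an infinite first moment is due to the long jumps.\<close>

lemma nn_integral_tail_infinite:
  assumes nint: "\<not> integrable \<nu> (\<lambda>u. u)" and y: "0 < y"
  shows "(\<integral>\<^sup>+ u\<in>{..<-y}. ennreal (- u) \<partial>\<nu>) = \<infinity>"
proof (rule ccontr)
  assume "\<not> ?thesis"
  then have fin: "(\<integral>\<^sup>+ u\<in>{..<-y}. ennreal (- u) \<partial>\<nu>) < \<infinity>" by (simp add: less_top)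
  have "(\<integral>\<^sup>+ u. ennreal (norm u) \<partial>\<nu>) \<le> (\<integral>\<^sup>+ u. ennreal (- u) * indicator {..<-y} u + ennreal (min y \<bar>u\<bar>) \<partial>\<nu>)"
  proof (rule nn_integral_mono_AE)
    show "AE u in \<nu>. ennreal (norm u) \<le> ennreal (- u) * indicator {..<-y} u + ennreal (min y \<bar>u\<bar>)"
      using AE_neg by eventually_elim (auto split: split_indicator simp: min_def)
  qed
  also have "\<dots> = (\<integral>\<^sup>+ u\<in>{..<-y}. ennreal (- u) \<partial>\<nu>) + (\<integral>\<^sup>+ u. ennreal (min y \<bar>u\<bar>) \<partial>\<nu>)"
    by (rule nn_integral_add) auto
  also have "\<dots> < \<infinity>"
  proof -
    have "(\<integral>\<^sup>+ u. ennreal (min y \<bar>u\<bar>) \<partial>\<nu>) = ennreal (LINT u|\<nu>. min y \<bar>u\<bar>)"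
      by (rule nn_integral_eq_integral) (use y in \<open>auto intro!: integrable_min\<close>)
    then show ?thesis using fin by simp
  qed
  finally have "integrable \<nu> (\<lambda>u. u)" by (simp add: integrable_iff_bounded)
  then show False using nint by simp
qed

end

section \<open>The identities for \<open>W\<close>, \<open>Z\<close> and \<open>Zbar\<close> as
  convolutions\<close>

context bv_scale
begin

lemma
  shows scale_Wbar_eq: "scale_Wbar W x = Wbar x" and scale_Z_eq: "scale_Z q W = Z"
    and scale_Zbar_eq: "scale_Zbar q W x = Zbar x"
proof -
  have 1: "scale_Wbar W x = Wbar x" for x
    unfolding scale_Wbar_def Wbar_def by (rule interval_integral_0_eq_half_conv[OF W_neg])
  then show "scale_Wbar W x = Wbar x" .
  show 2: "scale_Z q W = Z" by (simp add: fun_eq_iff scale_Z_def Z_def 1)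
  have "(LBINT z=0..ereal x. Z z) = Zbar x"
  proof (cases "0 \<le> x")
    case True
    then have "(LBINT z=ereal 0..ereal x. Z z) = (LBINT z:{0..x}. Z z)" by (rule interval_integral_Icc)
    also have "\<dots> = Zbar x" using Zbar_increment[OF True, of 0] by (simp add: Zbar_def Wbarbar_0)
    finally show ?thesis by (simp add: zero_ereal_def)
  next
    case False
    then have x: "x \<le> 0" by simp
    have "(LBINT z:{x..0}. Z z) = (LBINT z:{x..0}. 1)"
    proof (rule set_lebesgue_integral_cong)
      show "\<forall>z. z \<in> {x..0} \<longrightarrow> Z z = 1"
      proof (intro allI impI)
        fix z assume "z \<in> {x..0}"
        then show "Z z = 1" using Wbar_neg[of z] by (cases "z = 0") (auto simp: Z_def Wbar_0)
      qed
    qed simp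
    also have "\<dots> = - x" using x by (simp add: set_lebesgue_integral_def)
    finally show ?thesis using Wbarbar_neg[of x] False by (simp add: Zbar_def interval_integral_0_neg[OF x])
  qed
  then show "scale_Zbar q W x = Zbar x" by (simp add: scale_Zbar_def 2)
qed

lemma Z_cont: "continuous_on {0..} Z" and Zbar_cont: "continuous_on {0..} Zbar"
  unfolding Z_def Zbar_def by (intro continuous_intros Wbar_cont Wbarbar_cont)+

lemma shift_bounded:
  assumes "continuous_on {0..} F" "F \<in> borel_measurable borel" "0 \<le> a"
  shows "continuous_on {0..} (\<lambda>z. F (a + z))" "loc_bounded (\<lambda>z. F (a + z))"
proof -
  show 1: "continuous_on {0..} (\<lambda>z. F (a + z))"
    using assms(3) by (intro continuous_on_compose2[OF assms(1)] continuous_intros) auto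
  show "loc_bounded (\<lambda>z. F (a + z))"
    by (rule loc_bounded_of_continuous[OF _ 1]) (use assms(2) in simp)
qed

lemma resolvent_W:
  assumes V: "loc_bounded V" "continuous_on {0..} V"
    and V_eq: "\<And>t. 0 \<le> t \<Longrightarrow> (c - \<delta>) * V t = 1 + half_conv V tail t + p * half_conv V (\<lambda>_. 1) t"
    and a: "0 \<le> a" and t: "0 \<le> t"
  shows "half_conv V (overshoot W a) t = (c - \<delta>) * W a * V t - W (a + t)
     - \<delta> * half_conv V (\<lambda>z. deriv W (a + z)) t + (q - p) * half_conv V (\<lambda>z. W (a + z)) t"
proof -
  obtain w D where w: "loc_integrable w" "\<And>x. x < 0 \<Longrightarrow> w x = 0"
    and W_w: "\<And>a t. 0 \<le> a \<Longrightarrow> 0 \<le> t \<Longrightarrow> W (a + t) = W a + half_conv (\<lambda>_. 1) (\<lambda>z. w (a + z)) t"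
    and D: "countable D" "\<And>x. 0 < x \<Longrightarrow> x \<notin> D \<Longrightarrow> deriv W x = w x"
    by (rule W_density) (assumption | rule that)+
  have wa: "loc_integrable (\<lambda>z. w (a + z))"
    unfolding loc_integrable_def
  proof (intro conjI allI)
    show "(\<lambda>z. w (a + z)) \<in> borel_measurable borel" using loc_integrable_measurable[OF w(1)] by simp
    fix t
    have "integrable lborel (\<lambda>z. indicator {0..a + t} z *\<^sub>R w z)"
      using w by (simp add: loc_integrable_def set_integrable_def)
    from lborel_integrable_real_affine[OF this, of 1 a]
    have "integrable lborel (\<lambda>z. indicator {0..a + t} (a + z) *\<^sub>R w (a + z))" by simp
    from integrable_mult_indicator[OF _ this, of "{0..t}"]
    have "integrable lborel (\<lambda>z. indicator {0..t} z *\<^sub>R (indicator {0..a + t} (a + z) *\<^sub>R w (a + z)))" by simp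
    moreover have "indicator {0..t} z *\<^sub>R (indicator {0..a + t} (a + z) *\<^sub>R w (a + z)) = indicator {0..t} z *\<^sub>R w (a + z)" for z
      using a by (auto split: split_indicator)
    ultimately show "set_integrable lborel {0..t} (\<lambda>z. w (a + z))"
      unfolding set_integrable_def by (simp only:)
  qed
  \<comment> \<open>\<open>deriv W\<close> agrees with the density off a countable set. The point 0
    is excluded as well: for \<open>a = 0\<close> it is outside the range where the derivative is
    known.\<close>
  have "half_conv V (\<lambda>z. deriv W (a + z)) t = half_conv V (\<lambda>z. w (a + z)) t"
    unfolding half_conv_def set_lebesgue_integral_def
  proof (rule integral_discrete_difference[where X="insert 0 ((\<lambda>d. d - a) ` D)"])
    show "indicator {0..t} y *\<^sub>R (V (t - y) * deriv W (a + y)) = indicator {0..t} y *\<^sub>R (V (t - y) * w (a + y))"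
      if "y \<notin> insert 0 ((\<lambda>d. d - a) ` D)" for y
    proof (cases "y \<in> {0..t}")
      case True
      have "a + y \<notin> D" using that by (auto simp: image_iff)
      then show ?thesis using True that a D(2)[of "a + y"] by auto
    qed simp
  qed (use D in auto)
  moreover have "half_conv V (overshoot W a) t = (c - \<delta>) * W a * V t - W (a + t) - \<delta> * half_conv V (\<lambda>z. w (a + z)) t
      + (q - p) * half_conv V (\<lambda>z. W (a + z)) t + 0 * half_conv V (\<lambda>_. 1) t"
    by (rule half_conv_identity[OF V shift_bounded(2,1)[OF W_cont meas(1) a] tail_loc_integrable
          overshoot_loc_integrable[OF lin_growth_W] wa V_eq _ _ t])
       (use convolution_W[OF a] W_w[OF a] in auto)
  ultimately show ?thesis by simp
qed

text \<open>The density of \<open>Z\<close> is \<open>q * W\<close>. Splitting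
  \<open>Z = 1 + q * Wbar\<close> in the term \<open>(q - p) V * Z\<close> yields the primitive of
  \<open>V\<close> and the \<open>Wbar\<close> part of the last convolution.\<close>

lemma resolvent_Z:
  assumes V: "loc_bounded V" "continuous_on {0..} V"
    and V_eq: "\<And>t. 0 \<le> t \<Longrightarrow> (c - \<delta>) * V t = 1 + half_conv V tail t + p * half_conv V (\<lambda>_. 1) t"
    and a: "0 \<le> a" and t: "0 \<le> t"
  shows "half_conv V (overshoot Z a) t = (c - \<delta>) * Z a * V t - Z (a + t)
     - (p - q) * half_conv (\<lambda>_. 1) V t + q * half_conv V (\<lambda>z. (q - p) * Wbar (a + z) - \<delta> * W (a + z)) t"
proof -
  note Vi = loc_bounded_imp_integrable[OF V(1)]
  have qWbar: "loc_bounded (\<lambda>z. q * Wbar (a + z))"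
    by (rule shift_bounded(2)[of "\<lambda>z. q * Wbar z"]) (auto intro!: continuous_intros Wbar_cont a)
  have lWbar: "loc_bounded (\<lambda>z. (q - p) * Wbar (a + z))"
    by (rule shift_bounded(2)[of "\<lambda>z. (q - p) * Wbar z"]) (auto intro!: continuous_intros Wbar_cont a)
  have lW: "loc_bounded (\<lambda>z. (- \<delta>) * W (a + z))"
    by (rule shift_bounded(2)[of "\<lambda>z. (- \<delta>) * W z"]) (auto intro!: continuous_intros W_cont a)
  have Wa: "loc_integrable (\<lambda>z. q * W (a + z))"
    by (rule loc_bounded_imp_integrable, rule shift_bounded(2)[of "\<lambda>z. q * W z"])
       (auto intro!: continuous_intros W_cont a)
  have "half_conv V (overshoot Z a) t = (c - \<delta>) * Z a * V t - Z (a + t) - \<delta> * half_conv V (\<lambda>z. q * W (a + z)) t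
      + (q - p) * half_conv V (\<lambda>z. Z (a + z)) t + 0 * half_conv V (\<lambda>_. 1) t"
  proof (rule half_conv_identity[OF V shift_bounded(2,1)[OF Z_cont meas(4) a] tail_loc_integrable
          overshoot_loc_integrable[OF lin_growth_Z] Wa V_eq _ _ t])
    fix s :: real assume s: "0 \<le> s"
    show "c * (Z (a + s) - Z a) = half_conv (\<lambda>z. Z (a + z)) tail s - half_conv (\<lambda>_. 1) (overshoot Z a) s
       + q * half_conv (\<lambda>z. Z (a + z)) (\<lambda>_. 1) s + 0 * half_conv (\<lambda>_. 1) (\<lambda>_. 1) s"
      using convolution_Z[OF a s] by simp
    show "Z (a + s) = Z a + half_conv (\<lambda>_. 1) (\<lambda>z. q * W (a + z)) s"
      using Wbar_increment[OF s, of a] by (simp add: half_conv_one Z_def algebra_simps)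
  qed
  also have "half_conv V (\<lambda>z. q * W (a + z)) t = q * half_conv V (\<lambda>z. W (a + z)) t"
    by (simp add: half_conv_commute[of V] half_conv_mult_left)
  also have "half_conv V (\<lambda>z. Z (a + z)) t = half_conv (\<lambda>z. 1 + q * Wbar (a + z)) V t"
    by (simp add: half_conv_commute[of V] Z_def)
  also have "\<dots> = half_conv (\<lambda>_. 1) V t + q * half_conv (\<lambda>z. Wbar (a + z)) V t"
    unfolding half_conv_mult_left[symmetric]
    by (rule half_conv_add_left[OF loc_bounded_one qWbar Vi])
  also have "half_conv (\<lambda>z. Wbar (a + z)) V t = half_conv V (\<lambda>z. Wbar (a + z)) t"
    by (rule half_conv_commute)
  finally have 1: "half_conv V (overshoot Z a) t = (c - \<delta>) * Z a * V t - Z (a + t) - \<delta> * (q * half_conv V (\<lambda>z. W (a + z)) t)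
      + (q - p) * (half_conv (\<lambda>_. 1) V t + q * half_conv V (\<lambda>z. Wbar (a + z)) t)" by simp
  have "half_conv V (\<lambda>z. (q - p) * Wbar (a + z) - \<delta> * W (a + z)) t
      = half_conv (\<lambda>z. (q - p) * Wbar (a + z) + (- \<delta>) * W (a + z)) V t"
    by (simp add: half_conv_commute[of V])
  also have "\<dots> = (q - p) * half_conv (\<lambda>z. Wbar (a + z)) V t + (- \<delta>) * half_conv (\<lambda>z. W (a + z)) V t"
    unfolding half_conv_mult_left[symmetric]
    by (rule half_conv_add_left[OF lWbar lW Vi])
  finally have 2: "half_conv V (\<lambda>z. (q - p) * Wbar (a + z) - \<delta> * W (a + z)) t
      = (q - p) * half_conv V (\<lambda>z. Wbar (a + z)) t - \<delta> * half_conv V (\<lambda>z. W (a + z)) t"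
    by (simp add: half_conv_commute[of _ V])
  show ?thesis unfolding 1 2 by (simp add: algebra_simps)
qed

lemma resolvent_Zbar:
  assumes int: "integrable \<nu> (\<lambda>u. u)" and V: "loc_bounded V" "continuous_on {0..} V"
    and V_eq: "\<And>t. 0 \<le> t \<Longrightarrow> (c - \<delta>) * V t = 1 + half_conv V tail t + p * half_conv V (\<lambda>_. 1) t"
    and a: "0 \<le> a" and t: "0 \<le> t"
  shows "half_conv V (overshoot Zbar a) t = (c - \<delta>) * Zbar a * V t - Zbar (a + t)
     - \<delta> * half_conv V (\<lambda>z. Z (a + z)) t + (q - p) * half_conv V (\<lambda>z. Zbar (a + z)) t
     + (c + (LINT u|\<nu>. u)) * half_conv (\<lambda>_. 1) V t"
proof -
  have "half_conv V (overshoot Zbar a) t = (c - \<delta>) * Zbar a * V t - Zbar (a + t)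
     - \<delta> * half_conv V (\<lambda>z. Z (a + z)) t + (q - p) * half_conv V (\<lambda>z. Zbar (a + z)) t
     + (c + (LINT u|\<nu>. u)) * half_conv V (\<lambda>_. 1) t"
  proof (rule half_conv_identity[OF V shift_bounded(2,1)[OF Zbar_cont meas(5) a] tail_loc_integrable
          overshoot_loc_integrable[OF lin_growth_Zbar[OF int]]
          loc_bounded_imp_integrable[OF shift_bounded(2)[OF Z_cont meas(4) a]] V_eq _ _ t])
    fix s :: real assume s: "0 \<le> s"
    show "c * (Zbar (a + s) - Zbar a) = half_conv (\<lambda>z. Zbar (a + z)) tail s - half_conv (\<lambda>_. 1) (overshoot Zbar a) s
       + q * half_conv (\<lambda>z. Zbar (a + z)) (\<lambda>_. 1) s + (c + (LINT u|\<nu>. u)) * half_conv (\<lambda>_. 1) (\<lambda>_. 1) s"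
      by (rule convolution_Zbar[OF int a s])
    show "Zbar (a + s) = Zbar a + half_conv (\<lambda>_. 1) (\<lambda>z. Z (a + z)) s"
      using Zbar_increment[OF s, of a] by (simp add: half_conv_one)
  qed
  then show ?thesis by (simp add: half_conv_commute[of V "\<lambda>_. 1"])
qed

text \<open>The landing point is below \<open>a\<close>, so \<open>Zbar\<close> is at most
  \<open>Zbar a\<close> there, and the positive part is finite because the tail has finite mass.
  Moreover \<open>Zbar\<close> exceeds the identity by at most \<open>q * Wbarbar a\<close>, so the
  negative part inherits the infinite first moment.\<close>

lemma ext_integral_Zbar_infinite:
  assumes nint: "\<not> integrable \<nu> (\<lambda>u. u)" and y: "0 < y" and r: "0 < r"
  shows "ext_integral \<nu> {..<-y} (\<lambda>u. ereal (Zbar (a + y + u) * r)) = - \<infinity>"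
proof -
  let ?p = "\<integral>\<^sup>+ u\<in>{..<-y}. e2ennreal (ereal (Zbar (a + y + u) * r)) \<partial>\<nu>"
  let ?n = "\<integral>\<^sup>+ u\<in>{..<-y}. e2ennreal (- ereal (Zbar (a + y + u) * r)) \<partial>\<nu>"
  have tail_fin: "emeasure \<nu> {..<-y} < \<infinity>" by (rule emeasure_tail_finite[OF y])
  have "?p \<le> (\<integral>\<^sup>+ u. ennreal (Zbar a * r) * indicator {..<-y} u \<partial>\<nu>)"
  proof (intro nn_integral_mono)
    fix u
    have "Zbar (a + y + u) * r \<le> Zbar a * r" if "u < - y"
      using that r monoD[OF mono_Zbar, of "a + y + u" a] by (intro mult_right_mono) auto
    then show "e2ennreal (ereal (Zbar (a + y + u) * r)) * indicator {..<-y} u \<le> ennreal (Zbar a * r) * indicator {..<-y} u"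
      by (auto simp: e2ennreal_ereal intro!: ennreal_leI split: split_indicator)
  qed
  also have "\<dots> < \<infinity>" using tail_fin by (simp add: nn_integral_cmult ennreal_mult_less_top)
  finally have pos: "?p < \<infinity>" .
  have neg: "?n = \<infinity>"
  proof (rule ccontr)
    assume "\<not> ?thesis"
    then have fin: "?n < \<infinity>" by (simp add: less_top)
    define C where "C = \<bar>a + y\<bar> + q * Wbarbar a"
    have C: "0 \<le> C" using q Wbarbar_nonneg by (simp add: C_def)
    have "(\<integral>\<^sup>+ u\<in>{..<-y}. ennreal (- u) \<partial>\<nu>)
      \<le> (\<integral>\<^sup>+ u. ennreal (1 / r) * (e2ennreal (- ereal (Zbar (a + y + u) * r)) * indicator {..<-y} u) + ennreal C * indicator {..<-y} u \<partial>\<nu>)"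
    proof (intro nn_integral_mono)
      fix u
      show "ennreal (- u) * indicator {..<-y} u \<le> ennreal (1 / r) * (e2ennreal (- ereal (Zbar (a + y + u) * r)) * indicator {..<-y} u) + ennreal C * indicator {..<-y} u"
      proof (cases "u < - y")
        case True
        have "q * Wbarbar (a + y + u) \<le> q * Wbarbar a" using q True monoD[OF mono_Wbarbar, of "a + y + u" a] by (intro mult_left_mono) auto
        then have "- u \<le> - Zbar (a + y + u) + C" by (simp add: Zbar_def C_def)
        then have "ennreal (- u) \<le> ennreal (max 0 (- Zbar (a + y + u)) + C)" by (intro ennreal_leI) auto
        also have "\<dots> = ennreal (- Zbar (a + y + u)) + ennreal C"
          using C by (simp add: ennreal_plus ennreal_max_0)
        also have "ennreal (- Zbar (a + y + u)) = ennreal (1 / r) * ennreal (- Zbar (a + y + u) * r)"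
          using r by (simp add: ennreal_mult'[symmetric])
        finally show ?thesis using True by (simp add: e2ennreal_ereal)
      qed simp
    qed
    also have "\<dots> = ennreal (1 / r) * ?n + ennreal C * emeasure \<nu> {..<-y}"
      by (simp add: nn_integral_add nn_integral_cmult)
    also have "\<dots> < \<infinity>" using fin tail_fin by (simp add: ennreal_mult_less_top)
    finally show False using nn_integral_tail_infinite[OF nint y] by simp
  qed
  obtain z where "?p = ennreal z" "0 \<le> z"
    using pos by (metis ennreal_cases infinity_ennreal_def less_irrefl)
  then show ?thesis unfolding ext_integral_def neg by (simp add: enn2ereal_ennreal)
qed

end

lemma ext_integral_zero: "ext_integral M A (\<lambda>_. 0) = 0"
  by (simp add: ext_integral_def zero_ereal_def[symmetric])

lemma (in bv_jumps) bv_scaleI: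
  assumes c: "0 < c" and q: "0 \<le> q"
    and \<psi>: "\<And>\<theta>. 0 \<le> \<theta> \<Longrightarrow> \<psi> \<theta> = c * \<theta> - (LINT u:{..<0}|\<nu>. 1 - exp (\<theta> * u))"
    and W: "is_scale_function \<psi> q W"
  shows "bv_scale \<nu> c q W"
proof unfold_locales
  show "c * W t = 1 + half_conv W tail t + q * half_conv W (\<lambda>_. 1) t" if "0 \<le> t" for t
    by (rule scale_function_convolution_eq[OF c q \<psi> W that])
  show "W \<in> borel_measurable borel" by (rule scale_function_measurable[OF W])
qed (use c q W in \<open>auto simp: is_scale_function_def\<close>)

theorem lemma3p1:
  fixes M :: "'w measure" and X Y :: "real \<Rightarrow> 'w \<Rightarrow> real"
    and c \<delta> b p q v x :: real and \<nu> :: "real measure"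
    and \<psi> \<psi>Y W WW :: "real \<Rightarrow> real"
  assumes X: "spectrally_negative_bv M X c \<nu>"
    and b: "0 < b"
    and \<delta>: "0 \<le> \<delta>" "\<delta> < c"
    and Y: "Y = (\<lambda>t \<omega>. X t \<omega> - \<delta> * t)"
    and \<psi>: "\<psi> = laplace_exponent M X"
    and \<psi>Y: "\<psi>Y = laplace_exponent M Y"
    and pq: "0 \<le> p" "0 \<le> q"
    and W: "is_scale_function \<psi> q W"
    and WW: "is_scale_function \<psi>Y p WW"
    and vbx: "v \<le> b" "b \<le> x"
  shows
    "ext_integral lborel {0..} (\<lambda>y. ext_integral \<nu> {..<-y}
        (\<lambda>u. ereal (W (y + u + b - v) * WW (x - b - y)))) =
     ereal ((c - \<delta>) * W (b - v) * WW (x - b) - W (x - v)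
       - \<delta> * (LBINT y=b..x. WW (x - y) * deriv W (y - v))
       + (q - p) * (LBINT z=b..x. WW (x - z) * W (z - v)))
     \<and>
     ext_integral lborel {0..} (\<lambda>y. ext_integral \<nu> {..<-y}
        (\<lambda>u. ereal (scale_Z q W (y + u + b - v) * WW (x - b - y)))) =
     ereal ((c - \<delta>) * scale_Z q W (b - v) * WW (x - b) - scale_Z q W (x - v)
       - (p - q) * scale_Wbar WW (x - b)
       + q * (LBINT y=b..x. WW (x - y) * ((q - p) * scale_Wbar W (y - v) - \<delta> * W (y - v))))
     \<and>
     ext_integral lborel {0..} (\<lambda>y. ext_integral \<nu> {..<-y}
        (\<lambda>u. ereal (scale_Zbar q W (y + u + b - v) * WW (x - b - y)))) =
     ereal ((c - \<delta>) * scale_Zbar q W (b - v) * WW (x - b) - scale_Zbar q W (x - v)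
       - \<delta> * (LBINT y=b..x. WW (x - y) * scale_Z q W (y - v))
       + (q - p) * (LBINT y=b..x. WW (x - y) * scale_Zbar q W (y - v)))
     + deriv_zero_plus \<psi> * ereal (scale_Wbar WW (x - b))"
proof -
  have c: "0 < c" using \<delta> by simp
  have "bv_levy_measure \<nu>"
    using X by (auto simp: spectrally_negative_bv_def driftless_subordinator_def)
  then interpret bv_jumps \<nu> by unfold_locales
  have \<psi>_eq: "\<psi> \<theta> = c * \<theta> - (LINT u:{..<0}|\<nu>. 1 - exp (\<theta> * u))" if "0 \<le> \<theta>" for \<theta>
    unfolding \<psi> by (rule laplace_exponent_bv[OF X that])
  have \<psi>Y_eq: "\<psi>Y \<theta> = (c - \<delta>) * \<theta> - (LINT u:{..<0}|\<nu>. 1 - exp (\<theta> * u))" if "0 \<le> \<theta>" for \<theta>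
    unfolding \<psi>Y Y by (rule laplace_exponent_bv[OF spectrally_negative_bv_drift[OF X \<delta>(2)] that])
  interpret P: bv_scale \<nu> c q W
    by (rule bv_scaleI[OF c pq(2) \<psi>_eq W])
  interpret Q: bv_scale \<nu> "c - \<delta>" p WW
    by (rule bv_scaleI[OF _ pq(1) \<psi>Y_eq WW]) (use \<delta> in simp)
  define a where "a = b - v"
  define t where "t = x - b"
  have a: "0 \<le> a" and t: "0 \<le> t" using vbx by (auto simp: a_def t_def)
  have args: "y + u + b - v = a + y + u" "x - b - y = t - y" "x - v = a + t" for y u
    by (simp_all add: a_def t_def)
  note conv = interval_integral_eq_half_conv[OF vbx(2), of WW _ v, folded a_def t_def]
  note V = Q.W_bounded Q.W_cont Q.W_eq
  have Q_Wbar: "Q.Wbar t = half_conv (\<lambda>_. 1) WW t" by (simp add: Q.Wbar_def)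
  note scale = P.scale_Wbar_eq P.scale_Z_eq P.scale_Zbar_eq Q.scale_Wbar_eq Q_Wbar
  let ?I = "\<lambda>F. ext_integral lborel {0..} (\<lambda>y. ext_integral \<nu> {..<-y} (\<lambda>u. ereal (F (a + y + u) * WW (t - y))))"
  have I: "?I F = ereal (half_conv WW (overshoot F a) t)" if "lin_growth F" for F
    by (rule ext_integral_overshoot[OF that Q.W_bounded Q.W_neg])
  define R where "R = (c - \<delta>) * P.Zbar a * WW t - P.Zbar (a + t) - \<delta> * half_conv WW (\<lambda>z. P.Z (a + z)) t
      + (q - p) * half_conv WW (\<lambda>z. P.Zbar (a + z)) t"
  have iii: "?I P.Zbar = ereal R + deriv_zero_plus \<psi> * ereal (half_conv (\<lambda>_. 1) WW t)"
  proof (cases "integrable \<nu> (\<lambda>u. u)")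
    case True
    have "?I P.Zbar = ereal (R + (c + (LINT u|\<nu>. u)) * half_conv (\<lambda>_. 1) WW t)"
      using P.resolvent_Zbar[OF True V a t] unfolding I[OF P.lin_growth_Zbar[OF True]] R_def by simp
    then show ?thesis by (simp add: deriv_zero_plus_finite[OF \<psi>_eq True])
  next
    case False
    let ?J = "\<lambda>y. ext_integral \<nu> {..<-y} (\<lambda>u. ereal (P.Zbar (a + y + u) * WW (t - y)))"
    have after: "?J y = 0" if "t < y" for y
      using that ext_integral_zero[of \<nu> "{..<-y}"] by (simp add: Q.W_neg zero_ereal_def)
    have d: "deriv_zero_plus \<psi> = - \<infinity>" by (rule deriv_zero_plus_infinite[OF \<psi>_eq False])
    show ?thesis
    proof (cases "t = 0")
      \<comment> \<open>The inner integral is 0 for almost every \<open>y\<close>, and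
        \<open>R\<close> vanishes because \<open>(c - \<delta>) * WW 0 = 1\<close>. The last term is
        \<open>- \<infinity> * 0\<close>, which is 0 in \<open>ereal\<close>.\<close>
      case True
      have "?I P.Zbar = ext_integral lborel {0..} (\<lambda>_::real. 0)"
      proof (rule ext_integral_cong_AE)
        show "AE y in lborel. y \<in> {0..} \<longrightarrow> ?J y = 0"
          using AE_lborel_singleton[of "0::real"] by eventually_elim (use after True in auto)
      qed
      then show ?thesis
        using \<delta> by (simp add: True R_def half_conv_0 Q.W_0 ext_integral_zero d zero_ereal_def[symmetric])
    next
      case False
      then have t_pos: "0 < t" using t by simp
      \<comment> \<open>For \<open>0 < y <= t\<close> the factor \<open>WW (t - y)\<close> is
        positive, also at \<open>y = t\<close> because \<open>WW 0 > 0\<close>, so the inner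
        integral is \<open>- \<infinity>\<close> on a set of positive length.\<close>
      have "?I P.Zbar = ext_integral lborel {0..} (\<lambda>y::real. if y \<le> t then - \<infinity> else 0)"
      proof (rule ext_integral_cong_AE)
        show "AE y in lborel. y \<in> {0..} \<longrightarrow> ?J y
            = (if y \<le> t then - \<infinity> else 0)"
          using AE_lborel_singleton[of "0::real"]
          by eventually_elim (use after \<open>\<not> integrable \<nu> (\<lambda>u. u)\<close> in \<open>auto intro!: P.ext_integral_Zbar_infinite Q.W_pos\<close>)
      qed
      also have "\<dots> = - \<infinity>"
      proof -
        have pos: "(\<integral>\<^sup>+ y\<in>{0..}. e2ennreal (if y \<le> t then - \<infinity> else 0) \<partial>lborel) = (\<integral>\<^sup>+ (y::real). 0 \<partial>lborel)"
          by (intro nn_integral_cong) (auto simp: e2ennreal_neg)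
        have "(\<integral>\<^sup>+ y\<in>{0..}. e2ennreal (- (if y \<le> t then - \<infinity> else 0)) \<partial>lborel) = (\<integral>\<^sup>+ y. \<infinity> * indicator {0..t} y \<partial>lborel)"
          by (intro nn_integral_cong) (auto split: split_indicator)
        also have "\<dots> = \<infinity> * emeasure lborel {0..t}" by (rule nn_integral_cmult_indicator) simp
        also have "\<dots> = \<infinity>" using t_pos by (simp add: ennreal_top_mult)
        finally show ?thesis unfolding ext_integral_def pos by (simp add: zero_ennreal.rep_eq)
      qed
      also have "\<dots> = ereal R + deriv_zero_plus \<psi> * ereal (half_conv (\<lambda>_. 1) WW t)"
      proof -
        \<comment> \<open>By monotonicity \<open>WW 0 * t\<close> bounds the integral of
          \<open>WW\<close> from below, so \<open>- \<infinity>\<close> is multiplied by a positive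
          number.\<close>
        have "0 < WW 0 * t" using t_pos by (simp add: Q.W_pos)
        also have "WW 0 * t = (LBINT y:{0..t}. WW 0)" using t by (simp add: set_lebesgue_integral_def)
        also have "\<dots> \<le> (LBINT y:{0..t}. WW y)"
        proof (rule set_integral_mono[OF set_integrable_const_Icc])
          show "set_integrable lborel {0..t} WW" using Q.W_int by (simp add: loc_integrable_def)
        qed (use monoD[OF Q.mono_W] in auto)
        finally show ?thesis by (simp add: d half_conv_one)
      qed
      finally show ?thesis .
    qed
  qed
  have "?I W = ereal ((c - \<delta>) * W a * WW t - W (a + t) - \<delta> * half_conv WW (\<lambda>z. deriv W (a + z)) t
      + (q - p) * half_conv WW (\<lambda>z. W (a + z)) t)"
    using P.resolvent_W[OF V a t] I[OF P.lin_growth_W] by simp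
  moreover have "?I P.Z = ereal ((c - \<delta>) * P.Z a * WW t - P.Z (a + t) - (p - q) * half_conv (\<lambda>_. 1) WW t
      + q * half_conv WW (\<lambda>z. (q - p) * P.Wbar (a + z) - \<delta> * W (a + z)) t)"
    using P.resolvent_Z[OF V a t] I[OF P.lin_growth_Z] by simp
  moreover note iii
  ultimately show ?thesis
    unfolding args scale a_def[symmetric] t_def[symmetric] R_def
      conv[of "deriv W"] conv[of W] conv[of P.Z] conv[of P.Zbar] conv[of "\<lambda>z. (q - p) * P.Wbar z - \<delta> * W z"]
    by (intro conjI)
qed

end
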